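(* Let $M$ be either $B_n^+$ or $B_n^{+*}$ ($n\ge2$). Let $p\in(0,q_n]$ and let $\nu_p$ be the uniform measure of parameter $p$ on $\overline M$. Let $h:\mathcal S_n\to\mathbb R$ be $h(x)=\sum_{X\subseteq\Sigma:\ x\Delta_X\in\mathcal S_n}(-1)^{|X|}p^{|x\Delta_X|}$. For $k\ge1$ let $X_k:\overline M\to\mathcal S_n$, $X_k(\xi)=\xi_k$. Then: (1) under $\nu_p$, $(X_k)_{k\ge1}$ is a Markov chain, with values in $\mathcal S_n$ if $p<q_n$ and in $\mathcal S_n\setminus\{\mathbf e\}$ if $p=q_n$; (2) its initial distribution is $h$, which is a probability distribution on $\mathcal S_n$ giving positive weight to every non-unit simple braid, and giving positive weight to $\mathbf e$ if and only if $p<q_n$; (3) its transition matrix is $P_{x,x'}=\mathbf 1_{\{x\to x'\}}\,p^{|x|}\,h(x')/h(x)$, where $x,x'$ range over $\mathcal S_n$ if $p<q_n$ and over $\mathcal S_n\setminus\{\mathbf e\}$ if $p=q_n$.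
   Context: $M$ is either (a) the positive braid monoid $B_n^+$, generated by $\Sigma=\{\sigma_1,\dots,\sigma_{n-1}\}$ with relations $\sigma_i\sigma_j=\sigma_j\sigma_i$ for $|i-j|\ge2$, $\sigma_i\sigma_j\sigma_i=\sigma_j\sigma_i\sigma_j$ for $|i-j|=1$; or (b) the dual braid monoid $B_n^{+*}$, generated by $\Sigma=\{\sigma_{i,j}:1\le i<j\le n\}$ ($\sigma_{j,i}=\sigma_{i,j}$) with relations $\sigma_{i,j}\sigma_{j,k}=\sigma_{j,k}\sigma_{k,i}=\sigma_{k,i}\sigma_{i,j}$ for $i<j<k$ and $\sigma_{i,j}\sigma_{k,\ell}=\sigma_{k,\ell}\sigma_{i,j}$ whenever $i<j<k<\ell$ or $i<k<\ell<j$. Unit $\mathbf e$; $|x|$ word length; $x\le_l y$ iff $y=xz$. $M$ is a Garside monoid; $\Delta_X$ is the least upper bound of $X\subseteq\Sigma$ for $\le_l$, $\Delta=\Delta_\Sigma$, $\mathcal S_n$ the set of left divisors of $\Delta$. For $x\in\mathcal S_n$, $\mathsf R(x)=\{\sigma\in\Sigma:x\sigma\notin\mathcal S_n\}$, $\mathsf L(x)=\{\sigma\in\Sigma:\sigma\le_l x\}$, $x\to y$ iff $\mathsf L(y)\subseteq\mathsf R(x)$. Every $x\neq\mathbf e$ has a unique Garside normal form $(x_1,\dots,x_k)$ (non-unit simple braids, $x=x_1\cdots x_k$, $x_i\to x_{i+1}$); the normal form of $\mathbf e$ is $(\mathbf e)$. $q_n$ is the radius of convergence of $G_n(t)=\sum_{x\in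 M}t^{|x|}$. $\overline M$ is the set of sequences $\xi=(\xi_k)_{k\ge1}$ in $\mathcal S_n$ with $\xi_k\to\xi_{k+1}$ for all $k$, with product topology ($\mathcal S_n$ discrete) and Borel $\sigma$-algebra; $M$ is identified with sequences eventually equal to $\mathbf e$ via $x\mapsto$ its normal form followed by infinitely many $\mathbf e$. $\Uparrow x$ is the closure in $\overline M$ of $\{xz:z\in M\}$. A uniform measure of parameter $p\ge0$ is a probability measure $\nu$ on $\overline M$ with $\nu(\Uparrow x)=p^{|x|}$ for all $x\in M$; for each $p\in(0,q_n]$ such a measure exists and is unique. *)

theory Defs
  imports "HOL-Analysis.Analysis" "HOL-Probability.Probability"
begin

datatype mkind = Classical | Dual

datatype gen = S nat | D nat nat
  \<comment> \<open>S i = sigma_i (classical); D i j = sigma_{i,j} with i<j (dual)\<close>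

definition Sigma_gens :: "mkind \<Rightarrow> nat \<Rightarrow> gen set" where
  "Sigma_gens K n = (case K of
      Classical \<Rightarrow> {S i | i. 1 \<le> i \<and> i \<le> n - 1}
    | Dual \<Rightarrow> {D i j | i j. 1 \<le> i \<and> i < j \<and> j \<le> n})"

definition rels :: "mkind \<Rightarrow> nat \<Rightarrow> (gen list \<times> gen list) set" where
  "rels K n = (case K of
      Classical \<Rightarrow>
        {([S i, S j], [S j, S i]) | i j. S i \<in> Sigma_gens K n \<and> S j \<in> Sigma_gens K n
              \<and> (i + 2 \<le> j \<or> j + 2 \<le> i)}
      \<union> {([S i, S j, S i], [S j, S i, S j]) | i j. S i \<in> Sigma_gens K n \<and> S j \<in> Sigma_gens K n
              \<and> (j = i + 1 \<or> i = j + 1)}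
    | Dual \<Rightarrow>
        {([D i j, D j k], [D j k, D i k]) | i j k. 1 \<le> i \<and> i < j \<and> j < k \<and> k \<le> n}
      \<union> {([D j k, D i k], [D i k, D i j]) | i j k. 1 \<le> i \<and> i < j \<and> j < k \<and> k \<le> n}
      \<union> {([D i j, D k l], [D k l, D i j]) | i j k l. 1 \<le> i \<and> l \<le> n \<and>
              ((i < j \<and> j < k \<and> k < l) \<or> (i < k \<and> k < l \<and> l < j))})"

inductive weq :: "mkind \<Rightarrow> nat \<Rightarrow> gen list \<Rightarrow> gen list \<Rightarrow> bool" for K n where
  weq_refl: "weq K n w w"
| weq_sym: "weq K n u v \<Longrightarrow> weq K n v u"
| weq_trans: "weq K n u v \<Longrightarrow> weq K n v w \<Longrightarrow> weq K n u w"
| weq_rel: "(l, r) \<in> rels K n \<Longrightarrow> weq K n (u @ l @ v) (u @ r @ v)"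

type_synonym elt = "gen list set"

definition cls :: "mkind \<Rightarrow> nat \<Rightarrow> gen list \<Rightarrow> elt" where
  "cls K n w = {v. weq K n w v}"

definition Mon :: "mkind \<Rightarrow> nat \<Rightarrow> elt set" where
  "Mon K n = cls K n ` lists (Sigma_gens K n)"

definition unit_e :: "mkind \<Rightarrow> nat \<Rightarrow> elt" where
  "unit_e K n = cls K n []"

definition gelt :: "mkind \<Rightarrow> nat \<Rightarrow> gen \<Rightarrow> elt" where
  "gelt K n s = cls K n [s]"

definition mult :: "mkind \<Rightarrow> nat \<Rightarrow> elt \<Rightarrow> elt \<Rightarrow> elt" where
  "mult K n x y = cls K n ((SOME u. u \<in> x) @ (SOME v. v \<in> y))"

text \<open>Word length (well defined since relations are homogeneous).\<close>
definition len :: "elt \<Rightarrow> nat" where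
  "len x = length (SOME w. w \<in> x)"

definition ldiv :: "mkind \<Rightarrow> nat \<Rightarrow> elt \<Rightarrow> elt \<Rightarrow> bool" where
  "ldiv K n x y \<longleftrightarrow> (\<exists>z \<in> Mon K n. y = mult K n x z)"

definition DeltaX :: "mkind \<Rightarrow> nat \<Rightarrow> gen set \<Rightarrow> elt" where
  "DeltaX K n X = (THE d. d \<in> Mon K n \<and> (\<forall>s\<in>X. ldiv K n (gelt K n s) d) \<and>
       (\<forall>d'\<in>Mon K n. (\<forall>s\<in>X. ldiv K n (gelt K n s) d') \<longrightarrow> ldiv K n d d'))"

definition Delta :: "mkind \<Rightarrow> nat \<Rightarrow> elt" where
  "Delta K n = DeltaX K n (Sigma_gens K n)"

definition Simples :: "mkind \<Rightarrow> nat \<Rightarrow> elt set" where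
  "Simples K n = {x \<in> Mon K n. ldiv K n x (Delta K n)}"

definition Rset :: "mkind \<Rightarrow> nat \<Rightarrow> elt \<Rightarrow> gen set" where
  "Rset K n x = {s \<in> Sigma_gens K n. mult K n x (gelt K n s) \<notin> Simples K n}"

definition Lset :: "mkind \<Rightarrow> nat \<Rightarrow> elt \<Rightarrow> gen set" where
  "Lset K n x = {s \<in> Sigma_gens K n. ldiv K n (gelt K n s) x}"

definition arrow :: "mkind \<Rightarrow> nat \<Rightarrow> elt \<Rightarrow> elt \<Rightarrow> bool" where
  "arrow K n x y \<longleftrightarrow> Lset K n y \<subseteq> Rset K n x"

definition prodl :: "mkind \<Rightarrow> nat \<Rightarrow> elt list \<Rightarrow> elt" where
  "prodl K n xs = foldr (mult K n) xs (unit_e K n)"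

definition is_nf :: "mkind \<Rightarrow> nat \<Rightarrow> elt list \<Rightarrow> elt \<Rightarrow> bool" where
  "is_nf K n xs x \<longleftrightarrow>
     (x = unit_e K n \<and> xs = [unit_e K n]) \<or>
     (x \<noteq> unit_e K n \<and> xs \<noteq> [] \<and> set xs \<subseteq> Simples K n - {unit_e K n} \<and>
      prodl K n xs = x \<and> (\<forall>i. Suc i < length xs \<longrightarrow> arrow K n (xs ! i) (xs ! Suc i)))"

definition nf :: "mkind \<Rightarrow> nat \<Rightarrow> elt \<Rightarrow> elt list" where
  "nf K n x = (THE xs. is_nf K n xs x)"

text \<open>Sequences are indexed from 0: xi 0 is the first entry xi_1 of the paper.\<close>
definition Mbar :: "mkind \<Rightarrow> nat \<Rightarrow> (nat \<Rightarrow> elt) set" where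
  "Mbar K n = {xi. \<forall>k. xi k \<in> Simples K n \<and> arrow K n (xi k) (xi (Suc k))}"

definition embed :: "mkind \<Rightarrow> nat \<Rightarrow> elt \<Rightarrow> (nat \<Rightarrow> elt)" where
  "embed K n x = (\<lambda>k. if k < length (nf K n x) then nf K n x ! k else unit_e K n)"

definition Mbar_top :: "mkind \<Rightarrow> nat \<Rightarrow> (nat \<Rightarrow> elt) topology" where
  "Mbar_top K n = subtopology (product_topology (\<lambda>_. discrete_topology (Simples K n)) UNIV)
                     (Mbar K n)"

definition Mbar_borel :: "mkind \<Rightarrow> nat \<Rightarrow> (nat \<Rightarrow> elt) set set" where
  "Mbar_borel K n = sigma_sets (Mbar K n) {U. openin (Mbar_top K n) U}"

definition Up :: "mkind \<Rightarrow> nat \<Rightarrow> elt \<Rightarrow> (nat \<Rightarrow> elt) set" where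
  "Up K n x = (Mbar_top K n) closure_of (embed K n ` {mult K n x z | z. z \<in> Mon K n})"

definition qn :: "mkind \<Rightarrow> nat \<Rightarrow> ereal" where
  "qn K n = conv_radius (\<lambda>k. real (card {x \<in> Mon K n. len x = k}))"

definition unif_measure :: "mkind \<Rightarrow> nat \<Rightarrow> real \<Rightarrow> (nat \<Rightarrow> elt) measure \<Rightarrow> bool" where
  "unif_measure K n p \<nu> \<longleftrightarrow>
     prob_space \<nu> \<and> space \<nu> = Mbar K n \<and> sets \<nu> = Mbar_borel K n \<and>
     (\<forall>x \<in> Mon K n. measure \<nu> (Up K n x) = p ^ len x)"

definition hfun :: "mkind \<Rightarrow> nat \<Rightarrow> real \<Rightarrow> elt \<Rightarrow> real" where
  "hfun K n p x = (\<Sum>X \<in> {X. X \<subseteq> Sigma_gens K n \<and> mult K n x (DeltaX K n X) \<in> Simples K n}.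
       (-1) ^ card X * p ^ len (mult K n x (DeltaX K n X)))"

definition trans_mat :: "mkind \<Rightarrow> nat \<Rightarrow> real \<Rightarrow> elt \<Rightarrow> elt \<Rightarrow> real" where
  "trans_mat K n p x x' = (if arrow K n x x' then p ^ len x * hfun K n p x' / hfun K n p x else 0)"

end

theory Submission
  imports Defs
begin

text \<open>
  Both monoids are obtained from a finite lattice of states that encodes the simple elements:
  inversion sets of permutations in the classical case, noncrossing partitions in the dual case,
  ordered by inclusion. Left division of a state by a generator is an explicit operation on
  states, and the residual of a state by a generator, taken through joins, is an action of the
  monoid. From this action one reads off left cancellation, least common multiples and the
  greatest simple left divisor, hence the Garside normal form.

  For a product \<open>z\<close> of \<open>k\<close> simple elements, \<open>\<Up>z\<close> consists of the sequences whose first \<open>k\<close> entries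
  have a product divisible by \<open>z\<close>. So a cylinder is \<open>\<Up>z\<close> minus a finite union of sets \<open>\<Up>(z \<sigma>)\<close>, and
  inclusion-exclusion gives its measure \<open>p\<^bsup>|x\<^sub>1\<dots>x\<^sub>k\<^sub>-\<^sub>1|\<^esup> h(x\<^sub>k)\<close>; this is the Markov property, and it yields
  \<open>h(x) = p\<^bsup>|x|\<^esup> \<Sum> h(y)\<close>, the sum being over \<open>x \<rightarrow> y\<close>.

  Inclusion-exclusion for the counting measure shows that \<open>h(e)\<close> is the inverse of the growth
  series below the radius of convergence; at the radius it vanishes because the growth sequence is
  submultiplicative. Positivity of \<open>h\<close> travels backwards along arrows, so at the radius it is enough
  to lead every generator to a simple element \<open>y\<close> whose complement \<open>y\<inverse>\<Delta>\<close> only has commuting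
  atoms, where \<open>h(y)\<close> is a power of \<open>p\<close> times a power of \<open>1 - p\<close>.
\<close>

section \<open>Words and congruence\<close>

text \<open>The presentations come without an ambient group, so cancellation and common multiples
  have to be extracted from words. The recurring device is an invariant checked one relation at a
  time: the effect of a word on a state is the same for both sides of a defining relation, hence
  depends only on the element of the monoid. Positivity of \<open>h\<close> splits at the radius.
  Below it \<open>h(e) > 0\<close>, and every simple element has an arrow to \<open>e\<close>. At
  the radius \<open>h(e) = 0\<close>, and only \<open>e\<close> can follow \<open>e\<close>, so a
  path to a visibly positive value has to avoid \<open>e\<close>; this is why explicit paths are
  built in each monoid. The value found at their end contains a power of \<open>1 - p\<close>, so
  the radius must be kept away from 1 unless the exponent is 0. The generators on three strands do
  this: their Moebius polynomial is \<open>1 - 2t + t^3\<close> in the classical case and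
  \<open>(1 - t)(1 - 2t)\<close> in the dual case, and 3/4 is a convenient number between its
  smallest positive zero and 1.\<close>

lemma weq_context: "weq K n u v \<Longrightarrow> weq K n (a @ u @ b) (a @ v @ b)"
proof (induction rule: weq.induct)
  case (weq_rel l r u v)
  then have "weq K n ((a @ u) @ l @ (v @ b)) ((a @ u) @ r @ (v @ b))"
    by (rule weq.weq_rel)
  then show ?case by simp
qed (blast intro: weq.intros)+

lemma weq_append: "weq K n u u' \<Longrightarrow> weq K n v v' \<Longrightarrow> weq K n (u @ v) (u' @ v')"
  using weq_context[of K n u u' "[]" v] weq_context[of K n v v' u' "[]"]
  by (auto intro: weq_trans)

lemma weq_Cons: "weq K n u v \<Longrightarrow> weq K n (a # u) (a # v)"
  using weq_context[of K n u v "[a]" "[]"] by simp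

lemma cls_eq_iff: "cls K n u = cls K n v \<longleftrightarrow> weq K n u v"
  unfolding cls_def by (auto intro: weq_refl weq_sym weq_trans)

lemma weq_some: "weq K n u (SOME v. v \<in> cls K n u)"
proof -
  have "(SOME v. v \<in> cls K n u) \<in> cls K n u"
    by (rule someI[of _ u]) (simp add: cls_def weq_refl)
  then show ?thesis by (simp add: cls_def)
qed

text \<open>Congruence makes the representatives picked by \<open>SOME\<close> immaterial; from here
  on products are concatenations of words.\<close>

lemma mult_cls: "mult K n (cls K n u) (cls K n v) = cls K n (u @ v)"
  unfolding mult_def cls_eq_iff by (intro weq_append weq_sym[OF weq_some])

lemma rels_length: "(l, r) \<in> rels K n \<Longrightarrow> length l = length r"
  by (cases K) (auto simp: rels_def)

lemma rels_lists: "(l, r) \<in> rels K n \<Longrightarrow> l \<in> lists (Sigma_gens K n) \<longleftrightarrow> r \<in> lists (Sigma_gens K n)"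
  by (cases K) (auto simp: rels_def Sigma_gens_def)

lemma weq_length: "weq K n u v \<Longrightarrow> length u = length v"
  by (induction rule: weq.induct) (auto dest: rels_length)

lemma weq_lists: "weq K n u v \<Longrightarrow> u \<in> lists (Sigma_gens K n) \<longleftrightarrow> v \<in> lists (Sigma_gens K n)"
proof (induction rule: weq.induct)
  case (weq_rel l r u v)
  from rels_lists[OF this] show ?case by (simp add: in_lists_conv_set) blast
qed auto

lemma len_cls: "len (cls K n u) = length u"
  unfolding len_def using weq_length[OF weq_some] by metis

lemma finite_Sigma_gens: "finite (Sigma_gens K n)"
proof -
  have "{S i | i. 1 \<le> i \<and> i \<le> n - 1} \<subseteq> S ` {..n}"
    "{D i j | i j. 1 \<le> i \<and> i < j \<and> j \<le> n} \<subseteq> (\<lambda>(i,j). D i j) ` ({..n} \<times> {..n})"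
    by auto
  then show ?thesis
    by (cases K) (simp_all add: Sigma_gens_def finite_subset)
qed

section \<open>The monoid\<close>

lemma MonE:
  assumes "x \<in> Mon K n"
  obtains u where "u \<in> lists (Sigma_gens K n)" "x = cls K n u"
  using assms unfolding Mon_def by auto

lemma cls_Mon: "u \<in> lists (Sigma_gens K n) \<Longrightarrow> cls K n u \<in> Mon K n"
  unfolding Mon_def by auto

lemma unit_Mon [simp]: "unit_e K n \<in> Mon K n"
  unfolding unit_e_def by (simp add: cls_Mon)

lemma gelt_Mon [simp]: "s \<in> Sigma_gens K n \<Longrightarrow> gelt K n s \<in> Mon K n"
  unfolding gelt_def by (simp add: cls_Mon)

lemma mult_Mon [simp]: "x \<in> Mon K n \<Longrightarrow> y \<in> Mon K n \<Longrightarrow> mult K n x y \<in> Mon K n"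
  by (elim MonE) (simp add: mult_cls cls_Mon)

lemma mult_assoc:
  "x \<in> Mon K n \<Longrightarrow> y \<in> Mon K n \<Longrightarrow> z \<in> Mon K n \<Longrightarrow>
    mult K n (mult K n x y) z = mult K n x (mult K n y z)"
  by (elim MonE) (simp add: mult_cls)

lemma mult_unit [simp]:
  "x \<in> Mon K n \<Longrightarrow> mult K n x (unit_e K n) = x"
  "x \<in> Mon K n \<Longrightarrow> mult K n (unit_e K n) x = x"
  by (elim MonE; simp add: mult_cls unit_e_def)+

lemma len_mult [simp]:
  "x \<in> Mon K n \<Longrightarrow> y \<in> Mon K n \<Longrightarrow> len (mult K n x y) = len x + len y"
  by (elim MonE) (simp add: mult_cls len_cls)

lemma len_unit [simp]: "len (unit_e K n) = 0"
  by (simp add: unit_e_def len_cls)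

lemma len_gelt [simp]: "len (gelt K n s) = 1"
  by (simp add: gelt_def len_cls)

lemma len_0_iff: "x \<in> Mon K n \<Longrightarrow> len x = 0 \<longleftrightarrow> x = unit_e K n"
  by (elim MonE) (auto simp: len_cls unit_e_def cls_eq_iff dest: weq_length intro: weq_refl)

lemma ldiv_refl: "x \<in> Mon K n \<Longrightarrow> ldiv K n x x"
  unfolding ldiv_def by (rule bexI[of _ "unit_e K n"]) auto

lemma ldiv_mult: "y \<in> Mon K n \<Longrightarrow> ldiv K n x (mult K n x y)"
  unfolding ldiv_def by auto

lemma ldiv_trans: "x \<in> Mon K n \<Longrightarrow> ldiv K n x y \<Longrightarrow> ldiv K n y z \<Longrightarrow> ldiv K n x z"
  unfolding ldiv_def by (metis mult_Mon mult_assoc)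

lemma ldiv_len: "x \<in> Mon K n \<Longrightarrow> ldiv K n x y \<Longrightarrow> len x \<le> len y"
  unfolding ldiv_def by auto

text \<open>Lengths add, so the quotient of two elements dividing each other has length 0.\<close>

lemma ldiv_antisym:
  assumes "x \<in> Mon K n" "ldiv K n x y" "ldiv K n y x" shows "x = y"
proof -
  obtain z where z: "z \<in> Mon K n" "y = mult K n x z" using assms by (auto simp: ldiv_def)
  have "y \<in> Mon K n" using z assms(1) by simp
  then have "len y \<le> len x" using ldiv_len assms(3) by blast
  then have "len z = 0" using z assms(1) by simp
  then show ?thesis using z assms(1) len_0_iff by fastforce
qed

lemma ldiv_unit_left: "x \<in> Mon K n \<Longrightarrow> ldiv K n (unit_e K n) x"
  unfolding ldiv_def by auto

lemma ldiv_mult_mono: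
  "\<lbrakk>x \<in> Mon K n; y \<in> Mon K n; ldiv K n y z\<rbrakk> \<Longrightarrow> ldiv K n (mult K n x y) (mult K n x z)"
  unfolding ldiv_def using mult_assoc by blast

lemma Mon_has_gen:
  assumes "x \<in> Mon K n" "x \<noteq> unit_e K n"
  obtains s where "s \<in> Sigma_gens K n" "ldiv K n (gelt K n s) x"
proof -
  obtain u where u: "u \<in> lists (Sigma_gens K n)" "x = cls K n u" using assms(1) by (rule MonE)
  with assms(2) obtain s v where "u = s # v" by (cases u) (auto simp: unit_e_def)
  with u show thesis
    by (intro that[of s]) (auto simp: ldiv_def gelt_def mult_cls intro!: bexI[of _ "cls K n v"] cls_Mon)
qed

section \<open>Germs\<close>

primrec quo :: "(gen \<Rightarrow> 's \<Rightarrow> 's) \<Rightarrow> 's \<Rightarrow> gen list \<Rightarrow> 's" where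
  "quo q z [] = z"
| "quo q z (s # w) = quo q (q s z) w"

text \<open>\<open>quo\<close> is total and carries no meaning off a path; \<open>pth\<close>
  records that each letter in turn divides what is left of the state.\<close>

primrec pth :: "gen set \<Rightarrow> (gen \<Rightarrow> 'b) \<Rightarrow> (gen \<Rightarrow> 'b set \<Rightarrow> 'b set) \<Rightarrow> 'b set \<Rightarrow> gen list \<Rightarrow> bool" where
  "pth G a q z [] \<longleftrightarrow> True"
| "pth G a q z (s # w) \<longleftrightarrow> s \<in> G \<and> a s \<in> z \<and> pth G a q (q s z) w"

definition lang :: "gen set \<Rightarrow> (gen \<Rightarrow> 'b) \<Rightarrow> (gen \<Rightarrow> 'b set \<Rightarrow> 'b set) \<Rightarrow> 'b set \<Rightarrow> gen list \<Rightarrow> bool" where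
  "lang G a q z w \<longleftrightarrow> pth G a q z w \<and> quo q z w = {}"

lemma quo_append: "quo q z (u @ v) = quo q (quo q z u) v"
  by (induction u arbitrary: z) auto

lemma pth_append: "pth G a q z (u @ v) \<longleftrightarrow> pth G a q z u \<and> pth G a q (quo q z u) v"
  by (induction u arbitrary: z) auto

lemma pth_lists: "pth G a q z u \<Longrightarrow> u \<in> lists G"
  by (induction u arbitrary: z) auto

lemma lang_lists: "lang G a q z u \<Longrightarrow> u \<in> lists G"
  unfolding lang_def using pth_lists by blast

lemma lang_append: "lang G a q z (u @ v) \<longleftrightarrow> pth G a q z u \<and> lang G a q (quo q z u) v"
  by (auto simp: lang_def pth_append quo_append)

lemma lang_Cons: "lang G a q z (s # v) \<longleftrightarrow> s \<in> G \<and> a s \<in> z \<and> lang G a q (q s z) v"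
  by (auto simp: lang_def)

lemma lang_Nil: "lang G a q z [] \<longleftrightarrow> z = {}"
  by (auto simp: lang_def)

text \<open>
  A state \<open>z \<in> Z\<close> stands for a simple element, \<open>y \<subseteq> z\<close> for left divisibility, \<open>atm s \<in> z\<close> for
  divisibility by the generator \<open>s\<close>, and then \<open>q s z\<close> for the quotient. The words spelling \<open>z\<close> are those
  accepted by \<open>lang\<close>. The assumption \<open>linked\<close> replaces Matsumoto's theorem; it allows chains since two
  crossing generators of the dual monoid occur in no common defining relation. The assumption
  \<open>l \<in> lists (Sigma_gens K n)\<close> in \<open>rels_germ\<close> is needed because the nested commutation relations of
  \<open>rels Dual n\<close> also mention generators \<open>D i j\<close> with \<open>j > n\<close>.
\<close>
locale garside_germ =
  fixes K :: mkind and n :: nat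
    and Z :: "'b set set" and tp :: "'b set" and atm :: "gen \<Rightarrow> 'b"
    and q :: "gen \<Rightarrow> 'b set \<Rightarrow> 'b set"
  assumes finite_tp: "finite tp"
    and le_tp: "z \<in> Z \<Longrightarrow> z \<subseteq> tp"
    and bot_Z: "{} \<in> Z"
    and tp_Z: "tp \<in> Z"
    and ex_join: "\<lbrakk>y \<in> Z; z \<in> Z\<rbrakk> \<Longrightarrow> \<exists>j\<in>Z. y \<subseteq> j \<and> z \<subseteq> j \<and> (\<forall>u\<in>Z. y \<subseteq> u \<longrightarrow> z \<subseteq> u \<longrightarrow> j \<subseteq> u)"
    and atom_Z: "s \<in> Sigma_gens K n \<Longrightarrow> {atm s} \<in> Z"
    and inj_at: "inj_on atm (Sigma_gens K n)"
    and ex_atom: "\<lbrakk>z \<in> Z; z \<noteq> {}\<rbrakk> \<Longrightarrow> \<exists>s\<in>Sigma_gens K n. atm s \<in> z"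
    and atoms_top: "\<lbrakk>z \<in> Z; atm ` Sigma_gens K n \<subseteq> z\<rbrakk> \<Longrightarrow> z = tp"
    and q_Z: "\<lbrakk>s \<in> Sigma_gens K n; z \<in> Z; atm s \<in> z\<rbrakk> \<Longrightarrow> q s z \<in> Z"
    and q_card: "\<lbrakk>s \<in> Sigma_gens K n; z \<in> Z; atm s \<in> z\<rbrakk> \<Longrightarrow> card (q s z) < card z"
    and q_mono_iff: "\<lbrakk>s \<in> Sigma_gens K n; y \<in> Z; z \<in> Z; atm s \<in> y; atm s \<in> z\<rbrakk>
          \<Longrightarrow> q s y \<subseteq> q s z \<longleftrightarrow> y \<subseteq> z"
    and q_atom: "s \<in> Sigma_gens K n \<Longrightarrow> q s {atm s} = {}"
    and q_not_at: "\<lbrakk>s \<in> Sigma_gens K n; z \<in> Z; atm s \<in> z\<rbrakk> \<Longrightarrow> atm s \<notin> q s z"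
    and q_surj: "\<lbrakk>s \<in> Sigma_gens K n; z \<in> Z; atm s \<in> z; y \<in> Z; y \<subseteq> q s z\<rbrakk>
          \<Longrightarrow> \<exists>x\<in>Z. atm s \<in> x \<and> q s x = y"
    and rels_germ: "\<lbrakk>(l, r) \<in> rels K n; l \<in> lists (Sigma_gens K n)\<rbrakk> \<Longrightarrow>
          \<exists>j\<in>Z. lang (Sigma_gens K n) atm q j l \<and> lang (Sigma_gens K n) atm q j r \<and>
             (\<forall>z\<in>Z. j \<subseteq> z \<longrightarrow> quo q z l = quo q z r)"
    and linked: "\<lbrakk>z \<in> Z; s \<in> Sigma_gens K n; t \<in> Sigma_gens K n; atm s \<in> z; atm t \<in> z\<rbrakk> \<Longrightarrow>
          (s, t) \<in> {(s, t). atm s \<in> z \<and> atm t \<in> z \<and>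
             (\<exists>u v. ((s # u, t # v) \<in> rels K n \<or> (t # v, s # u) \<in> rels K n) \<and>
               (\<exists>j\<in>Z. j \<subseteq> z \<and> lang (Sigma_gens K n) atm q j (s # u)))}\<^sup>*"
begin

abbreviation "G \<equiv> Sigma_gens K n"
abbreviation "rpath \<equiv> pth G atm q"
abbreviation "word_of \<equiv> lang G atm q"
abbreviation eqv (infix "\<doteq>" 50) where "u \<doteq> v \<equiv> weq K n u v"

lemma finite_Z: "finite Z"
  using finite_tp le_tp by (meson PowI finite_Pow_iff finite_subset subsetI)

definition join :: "'b set \<Rightarrow> 'b set \<Rightarrow> 'b set" (infixl "\<curlyvee>" 65) where
  "y \<curlyvee> z = (SOME j. j \<in> Z \<and> y \<subseteq> j \<and> z \<subseteq> j \<and> (\<forall>u\<in>Z. y \<subseteq> u \<longrightarrow> z \<subseteq> u \<longrightarrow> j \<subseteq> u))"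

lemma join:
  assumes "y \<in> Z" "z \<in> Z"
  shows join_Z: "y \<curlyvee> z \<in> Z" and join_ub1: "y \<subseteq> y \<curlyvee> z" and join_ub2: "z \<subseteq> y \<curlyvee> z"
    and join_least: "\<lbrakk>u \<in> Z; y \<subseteq> u; z \<subseteq> u\<rbrakk> \<Longrightarrow> y \<curlyvee> z \<subseteq> u"
proof -
  have "\<exists>j. j \<in> Z \<and> y \<subseteq> j \<and> z \<subseteq> j \<and> (\<forall>u\<in>Z. y \<subseteq> u \<longrightarrow> z \<subseteq> u \<longrightarrow> j \<subseteq> u)"
    using ex_join[OF assms] by blast
  then have *: "y \<curlyvee> z \<in> Z \<and> y \<subseteq> y \<curlyvee> z \<and> z \<subseteq> y \<curlyvee> z \<and> (\<forall>u\<in>Z. y \<subseteq> u \<longrightarrow> z \<subseteq> u \<longrightarrow> y \<curlyvee> z \<subseteq> u)"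
    unfolding join_def by (rule someI_ex)
  show "y \<curlyvee> z \<in> Z" "y \<subseteq> y \<curlyvee> z" "z \<subseteq> y \<curlyvee> z" using * by auto
  show "\<lbrakk>u \<in> Z; y \<subseteq> u; z \<subseteq> u\<rbrakk> \<Longrightarrow> y \<curlyvee> z \<subseteq> u" using * by auto
qed

lemma join_subset_iff: "\<lbrakk>y \<in> Z; z \<in> Z; u \<in> Z\<rbrakk> \<Longrightarrow> y \<curlyvee> z \<subseteq> u \<longleftrightarrow> y \<subseteq> u \<and> z \<subseteq> u"
  using join_ub1 join_ub2 join_least by (meson subset_trans)

text \<open>Joins are known through their upper bounds (\<open>join_subset_iff\<close>); comparing
  upper bounds turns the join laws into propositional logic.\<close>

lemma state_eqI: "\<lbrakk>y \<in> Z; z \<in> Z; \<And>u. u \<in> Z \<Longrightarrow> y \<subseteq> u \<longleftrightarrow> z \<subseteq> u\<rbrakk> \<Longrightarrow> y = z"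
  by blast

lemma join_absorb: "\<lbrakk>y \<in> Z; z \<in> Z; y \<subseteq> z\<rbrakk> \<Longrightarrow> y \<curlyvee> z = z" "\<lbrakk>y \<in> Z; z \<in> Z; y \<subseteq> z\<rbrakk> \<Longrightarrow> z \<curlyvee> y = z"
  by (rule state_eqI; simp add: join_Z join_subset_iff; blast)+

lemma join_comm: "\<lbrakk>y \<in> Z; z \<in> Z\<rbrakk> \<Longrightarrow> y \<curlyvee> z = z \<curlyvee> y"
  by (rule state_eqI) (auto simp: join_Z join_subset_iff)

lemma join_assoc: "\<lbrakk>x \<in> Z; y \<in> Z; z \<in> Z\<rbrakk> \<Longrightarrow> (x \<curlyvee> y) \<curlyvee> z = x \<curlyvee> (y \<curlyvee> z)"
  by (rule state_eqI) (auto simp: join_Z join_subset_iff)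

text \<open>On states containing \<open>atm s\<close> the map \<open>q s\<close> is an order
  embedding with downward closed image, which forces it to preserve joins: the join of the quotients
  is itself a quotient, namely of a state above both \<open>y\<close> and \<open>z\<close>.\<close>

lemma q_join:
  assumes "s \<in> G" "y \<in> Z" "z \<in> Z" "atm s \<in> y" "atm s \<in> z"
  shows "q s (y \<curlyvee> z) = q s y \<curlyvee> q s z"
proof (rule subset_antisym)
  have j: "y \<curlyvee> z \<in> Z" "atm s \<in> y \<curlyvee> z" using assms join_Z join_ub1 by blast+
  have qs: "q s y \<in> Z" "q s z \<in> Z" "q s (y \<curlyvee> z) \<in> Z" using assms j q_Z by auto
  show le: "q s y \<curlyvee> q s z \<subseteq> q s (y \<curlyvee> z)"
    using assms j qs by (simp add: join_subset_iff q_mono_iff join_ub1 join_ub2)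
  obtain x where x: "x \<in> Z" "atm s \<in> x" "q s x = q s y \<curlyvee> q s z"
    using q_surj[OF assms(1) j _ le] join_Z qs by blast
  then have "q s y \<subseteq> q s x" "q s z \<subseteq> q s x" using join_ub1 join_ub2 qs by auto
  then have "y \<subseteq> x" "z \<subseteq> x" using x q_mono_iff assms by blast+
  then have "y \<curlyvee> z \<subseteq> x" using join_least assms x by blast
  then show "q s (y \<curlyvee> z) \<subseteq> q s y \<curlyvee> q s z" using q_mono_iff assms j x by metis
qed

lemma path_Z: "\<lbrakk>z \<in> Z; rpath z w\<rbrakk> \<Longrightarrow> quo q z w \<in> Z"
  by (induction w arbitrary: z) (auto simp: q_Z)

lemma ex_word: "z \<in> Z \<Longrightarrow> \<exists>w. word_of z w"
proof (induction "card z" arbitrary: z rule: less_induct)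
  case less
  show ?case
  proof (cases "z = {}")
    case False
    then obtain s where s: "s \<in> G" "atm s \<in> z" using ex_atom less.prems by blast
    then obtain w where "word_of (q s z) w" using less q_card q_Z by blast
    then show ?thesis using s lang_Cons by blast
  qed (use lang_Nil in blast)
qed

lemma path_mono: "\<lbrakk>y \<in> Z; z \<in> Z; y \<subseteq> z; rpath y u\<rbrakk> \<Longrightarrow> rpath z u \<and> quo q y u \<subseteq> quo q z u"
proof (induction u arbitrary: y z)
  case (Cons s u)
  then have "q s y \<subseteq> q s z" using q_mono_iff by (metis pth.simps(2) subsetD)
  moreover have "s \<in> G" "atm s \<in> y" "atm s \<in> z" "rpath (q s y) u" using Cons.prems by auto
  ultimately show ?case using Cons.IH[of "q s y" "q s z"] Cons.prems q_Z by simp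
qed auto

text \<open>This is \<open>q_mono_iff\<close> iterated along one spelling. Inclusion of states can
  thus be tested by running a single word, which is how relations and congruence enter.\<close>

lemma word_of_subset_iff: "\<lbrakk>y \<in> Z; z \<in> Z; word_of y u\<rbrakk> \<Longrightarrow> y \<subseteq> z \<longleftrightarrow> rpath z u"
proof (induction u arbitrary: y z)
  case (Cons s u)
  then have s: "s \<in> G" "atm s \<in> y" "word_of (q s y) u" by (auto simp: lang_Cons)
  show ?case
  proof (cases "atm s \<in> z")
    case True
    then have "y \<subseteq> z \<longleftrightarrow> q s y \<subseteq> q s z" using q_mono_iff s Cons.prems by blast
    also have "\<dots> \<longleftrightarrow> rpath (q s z) u" using Cons.IH s Cons.prems True q_Z by blast
    finally show ?thesis using True s by simp
  qed (use s in auto)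
qed (auto simp: lang_Nil)

text \<open>The state is rebuilt from the last letter backwards, each letter being put back by
  \<open>q_surj\<close>. In particular every prefix of a spelling is a spelling.\<close>

lemma path_word_of: "\<lbrakk>z \<in> Z; rpath z u\<rbrakk> \<Longrightarrow> \<exists>y\<in>Z. word_of y u"
proof (induction u arbitrary: z)
  case Nil
  then show ?case using bot_Z lang_Nil by blast
next
  case (Cons s u)
  then obtain y where y: "y \<in> Z" "word_of y u" using q_Z by fastforce
  have "y \<subseteq> q s z" using word_of_subset_iff y Cons q_Z by (meson pth.simps(2))
  then obtain x where "x \<in> Z" "atm s \<in> x" "q s x = y" using q_surj y Cons by (meson pth.simps(2))
  then show ?case using y Cons.prems by (auto simp: lang_Cons)
qed

text \<open>Both sides of a relation spell one state \<open>j\<close>, so each is a path from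
  \<open>z\<close> exactly when \<open>z\<close> contains \<open>j\<close>, and above
  \<open>j\<close> the quotients agree.\<close>

lemma rels_word_of:
  assumes "(l, r) \<in> rels K n" "l \<in> lists G" "z \<in> Z"
  shows "rpath z l \<longleftrightarrow> rpath z r" and "rpath z l \<Longrightarrow> quo q z l = quo q z r"
proof -
  obtain j where j: "j \<in> Z" "word_of j l" "word_of j r" "\<forall>z\<in>Z. j \<subseteq> z \<longrightarrow> quo q z l = quo q z r"
    using rels_germ assms by blast
  have "j \<subseteq> z \<longleftrightarrow> rpath z l" "j \<subseteq> z \<longleftrightarrow> rpath z r"
    using word_of_subset_iff[OF j(1) assms(3)] j(2,3) by auto
  then show "rpath z l \<longleftrightarrow> rpath z r" and "rpath z l \<Longrightarrow> quo q z l = quo q z r"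
    using j(4) assms(3) by auto
qed

lemma weq_path: "u \<doteq> v \<Longrightarrow> u \<in> lists G \<Longrightarrow> z \<in> Z \<Longrightarrow> (rpath z u \<longleftrightarrow> rpath z v) \<and> (rpath z u \<longrightarrow> quo q z u = quo q z v)"
proof (induction arbitrary: rule: weq.induct)
  case (weq_rel l r u v)
  then have l: "l \<in> lists G" by simp
  show ?case
    using rels_word_of[OF weq_rel(1) l] path_Z[OF weq_rel.prems(2), of u]
    by (auto simp: pth_append quo_append)
qed (auto simp: weq_lists)

lemma weq_word_of: "u \<doteq> v \<Longrightarrow> z \<in> Z \<Longrightarrow> word_of z u \<Longrightarrow> word_of z v"
  unfolding lang_def using weq_path pth_lists by metis

text \<open>Induction on the size of \<open>z\<close>. Spellings with the same first letter are
  settled by the induction hypothesis; different first letters are connected by the chain of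
  \<open>linked\<close>, one relation per link.\<close>

lemma word_of_unique: "\<lbrakk>z \<in> Z; word_of z u; word_of z v\<rbrakk> \<Longrightarrow> u \<doteq> v"
proof (induction "card z" arbitrary: z u v rule: less_induct)
  case less
  show ?case
  proof (cases "z = {}")
    case True
    then have "u = []" "v = []" using less.prems by (cases u; cases v; auto simp: lang_Cons)+
    then show ?thesis by (simp add: weq_refl)
  next
    case False
    then obtain s u' t v' where uv: "u = s # u'" "v = t # v'"
      using less.prems by (cases u; cases v; auto simp: lang_Nil)
    have st: "s \<in> G" "atm s \<in> z" "t \<in> G" "atm t \<in> z" "word_of (q s z) u'" "word_of (q t z) v'"
      using less.prems uv by (auto simp: lang_Cons)
    have same: "s # w \<doteq> s # w'" if "word_of z (s # w)" "word_of z (s # w')" for s w w'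
      using less(1)[of "q s z" w w'] that less.prems q_card q_Z by (auto simp: lang_Cons intro: weq_Cons)
    have "\<forall>v. word_of z (t # v) \<longrightarrow> s # u' \<doteq> t # v"
      using linked[OF less.prems(1) st(1,3,2,4)]
    proof (induction rule: rtrancl_induct)
      case base
      then show ?case using same less.prems uv by blast
    next
      case (step x y)
      then obtain a b j where ab: "(x # a, y # b) \<in> rels K n \<or> (y # b, x # a) \<in> rels K n"
        "j \<in> Z" "j \<subseteq> z" "word_of j (x # a)" by auto
      have "([] @ (x # a) @ []) \<doteq> ([] @ (y # b) @ [])"
        using ab(1) weq_rel[of _ _ K n "[]" "[]"] weq_sym by blast
      then have w: "x # a \<doteq> y # b" by simp
      have p: "rpath z (x # a)" using word_of_subset_iff ab less.prems by blast
      have l: "x # a \<in> lists G" using p pth_lists by blast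
      have p': "rpath z (y # b)" "quo q z (y # b) = quo q z (x # a)"
        using weq_path[OF w l less.prems(1)] p by auto
      \<comment> \<open>Both sides of the relation leave the same quotient of \<open>z\<close>, so
        one tail \<open>c\<close> completes each of them to a spelling of \<open>z\<close>, the
        first starting with \<open>x\<close>, the second with \<open>y\<close>.\<close>
      obtain c where "word_of (quo q z (x # a)) c" using ex_word path_Z less.prems p by blast
      then have c: "word_of z (x # (a @ c))" "word_of z (y # (b @ c))"
        using p p' lang_append[of G atm q z "x # a" c] lang_append[of G atm q z "y # b" c] by auto
      have "s # u' \<doteq> x # (a @ c)" using step c by blast
      moreover have "x # (a @ c) \<doteq> y # (b @ c)" using weq_append[OF w weq_refl[of K n c]] by simp
      ultimately show ?case using same[OF c(2)] weq_trans by blast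
    qed
    then show ?thesis using less.prems uv by blast
  qed
qed

definition wd :: "'b set \<Rightarrow> gen list" where "wd z = (SOME w. word_of z w)"

lemma word_of_wd: "z \<in> Z \<Longrightarrow> word_of z (wd z)"
  unfolding wd_def using ex_word by (rule someI_ex)

lemma wd_lists: "z \<in> Z \<Longrightarrow> wd z \<in> lists G"
  using word_of_wd pth_lists lang_def by metis

subsection \<open>Residuals\<close>

text \<open>The element of \<open>res z s\<close> divides \<open>x\<close> if and only if that of \<open>z\<close> divides \<open>s x\<close>.\<close>
definition res :: "'b set \<Rightarrow> gen \<Rightarrow> 'b set" where "res z s = q s ({atm s} \<curlyvee> z)"

definition resw :: "'b set \<Rightarrow> gen list \<Rightarrow> 'b set" where "resw z w = foldl res z w"

lemma resw_simps [simp]: "resw z [] = z" "resw z (s # w) = resw (res z s) w"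
  by (auto simp: resw_def)

lemma resw_append: "resw z (u @ v) = resw (resw z u) v"
  by (auto simp: resw_def)

lemma res_Z: "z \<in> Z \<Longrightarrow> s \<in> G \<Longrightarrow> res z s \<in> Z"
  unfolding res_def using join_Z join_ub1 atom_Z q_Z by (meson insert_subset)

lemma resw_Z: "z \<in> Z \<Longrightarrow> w \<in> lists G \<Longrightarrow> resw z w \<in> Z"
  by (induction w arbitrary: z) (auto simp: res_Z)

lemma at_join: "s \<in> G \<Longrightarrow> z \<in> Z \<Longrightarrow> atm s \<in> {atm s} \<curlyvee> z"
  using join_ub1[OF atom_Z] by blast

text \<open>Joining with one letter at a time amounts to joining with \<open>j\<close> at once,
  since each letter met along a spelling of \<open>j\<close> lies below what remains of
  \<open>j\<close>.\<close>

lemma resw_word_of: "\<lbrakk>j \<in> Z; z \<in> Z; word_of j u\<rbrakk> \<Longrightarrow> resw z u = quo q (j \<curlyvee> z) u"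
proof (induction u arbitrary: j z)
  case Nil
  then show ?case by (simp add: lang_Nil join_absorb)
next
  case (Cons s u)
  then have s: "s \<in> G" "atm s \<in> j" "word_of (q s j) u" by (auto simp: lang_Cons)
  have a: "{atm s} \<curlyvee> z \<in> Z" using s Cons atom_Z join_Z by blast
  have "resw z (s # u) = quo q (q s j \<curlyvee> res z s) u"
    using Cons s res_Z q_Z by simp
  also have "q s j \<curlyvee> res z s = q s (j \<curlyvee> ({atm s} \<curlyvee> z))"
    unfolding res_def using q_join s Cons a at_join by metis
  also have "j \<curlyvee> ({atm s} \<curlyvee> z) = (j \<curlyvee> {atm s}) \<curlyvee> z"
    using join_assoc s Cons atom_Z by metis
  also have "j \<curlyvee> {atm s} = j" using join_absorb(2)[of "{atm s}" j] s Cons atom_Z by auto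
  finally show ?case by simp
qed

text \<open>Both sides of a relation spell the same \<open>j\<close> and have equal quotients above
  \<open>j\<close>, in particular on the join of \<open>j\<close> with the state reached so far. So
  the residual action passes to the monoid.\<close>

lemma resw_weq: "u \<doteq> v \<Longrightarrow> u \<in> lists G \<Longrightarrow> z \<in> Z \<Longrightarrow> resw z u = resw z v"
proof (induction rule: weq.induct)
  case (weq_rel l r u v)
  obtain j where j: "j \<in> Z" "word_of j l" "word_of j r" "\<forall>z\<in>Z. j \<subseteq> z \<longrightarrow> quo q z l = quo q z r"
    using rels_germ weq_rel by (metis append_in_lists_conv)
  let ?y = "resw z u"
  have y: "?y \<in> Z" using weq_rel resw_Z by simp
  have "resw ?y l = resw ?y r"
    using resw_word_of[OF j(1) y] j join_Z[OF j(1) y] join_ub1[OF j(1) y] by simp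
  then show ?case by (simp add: resw_append)
qed (auto simp: weq_lists)

lemma res_join: "\<lbrakk>y \<in> Z; z \<in> Z; s \<in> G\<rbrakk> \<Longrightarrow> res (y \<curlyvee> z) s = res y s \<curlyvee> res z s"
proof -
  assume a: "y \<in> Z" "z \<in> Z" "s \<in> G"
  have "{atm s} \<curlyvee> (y \<curlyvee> z) = ({atm s} \<curlyvee> y) \<curlyvee> ({atm s} \<curlyvee> z)"
    using a atom_Z by (intro state_eqI) (auto simp: join_Z join_subset_iff)
  then show ?thesis unfolding res_def using q_join a at_join atom_Z join_Z by metis
qed

lemma resw_join: "\<lbrakk>y \<in> Z; z \<in> Z; w \<in> lists G\<rbrakk> \<Longrightarrow> resw (y \<curlyvee> z) w = resw y w \<curlyvee> resw z w"
  by (induction w arbitrary: y z) (auto simp: res_join res_Z)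

lemma res_bot: "s \<in> G \<Longrightarrow> res {} s = {}"
  unfolding res_def using join_absorb(2)[of "{}" "{atm s}"] atom_Z bot_Z q_atom by simp

lemma resw_bot: "w \<in> lists G \<Longrightarrow> resw {} w = {}"
  by (induction w) (auto simp: res_bot)

lemma wd_bot: "wd {} = []"
  using word_of_wd[OF bot_Z] by (cases "wd {}") (auto simp: lang_Cons)

lemma word_of_atom: "s \<in> G \<Longrightarrow> word_of {atm s} [s]"
  by (auto simp: lang_Cons lang_Nil q_atom)

lemma wd_atom: "s \<in> G \<Longrightarrow> wd {atm s} = [s]"
proof -
  assume s: "s \<in> G"
  have "word_of {atm s} (wd {atm s})" using word_of_wd atom_Z s by blast
  moreover have "wd {atm s} \<doteq> [s]" using word_of_unique calculation word_of_atom s atom_Z by blast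
  moreover have "length (wd {atm s}) = 1" using weq_length calculation by fastforce
  ultimately show ?thesis using inj_at s
    by (cases "wd {atm s}") (auto simp: lang_Cons inj_on_def)
qed

lemma subset_word: "\<lbrakk>y \<in> Z; z \<in> Z; y \<subseteq> z; word_of y u\<rbrakk> \<Longrightarrow> \<exists>v. word_of z (u @ v)"
  using word_of_subset_iff path_Z ex_word lang_append by metis

lemma resw_self: "\<lbrakk>z \<in> Z; word_of z u\<rbrakk> \<Longrightarrow> resw z u = {}"
  using resw_word_of[of z z u] by (simp add: join_absorb lang_def)

text \<open>For the implication from left to right: the join of \<open>{atm s}\<close> and
  \<open>z\<close> has a spelling that starts with \<open>s\<close> and one that starts with
  \<open>wd z\<close>. Uniqueness of spellings converts a factorisation found after \<open>s\<close>
  into one that begins with \<open>wd z\<close>.\<close>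

lemma resw_empty_iff:
  assumes "z \<in> Z" "w \<in> lists G"
  shows "resw z w = {} \<longleftrightarrow> (\<exists>v\<in>lists G. w \<doteq> wd z @ v)"
proof
  assume "\<exists>v\<in>lists G. w \<doteq> wd z @ v"
  then obtain v where "v \<in> lists G" "w \<doteq> wd z @ v" by blast
  then show "resw z w = {}"
    using resw_weq assms resw_self[OF assms(1) word_of_wd] by (simp add: resw_append resw_bot)
next
  show "resw z w = {} \<Longrightarrow> \<exists>v\<in>lists G. w \<doteq> wd z @ v"
    using assms
  proof (induction w arbitrary: z)
    case Nil
    then show ?case by (auto simp: wd_bot intro: weq_refl)
  next
    case (Cons s w)
    let ?r = "res z s" let ?j = "{atm s} \<curlyvee> z"
    have s: "s \<in> G" "w \<in> lists G" using Cons by auto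
    have r: "?r \<in> Z" "?j \<in> Z" using Cons res_Z join_Z atom_Z by auto
    obtain v where v: "v \<in> lists G" "w \<doteq> wd ?r @ v" using Cons.IH[OF _ r(1) s(2)] Cons.prems(1) by auto
    have w1: "word_of ?j (s # wd ?r)"
      using word_of_wd[OF r(1)] s Cons at_join by (auto simp: lang_Cons res_def)
    obtain v' where v': "word_of ?j (wd z @ v')"
      using subset_word[OF Cons.prems(2) r(2) _ word_of_wd] join_ub2 atom_Z s Cons by blast
    have l: "v' \<in> lists G" using lang_lists[OF v'] by simp
    have "s # wd ?r \<doteq> wd z @ v'" using word_of_unique r w1 v' by blast
    then have "(s # wd ?r) @ v \<doteq> (wd z @ v') @ v" using weq_append weq_refl by blast
    moreover have "s # w \<doteq> s # (wd ?r @ v)" using v weq_Cons by blast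
    ultimately have "s # w \<doteq> wd z @ (v' @ v)" using weq_trans by simp
    then show ?case using l v by (intro bexI[of _ "v' @ v"]) auto
  qed
qed

subsection \<open>Cancellation\<close>

text \<open>The join is the one behind the residual, but divided by the other factor:
  \<open>cpl z y\<close> is what \<open>z\<close> lacks to reach the least common multiple of
  \<open>z\<close> and \<open>y\<close>.\<close>

definition cpl :: "'b set \<Rightarrow> 'b set \<Rightarrow> 'b set" where "cpl z y = quo q (z \<curlyvee> y) (wd z)"

text \<open>If \<open>z\<close> divides \<open>w\<close>, then \<open>canc z w\<close> spells the quotient.\<close>
primrec canc :: "'b set \<Rightarrow> gen list \<Rightarrow> gen list" where
  "canc z [] = []"
| "canc z (s # w) = wd (cpl z {atm s}) @ canc (res z s) w"

lemma cpl_Z: "z \<in> Z \<Longrightarrow> y \<in> Z \<Longrightarrow> cpl z y \<in> Z"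
  unfolding cpl_def using path_Z join_Z word_of_wd lang_def path_mono join_ub1 by metis

lemma word_of_cpl: "\<lbrakk>z \<in> Z; y \<in> Z; word_of (cpl z y) v\<rbrakk> \<Longrightarrow> word_of (z \<curlyvee> y) (wd z @ v)"
  unfolding cpl_def lang_append using path_mono join_Z word_of_wd lang_def join_ub1 by metis

lemma word_of_cplI: "\<lbrakk>z \<in> Z; y \<in> Z; word_of (z \<curlyvee> y) (wd z @ v)\<rbrakk> \<Longrightarrow> word_of (cpl z y) v"
  unfolding cpl_def lang_append by blast

text \<open>Two commuting squares are pasted: the join of \<open>z\<close> with the first letter,
  then the join of the residual with the rest of \<open>j\<close>. By uniqueness of spellings their
  composite is the square of \<open>z\<close> and \<open>j\<close>.\<close>

lemma canc_word_of:
  "\<lbrakk>j \<in> Z; z \<in> Z; word_of j u; v \<in> lists G\<rbrakk> \<Longrightarrow> canc z (u @ v) \<doteq> wd (cpl z j) @ canc (resw z u) v"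
proof (induction u arbitrary: j z)
  case Nil
  then have "j = {}" by (simp add: lang_Nil)
  then have "cpl z j = {}"
    unfolding cpl_def using Nil word_of_wd by (simp add: join_absorb lang_def)
  then show ?case by (simp add: wd_bot weq_refl)
next
  case (Cons s u)
  then have s: "s \<in> G" "atm s \<in> j" "word_of (q s j) u" by (auto simp: lang_Cons)
  let ?r = "res z s"
  have zs: "?r \<in> Z" "q s j \<in> Z" "{atm s} \<in> Z" using s Cons res_Z q_Z atom_Z by auto
  let ?b = "wd (cpl ?r (q s j))" and ?a = "wd (cpl z {atm s})"
  have a: "word_of (z \<curlyvee> {atm s}) (wd z @ ?a)"
    by (intro word_of_cpl word_of_wd cpl_Z Cons.prems zs)
  have rr: "word_of (z \<curlyvee> {atm s}) (s # wd ?r)"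
    using word_of_wd[OF zs(1)] s(1) at_join[OF s(1) Cons.prems(2)] join_comm[OF zs(3) Cons.prems(2)]
    by (simp add: lang_Cons res_def)
  have eq: "wd z @ ?a \<doteq> s # wd ?r" using word_of_unique[OF _ a rr] join_Z Cons.prems(2) zs by blast
  have b: "word_of (?r \<curlyvee> q s j) (wd ?r @ ?b)"
    by (intro word_of_cpl word_of_wd cpl_Z zs)
  have "?r \<curlyvee> q s j = q s (({atm s} \<curlyvee> z) \<curlyvee> j)"
    unfolding res_def
    by (rule q_join[symmetric]) (use s(1,2) Cons.prems zs at_join join_Z in auto)
  also have "({atm s} \<curlyvee> z) \<curlyvee> j = (z \<curlyvee> j)"
    using s(2) Cons.prems zs by (intro state_eqI) (auto simp: join_Z join_subset_iff)
  finally have b2: "word_of (z \<curlyvee> j) (s # (wd ?r @ ?b))"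
    using b s(1,2) join_ub2[OF Cons.prems(2,1)] by (auto simp: lang_Cons)
  have "(wd z @ ?a) @ ?b \<doteq> (s # wd ?r) @ ?b" using eq weq_append weq_refl by blast
  then have "word_of (z \<curlyvee> j) (wd z @ (?a @ ?b))"
    using weq_word_of[OF weq_sym] b2 join_Z Cons.prems(1,2) by (metis append_Cons append_assoc)
  then have "word_of (cpl z j) (?a @ ?b)" by (intro word_of_cplI Cons.prems)
  then have ab: "?a @ ?b \<doteq> wd (cpl z j)" using word_of_unique[OF _ _ word_of_wd] cpl_Z Cons.prems(1,2) by blast
  have "canc z ((s # u) @ v) = ?a @ canc ?r (u @ v)" by simp
  also have "\<dots> \<doteq> ?a @ (?b @ canc (resw ?r u) v)"
    using Cons.IH[OF zs(2,1) s(3) Cons.prems(4)] weq_append weq_refl by blast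
  finally have "canc z ((s # u) @ v) \<doteq> (?a @ ?b) @ canc (resw ?r u) v" by simp
  moreover have "(?a @ ?b) @ canc (resw ?r u) v \<doteq> wd (cpl z j) @ canc (resw ?r u) v"
    using ab weq_append weq_refl by blast
  ultimately show ?case using weq_trans by (simp only: resw_simps)
qed

text \<open>By \<open>canc_word_of\<close> the output on \<open>l @ v\<close> depends on
  \<open>l\<close> only through the state \<open>j\<close> that it spells and through
  \<open>resw z l\<close>, and both are the same for \<open>r\<close>. The letters in front of the
  relation are stripped by an inner induction.\<close>

lemma canc_weq: "u \<doteq> v \<Longrightarrow> u \<in> lists G \<Longrightarrow> z \<in> Z \<Longrightarrow> canc z u \<doteq> canc z v"
proof (induction arbitrary: z rule: weq.induct)
  case (weq_rel l r u v)
  show ?case using weq_rel(2,3)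
  proof (induction u arbitrary: z)
    case Nil
    obtain j where j: "j \<in> Z" "word_of j l" "word_of j r"
      using rels_germ weq_rel by (metis append_in_lists_conv)
    have "resw z l = resw z r"
      using resw_weq[of l r z] weq_rel.hyps weq.weq_rel[of l r K n "[]" "[]"] Nil by simp
    then show ?case using canc_word_of[OF j(1) Nil(2) j(2), of v] canc_word_of[OF j(1) Nil(2) j(3), of v]
      Nil by simp (meson weq_sym weq_trans)
  next
    case (Cons s u)
    then show ?case using weq_append[OF weq_refl] res_Z by simp
  qed
qed (use weq_lists in \<open>blast intro: weq.intros\<close>)+

lemma canc_bot: "w \<in> lists G \<Longrightarrow> canc {} w = w"
proof (induction w)
  case (Cons s w)
  have "cpl {} {atm s} = {atm s}"
    using Cons by (simp add: cpl_def wd_bot join_absorb bot_Z atom_Z)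
  then show ?case using Cons by (simp add: res_bot wd_atom)
qed simp

text \<open>Dividing \<open>s\<close> out of \<open>s # w\<close> returns \<open>w\<close>
  literally, and \<open>canc\<close> respects the congruence.\<close>

lemma word_left_cancel:
  assumes "s \<in> G" "u \<in> lists G" "v \<in> lists G" "s # u \<doteq> s # v"
  shows "u \<doteq> v"
proof -
  have *: "canc {atm s} (s # w) = w" if "w \<in> lists G" for w
  proof -
    have "cpl {atm s} {atm s} = {}"
      using assms by (simp add: cpl_def join_absorb atom_Z wd_atom q_atom)
    moreover have "res {atm s} s = {}" using assms by (simp add: res_def join_absorb atom_Z q_atom)
    ultimately show ?thesis using that by (simp add: canc_bot wd_bot)
  qed
  then show ?thesis using canc_weq[OF assms(4), of "{atm s}"] assms atom_Z by simp
qed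

lemma mult_left_cancel:
  assumes "x \<in> Mon K n" "y \<in> Mon K n" "z \<in> Mon K n" "mult K n x y = mult K n x z"
  shows "y = z"
proof -
  obtain a u v where *: "a \<in> lists G" "x = cls K n a" "u \<in> lists G" "y = cls K n u" "v \<in> lists G" "z = cls K n v"
    using assms(1-3) by (meson MonE)
  have "a @ u \<doteq> a @ v \<Longrightarrow> u \<doteq> v" using *(1)
  proof (induction a)
    case (Cons s a)
    then show ?case using word_left_cancel[of s "a @ u" "a @ v"] * by simp
  qed simp
  then show ?thesis using assms(4) * by (simp add: mult_cls cls_eq_iff)
qed

lemma ldiv_mult_cancel:
  "\<lbrakk>x \<in> Mon K n; y \<in> Mon K n; z \<in> Mon K n\<rbrakk> \<Longrightarrow> ldiv K n (mult K n x y) (mult K n x z) \<longleftrightarrow> ldiv K n y z"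
  unfolding ldiv_def using mult_assoc mult_left_cancel mult_Mon by metis

subsection \<open>Simple elements\<close>

definition el :: "'b set \<Rightarrow> elt" where "el z = cls K n (wd z)"

lemma el_Mon: "z \<in> Z \<Longrightarrow> el z \<in> Mon K n"
  unfolding el_def using cls_Mon wd_lists by blast

lemma el_word_of: "z \<in> Z \<Longrightarrow> word_of z u \<Longrightarrow> cls K n u = el z"
  unfolding el_def cls_eq_iff using word_of_unique word_of_wd by blast

lemma ldiv_el_iff: "z \<in> Z \<Longrightarrow> w \<in> lists G \<Longrightarrow> ldiv K n (el z) (cls K n w) \<longleftrightarrow> resw z w = {}"
  unfolding ldiv_def el_def Mon_def using resw_empty_iff
  by (auto simp: mult_cls cls_eq_iff)

lemma ldiv_el_el: "y \<in> Z \<Longrightarrow> z \<in> Z \<Longrightarrow> ldiv K n (el y) (el z) \<longleftrightarrow> y \<subseteq> z"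
proof
  assume a: "y \<in> Z" "z \<in> Z"
  { assume "ldiv K n (el y) (el z)"
    then obtain v where v: "v \<in> lists G" "wd z \<doteq> wd y @ v"
      unfolding ldiv_def el_def Mon_def by (auto simp: mult_cls cls_eq_iff)
    then have "word_of z (wd y @ v)" using weq_word_of a word_of_wd by blast
    then show "y \<subseteq> z" using word_of_subset_iff a word_of_wd lang_append by blast }
  { assume "y \<subseteq> z"
    then obtain v where v: "word_of z (wd y @ v)" using subset_word a word_of_wd by blast
    then have "v \<in> lists G" using lang_lists[OF v] by simp
    then show "ldiv K n (el y) (el z)"
      using el_word_of[OF a(2) v] ldiv_mult[OF cls_Mon] unfolding el_def by (metis mult_cls) }
qed

lemma el_bot: "el {} = unit_e K n"
  by (simp add: el_def wd_bot unit_e_def)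

lemma el_atom: "s \<in> G \<Longrightarrow> el {atm s} = gelt K n s"
  by (simp add: el_def wd_atom gelt_def)

lemma ldiv_gelt_el: "s \<in> G \<Longrightarrow> z \<in> Z \<Longrightarrow> ldiv K n (gelt K n s) (el z) \<longleftrightarrow> atm s \<in> z"
  using ldiv_el_el[of "{atm s}" z] atom_Z el_atom by simp

text \<open>Residuals commute with joins, so two empty residuals give an empty one. This makes the
  join of states a least common multiple in the whole monoid, not only among simple
  elements.\<close>

lemma ldiv_el_join:
  "\<lbrakk>y \<in> Z; z \<in> Z; x \<in> Mon K n\<rbrakk> \<Longrightarrow> ldiv K n (el (y \<curlyvee> z)) x \<longleftrightarrow> ldiv K n (el y) x \<and> ldiv K n (el z) x"
proof -
  assume a: "y \<in> Z" "z \<in> Z" "x \<in> Mon K n"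
  obtain w where w: "w \<in> lists G" "x = cls K n w" using a MonE by blast
  have "ldiv K n (el (y \<curlyvee> z)) x" if "ldiv K n (el y) x" "ldiv K n (el z) x"
    using that a w by (simp add: ldiv_el_iff resw_join join_Z) (simp add: join_absorb bot_Z)
  moreover have "ldiv K n (el y) (el (y \<curlyvee> z))" "ldiv K n (el z) (el (y \<curlyvee> z))"
    using a ldiv_el_el join_Z join_ub1 join_ub2 by auto
  ultimately show ?thesis using ldiv_trans el_Mon a by blast
qed

lemma finite_atom_join:
  assumes "finite X" "X \<subseteq> G"
  shows "\<exists>j\<in>Z. (\<forall>z\<in>Z. j \<subseteq> z \<longleftrightarrow> atm ` X \<subseteq> z) \<and> (\<forall>x\<in>Mon K n. ldiv K n (el j) x \<longleftrightarrow> (\<forall>s\<in>X. ldiv K n (gelt K n s) x))"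
  using assms
proof (induction X rule: finite_induct)
  case empty
  then show ?case using bot_Z el_bot ldiv_unit_left by (intro bexI[of _ "{}"]) auto
next
  case (insert s X)
  then obtain j where j: "j \<in> Z" "\<And>z. z \<in> Z \<Longrightarrow> j \<subseteq> z \<longleftrightarrow> atm ` X \<subseteq> z"
    "\<And>x. x \<in> Mon K n \<Longrightarrow> ldiv K n (el j) x \<longleftrightarrow> (\<forall>s\<in>X. ldiv K n (gelt K n s) x)" by auto
  have s: "s \<in> G" "{atm s} \<in> Z" using insert atom_Z by auto
  show ?case
  proof (intro bexI[of _ "{atm s} \<curlyvee> j"] conjI ballI)
    fix z assume "z \<in> Z"
    then show "{atm s} \<curlyvee> j \<subseteq> z \<longleftrightarrow> atm ` insert s X \<subseteq> z"
      using join[OF s(2) j(1)] j(2) by (metis image_insert insert_is_Un le_sup_iff subset_trans)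
  next
    fix x assume "x \<in> Mon K n"
    then show "ldiv K n (el ({atm s} \<curlyvee> j)) x \<longleftrightarrow> (\<forall>s\<in>insert s X. ldiv K n (gelt K n s) x)"
      using ldiv_el_join s j el_atom by simp
  qed (use join_Z s j in blast)
qed

definition atom_join :: "gen set \<Rightarrow> 'b set" where
  "atom_join X = (SOME j. j \<in> Z \<and> (\<forall>z\<in>Z. j \<subseteq> z \<longleftrightarrow> atm ` X \<subseteq> z) \<and>
     (\<forall>x\<in>Mon K n. ldiv K n (el j) x \<longleftrightarrow> (\<forall>s\<in>X. ldiv K n (gelt K n s) x)))"

lemma atom_join:
  assumes "X \<subseteq> G"
  shows atom_join_Z: "atom_join X \<in> Z" and atom_join_subset: "z \<in> Z \<Longrightarrow> atom_join X \<subseteq> z \<longleftrightarrow> atm ` X \<subseteq> z"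
    and ldiv_atom_join: "x \<in> Mon K n \<Longrightarrow> ldiv K n (el (atom_join X)) x \<longleftrightarrow> (\<forall>s\<in>X. ldiv K n (gelt K n s) x)"
proof -
  have "finite X" using assms finite_Sigma_gens finite_subset by blast
  from finite_atom_join[OF this assms]
  have "\<exists>j. j \<in> Z \<and> (\<forall>z\<in>Z. j \<subseteq> z \<longleftrightarrow> atm ` X \<subseteq> z) \<and>
     (\<forall>x\<in>Mon K n. ldiv K n (el j) x \<longleftrightarrow> (\<forall>s\<in>X. ldiv K n (gelt K n s) x))" by blast
  from someI_ex[OF this]
  show "atom_join X \<in> Z" "z \<in> Z \<Longrightarrow> atom_join X \<subseteq> z \<longleftrightarrow> atm ` X \<subseteq> z"
   "x \<in> Mon K n \<Longrightarrow> ldiv K n (el (atom_join X)) x \<longleftrightarrow> (\<forall>s\<in>X. ldiv K n (gelt K n s) x)"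
    unfolding atom_join_def by blast+
qed

lemma atom_join_eqI:
  "\<lbrakk>X \<subseteq> G; j \<in> Z; atm ` X \<subseteq> j; \<And>z. \<lbrakk>z \<in> Z; atm ` X \<subseteq> z\<rbrakk> \<Longrightarrow> j \<subseteq> z\<rbrakk> \<Longrightarrow> atom_join X = j"
  using atom_join_subset atom_join_Z by (meson subset_antisym subset_refl)

text \<open>The join of the atoms is a least upper bound for divisibility in the whole monoid, and
  antisymmetry makes the description in \<open>DeltaX\<close> definite.\<close>

lemma DeltaX_atom_join: "X \<subseteq> G \<Longrightarrow> DeltaX K n X = el (atom_join X)"
  unfolding DeltaX_def
proof (rule the_equality)
  assume X: "X \<subseteq> G"
  have j: "el (atom_join X) \<in> Mon K n" using X atom_join_Z el_Mon by blast
  then have d: "\<forall>s\<in>X. ldiv K n (gelt K n s) (el (atom_join X))" using ldiv_atom_join[OF X j] ldiv_refl by blast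
  show "el (atom_join X) \<in> Mon K n \<and> (\<forall>s\<in>X. ldiv K n (gelt K n s) (el (atom_join X))) \<and>
     (\<forall>d'\<in>Mon K n. (\<forall>s\<in>X. ldiv K n (gelt K n s) d') \<longrightarrow> ldiv K n (el (atom_join X)) d')"
    using j d ldiv_atom_join[OF X] by blast
  fix d assume "d \<in> Mon K n \<and> (\<forall>s\<in>X. ldiv K n (gelt K n s) d) \<and>
     (\<forall>d'\<in>Mon K n. (\<forall>s\<in>X. ldiv K n (gelt K n s) d') \<longrightarrow> ldiv K n d d')"
  then show "d = el (atom_join X)"
    using j \<open>\<forall>s\<in>X. ldiv K n (gelt K n s) (el (atom_join X))\<close> ldiv_atom_join[OF X] ldiv_antisym by blast
qed

lemma atom_join_all: "atom_join G = tp"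
proof (rule atom_join_eqI)
  show "atm ` G \<subseteq> tp" using atom_Z le_tp by blast
  fix z assume z: "z \<in> Z" "atm ` G \<subseteq> z"
  then show "tp \<subseteq> z" using atoms_top by blast
qed (auto simp: tp_Z)

end

lemma prodl_Nil [simp]: "prodl K n [] = unit_e K n"
  by (simp add: prodl_def)

lemma prodl_Cons [simp]: "prodl K n (x # xs) = mult K n x (prodl K n xs)"
  by (simp add: prodl_def)

lemma prodl_Mon: "set xs \<subseteq> Mon K n \<Longrightarrow> prodl K n xs \<in> Mon K n"
  by (induction xs) auto

lemma prodl_append:
  "set xs \<subseteq> Mon K n \<Longrightarrow> set ys \<subseteq> Mon K n \<Longrightarrow> prodl K n (xs @ ys) = mult K n (prodl K n xs) (prodl K n ys)"
  by (induction xs) (auto simp: prodl_Mon mult_assoc)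

lemma prodl_replicate_unit [simp]: "prodl K n (replicate m (unit_e K n)) = unit_e K n"
  by (induction m) auto

section \<open>Divisors of Delta, residuals and heads in the monoid\<close>

context garside_germ
begin

abbreviation "M \<equiv> Mon K n"
abbreviation "Sm \<equiv> Simples K n"
abbreviation "e \<equiv> unit_e K n"
abbreviation mul (infixl "\<odot>" 70) where "x \<odot> y \<equiv> mult K n x y"
abbreviation dv (infix "\<preceq>" 50) where "x \<preceq> y \<equiv> ldiv K n x y"
abbreviation "ge \<equiv> gelt K n"
abbreviation "DX \<equiv> DeltaX K n"

lemma Delta_el: "Delta K n = el tp"
  unfolding Delta_def by (simp add: DeltaX_atom_join atom_join_all)

text \<open>A left divisor of \<open>Delta\<close> has a word that is a prefix of a spelling of
  \<open>tp\<close>, and such prefixes spell states.\<close>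

lemma Simples_el: "Sm = el ` Z"
proof (intro equalityI subsetI)
  fix x assume "x \<in> el ` Z"
  then show "x \<in> Sm" unfolding Simples_def Delta_el using ldiv_el_el tp_Z le_tp el_Mon by auto
next
  fix x assume "x \<in> Sm"
  then have x: "x \<in> M" "x \<preceq> el tp" by (auto simp: Simples_def Delta_el)
  then obtain z where z: "z \<in> M" "el tp = x \<odot> z" by (auto simp: ldiv_def)
  obtain w where w: "w \<in> lists G" "x = cls K n w" using x(1) MonE by blast
  obtain v where v: "v \<in> lists G" "z = cls K n v" using z(1) MonE by blast
  have "wd tp \<doteq> w @ v" using z(2) w v by (simp add: el_def mult_cls cls_eq_iff)
  then have "word_of tp (w @ v)" using weq_word_of tp_Z word_of_wd by blast
  then have "rpath tp w" by (simp add: lang_append)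
  then obtain y where "y \<in> Z" "word_of y w" using path_word_of tp_Z by blast
  then show "x \<in> el ` Z" using el_word_of w by blast
qed

lemma finite_Simples: "finite Sm"
  unfolding Simples_el using finite_Z by simp

lemma Simples_Mon: "x \<in> Sm \<Longrightarrow> x \<in> M"
  by (simp add: Simples_def)

lemma unit_Simples: "e \<in> Sm"
  unfolding Simples_el using el_bot bot_Z by force

lemma gelt_Simples: "s \<in> G \<Longrightarrow> ge s \<in> Sm"
  unfolding Simples_el using el_atom atom_Z by force

lemma Simples_ldiv: "x \<in> M \<Longrightarrow> y \<in> Sm \<Longrightarrow> x \<preceq> y \<Longrightarrow> x \<in> Sm"
  unfolding Simples_def using ldiv_trans by blast

lemma DX_Simples: "X \<subseteq> G \<Longrightarrow> DX X \<in> Sm"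
  unfolding Simples_el using DeltaX_atom_join atom_join_Z by blast

lemma ldiv_DX: "X \<subseteq> G \<Longrightarrow> x \<in> M \<Longrightarrow> DX X \<preceq> x \<longleftrightarrow> (\<forall>s\<in>X. ge s \<preceq> x)"
  using DeltaX_atom_join ldiv_atom_join by simp

text \<open>Here \<open>x \<odot> r\<close> is the least common multiple of \<open>x\<close> and
  \<open>a\<close>; for simple \<open>x\<close> it is the element of a join of states, hence
  simple.\<close>

lemma residual:
  assumes "a \<in> Sm" "x \<in> M"
  obtains r where "r \<in> Sm" "\<And>y. y \<in> M \<Longrightarrow> a \<preceq> x \<odot> y \<longleftrightarrow> r \<preceq> y" "x \<in> Sm \<Longrightarrow> x \<odot> r \<in> Sm"
proof -
  obtain z where z: "z \<in> Z" "a = el z" using assms Simples_el by blast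
  obtain w where w: "w \<in> lists G" "x = cls K n w" using assms(2) by (rule MonE)
  have r: "resw z w \<in> Z" using resw_Z z w by blast
  have *: "a \<preceq> x \<odot> y \<longleftrightarrow> el (resw z w) \<preceq> y" if yM: "y \<in> M" for y
  proof -
    obtain v where v: "v \<in> lists G" "y = cls K n v" using yM by (rule MonE)
    then show ?thesis using z w r by (simp add: mult_cls ldiv_el_iff resw_append)
  qed
  have "x \<odot> el (resw z w) \<in> Sm" if xs: "x \<in> Sm"
  proof -
    obtain j where j: "j \<in> Z" "x = el j" using xs Simples_el by blast
    have "wd j \<doteq> w" using j(2) w(2) by (simp add: el_def flip: cls_eq_iff)
    then have jw: "word_of j w" using weq_word_of[OF _ j(1) word_of_wd[OF j(1)]] by blast
    have "word_of (j \<curlyvee> z) (w @ wd (resw z w))"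
      unfolding lang_append using resw_word_of[OF j(1) z(1) jw] word_of_wd[OF r]
        path_mono[OF j(1) join_Z[OF j(1) z(1)] join_ub1[OF j(1) z(1)]] jw
      by (simp add: lang_def)
    then have "x \<odot> el (resw z w) = el (j \<curlyvee> z)"
      using el_word_of[OF join_Z[OF j(1) z(1)]] w by (simp add: el_def mult_cls)
    then show ?thesis using Simples_el join_Z j z by blast
  qed
  then show thesis using that[of "el (resw z w)"] * r Simples_el by blast
qed

text \<open>The states dividing \<open>x\<close> are closed under joins, so a maximal one is
  greatest.\<close>

lemma ex_head:
  assumes "x \<in> M"
  obtains h where "h \<in> Sm" "h \<preceq> x" "\<And>a. a \<in> Sm \<Longrightarrow> a \<preceq> x \<Longrightarrow> a \<preceq> h"
proof -
  define A where "A = {z \<in> Z. el z \<preceq> x}"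
  have fin: "finite A" unfolding A_def using finite_Z by simp
  have "{} \<in> A" unfolding A_def using bot_Z el_bot ldiv_unit_left assms by simp
  then obtain m where m: "m \<in> A" "\<And>y. y \<in> A \<Longrightarrow> m \<subseteq> y \<Longrightarrow> m = y"
    using finite_has_maximal[OF fin] by blast
  have mz: "m \<in> Z" "el m \<preceq> x" using m A_def by auto
  have "y \<subseteq> m" if "y \<in> Z" "el y \<preceq> x" for y
  proof -
    have "m \<curlyvee> y \<in> A" unfolding A_def using join_Z ldiv_el_join mz that assms by simp
    then show ?thesis using m(2) join_ub1 join_ub2 mz that by metis
  qed
  then have "a \<preceq> el m" if "a \<in> Sm" "a \<preceq> x" for a
    using that mz ldiv_el_el unfolding Simples_el by blast
  then show thesis using that[of "el m"] mz Simples_el by blast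
qed

lemma mult_Simples_iff:
  assumes "a \<in> Sm"
  obtains c where "c \<in> M" "\<And>b. b \<in> M \<Longrightarrow> a \<odot> b \<in> Sm \<longleftrightarrow> b \<preceq> c"
proof -
  obtain c where c: "c \<in> M" "Delta K n = a \<odot> c"
    using assms by (auto simp: Simples_def ldiv_def)
  have "a \<odot> b \<in> Sm \<longleftrightarrow> b \<preceq> c" if "b \<in> M" for b
    unfolding Simples_def c(2) using that c assms Simples_Mon ldiv_mult_cancel by auto
  then show thesis using that c by blast
qed

text \<open>Simplicity of \<open>a \<odot> b\<close> means that \<open>b\<close> divides the
  complement of \<open>a\<close> in \<open>Delta\<close>, and for a least common multiple this is
  tested on the generators. The index set of \<open>hfun\<close> thereby becomes a full power set,
  the shape that inclusion-exclusion produces.\<close>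

lemma mult_DX_Simples:
  assumes "a \<in> Sm" "X \<subseteq> G"
  shows "a \<odot> DX X \<in> Sm \<longleftrightarrow> X \<inter> Rset K n a = {}"
proof -
  obtain c where c: "c \<in> M" "\<And>b. b \<in> M \<Longrightarrow> a \<odot> b \<in> Sm \<longleftrightarrow> b \<preceq> c" using assms mult_Simples_iff by blast
  have "a \<odot> DX X \<in> Sm \<longleftrightarrow> (\<forall>s\<in>X. ge s \<preceq> c)"
    using c assms DX_Simples Simples_Mon ldiv_DX by simp
  also have "\<dots> \<longleftrightarrow> (\<forall>s\<in>X. a \<odot> ge s \<in> Sm)" using c assms by (meson gelt_Mon subsetD)
  finally show ?thesis using assms(2) by (auto simp: Rset_def)
qed

lemma gelt_square_not_simple:
  assumes "s \<in> G" "x \<in> M" shows "(x \<odot> ge s) \<odot> ge s \<notin> Sm"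
proof
  assume a: "(x \<odot> ge s) \<odot> ge s \<in> Sm"
  obtain w where w: "w \<in> lists G" "x = cls K n w" using assms(2) by (rule MonE)
  obtain z where z: "z \<in> Z" "cls K n (w @ [s, s]) = el z"
    using a w by (auto simp: Simples_el gelt_def mult_cls)
  then have "wd z \<doteq> w @ [s, s]" by (simp add: el_def flip: cls_eq_iff)
  then have "word_of z (w @ [s, s])" using weq_word_of[OF _ z(1) word_of_wd[OF z(1)]] by blast
  then have *: "rpath z w" "atm s \<in> quo q z w" "atm s \<in> q s (quo q z w)"
    by (auto simp: lang_append lang_Cons)
  then show False using q_not_at assms(1) path_Z z(1) by blast
qed

subsection \<open>Normal forms\<close>

definition normal :: "elt list \<Rightarrow> bool" where
  "normal xs \<longleftrightarrow> set xs \<subseteq> Sm \<and> successively (arrow K n) xs"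

lemma normal_nth:
  "normal xs \<longleftrightarrow> set xs \<subseteq> Sm \<and> (\<forall>i. Suc i < length xs \<longrightarrow> arrow K n (xs ! i) (xs ! Suc i))"
  by (simp add: normal_def successively_conv_nth)

lemma normal_Nil [simp]: "normal []"
  by (simp add: normal_def)

lemma normal_Cons: "normal (x # xs) \<longleftrightarrow> x \<in> Sm \<and> (xs \<noteq> [] \<longrightarrow> arrow K n x (hd xs)) \<and> normal xs"
  by (auto simp: normal_def successively_Cons)

lemma normal_Mon: "normal xs \<Longrightarrow> set xs \<subseteq> M"
  using Simples_Mon by (auto simp: normal_def)

lemma arrow_unit: "arrow K n x e"
  unfolding arrow_def Lset_def using ldiv_len[of "gelt K n _" K n e] by fastforce

lemma normal_append_units: "normal xs \<Longrightarrow> normal (xs @ replicate m e)"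
proof (induction xs)
  case Nil
  show ?case using arrow_unit unit_Simples
    by (induction m) (auto simp: normal_Cons hd_replicate)
next
  case (Cons x xs)
  then show ?case using arrow_unit unit_Simples
    by (cases xs) (auto simp: normal_Cons hd_append hd_replicate)
qed

text \<open>Let \<open>r\<close> be the residual of \<open>a\<close> by \<open>y\<close>. By
  induction \<open>r\<close> divides \<open>y'\<close>, and \<open>y \<odot> r\<close> is simple. A
  generator dividing \<open>r\<close> would lie in the left set of \<open>y'\<close> but not in the
  right set of \<open>y\<close>, against the arrow; so \<open>r\<close> is the unit.\<close>

lemma normal_head: "\<lbrakk>normal (y # ys); a \<in> Sm; a \<preceq> prodl K n (y # ys)\<rbrakk> \<Longrightarrow> a \<preceq> y"
proof (induction ys arbitrary: a y)
  case Nil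
  then show ?case using Simples_Mon by (simp add: normal_Cons)
next
  case (Cons y' ys)
  have y: "y \<in> Sm" "y \<in> M" "arrow K n y y'" and n': "normal (y' # ys)"
    using Cons.prems Simples_Mon by (auto simp: normal_Cons)
  let ?P = "prodl K n (y' # ys)"
  have P: "?P \<in> M" using n' normal_Mon prodl_Mon by blast
  obtain r where r: "r \<in> Sm" "\<And>x. x \<in> M \<Longrightarrow> a \<preceq> y \<odot> x \<longleftrightarrow> r \<preceq> x" "y \<odot> r \<in> Sm"
    using residual[OF Cons.prems(2) y(2)] y(1) by metis
  have "r \<preceq> ?P" using r(2)[OF P] Cons.prems(3) by simp
  then have ry: "r \<preceq> y'" using Cons.IH n' r(1) by blast
  have "r = e"
  proof (rule ccontr)
    assume "r \<noteq> e"
    then obtain s where s: "s \<in> G" "ge s \<preceq> r" using Mon_has_gen r(1) Simples_Mon by blast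
    then have "ge s \<preceq> y'" using ry ldiv_trans gelt_Mon by blast
    then have "s \<in> Rset K n y" using y(3) s by (auto simp: arrow_def Lset_def)
    moreover have "y \<odot> ge s \<preceq> y \<odot> r" using ldiv_mult_mono y s by simp
    then have "y \<odot> ge s \<in> Sm" using Simples_ldiv r(3) y s by simp
    ultimately show False by (simp add: Rset_def)
  qed
  then show ?case using r(2)[of e] y ldiv_refl[of e K n] by simp
qed

lemma normal_unique:
  "\<lbrakk>normal xs; normal ys; length xs = length ys; prodl K n xs = prodl K n ys\<rbrakk> \<Longrightarrow> xs = ys"
proof (induction xs arbitrary: ys)
  case (Cons x xs)
  then obtain y ys' where ys: "ys = y # ys'" by (cases ys) auto
  have m: "x \<in> Sm" "y \<in> Sm" "x \<in> M" "y \<in> M" "normal xs" "normal ys'"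
    using Cons.prems ys Simples_Mon by (auto simp: normal_Cons)
  have p: "prodl K n xs \<in> M" "prodl K n ys' \<in> M" using m normal_Mon prodl_Mon by auto
  have eq: "x \<odot> prodl K n xs = y \<odot> prodl K n ys'" using Cons.prems ys by simp
  have "x \<preceq> y" using normal_head[of y ys' x] Cons.prems ys m ldiv_mult[OF p(1), of x] eq by simp
  moreover have "y \<preceq> x" using normal_head[of x xs y] Cons.prems ys m ldiv_mult[OF p(2), of y] eq by simp
  ultimately have "x = y" using ldiv_antisym m by blast
  then have "prodl K n xs = prodl K n ys'" using mult_left_cancel[OF m(3) p] eq by simp
  then have "xs = ys'" using Cons.IH[OF m(5,6)] Cons.prems(3) ys by simp
  with \<open>x = y\<close> ys show ?case by simp
qed simp

text \<open>Each simple factor of the divisor uses up at most one entry of the normal sequence,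
  because a simple divisor only sees the head. The factor \<open>a\<close> stands for what has been
  read but not yet divided out, and is there for the induction.\<close>

lemma normal_prefix:
  "\<lbrakk>normal ys; set xs \<subseteq> Sm; a \<in> M; prodl K n xs \<preceq> a \<odot> prodl K n ys\<rbrakk>
    \<Longrightarrow> prodl K n xs \<preceq> a \<odot> prodl K n (take (length xs) ys)"
proof (induction xs arbitrary: a ys)
  case Nil
  then show ?case by (simp add: ldiv_unit_left)
next
  case (Cons x xs)
  show ?case
  proof (cases ys)
    case (Cons y ys')
    have m: "x \<in> Sm" "x \<in> M" "set xs \<subseteq> Sm" "y \<in> M" "normal ys'"
      using Cons.prems Cons Simples_Mon by (auto simp: normal_Cons)
    have "set xs \<subseteq> M" using m Simples_Mon by blast
    then have p: "prodl K n ys \<in> M" "prodl K n ys' \<in> M" "prodl K n xs \<in> M"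
      "prodl K n (take (length xs) ys') \<in> M"
      using normal_Mon[OF Cons.prems(1)] normal_Mon[OF m(5)] set_take_subset[of "length xs" ys']
      by (auto intro!: prodl_Mon)
    obtain r where r: "r \<in> Sm" "\<And>z. z \<in> M \<Longrightarrow> x \<preceq> a \<odot> z \<longleftrightarrow> r \<preceq> z"
      using residual[OF m(1) Cons.prems(3)] by metis
    have "x \<preceq> prodl K n (x # xs)" using p ldiv_mult by simp
    then have "x \<preceq> a \<odot> prodl K n ys" using Cons.prems ldiv_trans m by blast
    then have "r \<preceq> y" using r p normal_head Cons.prems Cons by blast
    then have "x \<preceq> a \<odot> y" using r m by blast
    then obtain b where b: "b \<in> M" "a \<odot> y = x \<odot> b" by (auto simp: ldiv_def)
    have eq: "a \<odot> (y \<odot> z) = x \<odot> (b \<odot> z)" if "z \<in> M" for z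
      using that b Cons.prems m mult_assoc by metis
    have "x \<odot> prodl K n xs \<preceq> x \<odot> (b \<odot> prodl K n ys')"
      using Cons.prems(4) Cons eq[OF p(2)] by simp
    then have "prodl K n xs \<preceq> b \<odot> prodl K n ys'" using ldiv_mult_cancel m p b by simp
    then have "prodl K n xs \<preceq> b \<odot> prodl K n (take (length xs) ys')" using Cons.IH m b by blast
    then have "x \<odot> prodl K n xs \<preceq> x \<odot> (b \<odot> prodl K n (take (length xs) ys'))"
      using ldiv_mult_cancel m p b by simp
    then show ?thesis using eq[OF p(4)] Cons by simp
  qed (use Cons.prems in simp)
qed

text \<open>Greedy choice: divide by the greatest simple divisor \<open>h\<close>. A generator
  \<open>t\<close> dividing the next entry with \<open>h \<odot> t\<close> simple would give a
  larger simple divisor.\<close>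

lemma ex_normal:
  "x \<in> M \<Longrightarrow> \<exists>xs. normal xs \<and> e \<notin> set xs \<and> prodl K n xs = x"
proof (induction "len x" arbitrary: x rule: less_induct)
  case less
  show ?case
  proof (cases "x = e")
    case True
    then show ?thesis by (intro exI[of _ "[]"]) simp
  next
    case False
    obtain h where h: "h \<in> Sm" "h \<preceq> x" "\<And>a. a \<in> Sm \<Longrightarrow> a \<preceq> x \<Longrightarrow> a \<preceq> h"
      using ex_head less.prems by blast
    obtain s where s: "s \<in> G" "ge s \<preceq> x" using Mon_has_gen less.prems False by blast
    have hM: "h \<in> M" using h Simples_Mon by blast
    have "ge s \<preceq> h" using h s gelt_Simples by blast
    then have "h \<noteq> e" "len h > 0" using ldiv_len[of "ge s" K n h] s by (auto)
    obtain y where y: "y \<in> M" "x = h \<odot> y" using h by (auto simp: ldiv_def)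
    then obtain ys where ys: "normal ys" "e \<notin> set ys" "prodl K n ys = y"
      using less.hyps[of y] \<open>len h > 0\<close> hM by auto
    have "arrow K n h (hd ys)" if "ys \<noteq> []"
      unfolding arrow_def
    proof
      fix t assume t: "t \<in> Lset K n (hd ys)"
      obtain y1 ys' where yy: "ys = y1 # ys'" using \<open>ys \<noteq> []\<close> by (cases ys) auto
      have y1: "y1 \<in> M" "prodl K n ys' \<in> M"
        using ys(1) yy normal_Mon[of ys'] prodl_Mon[of ys'] Simples_Mon by (auto simp: normal_Cons)
      have tG: "t \<in> G" "ge t \<preceq> y1" using t yy by (auto simp: Lset_def)
      then have "ge t \<preceq> y" using ys(3) yy y1 ldiv_trans[OF _ _ ldiv_mult[OF y1(2)], of "ge t" y1] by simp
      then have "h \<odot> ge t \<preceq> x" using ldiv_mult_mono hM tG y by simp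
      have "h \<odot> ge t \<notin> Sm"
      proof
        assume "h \<odot> ge t \<in> Sm"
        then have "h \<odot> ge t \<preceq> h" using h \<open>h \<odot> ge t \<preceq> x\<close> by blast
        then show False using ldiv_len[of "h \<odot> ge t" K n h] hM tG by simp
      qed
      then show "t \<in> Rset K n h" using tG by (simp add: Rset_def)
    qed
    then show ?thesis using h ys y \<open>h \<noteq> e\<close> by (intro exI[of _ "h # ys"]) (auto simp: normal_Cons)
  qed
qed

lemma normal_unique_padded:
  assumes "normal xs" "normal ys" "prodl K n xs = prodl K n ys" "length xs \<le> length ys"
  shows "ys = xs @ replicate (length ys - length xs) e"
proof -
  have u: "set (replicate (length ys - length xs) e) \<subseteq> M" by auto
  show ?thesis
    by (rule normal_unique)
      (use assms normal_append_units in \<open>auto simp: prodl_append[OF normal_Mon u] prodl_Mon normal_Mon\<close>)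
qed

lemma is_nf_nf:
  assumes "x \<in> M" shows "is_nf K n (nf K n x) x"
proof (cases "x = e")
  case True
  have "is_nf K n [e] x" using True by (simp add: is_nf_def)
  moreover have "xs = [e]" if "is_nf K n xs x" for xs using that True by (simp add: is_nf_def)
  ultimately show ?thesis unfolding nf_def by (rule theI)
next
  case False
  have iff: "is_nf K n xs x \<longleftrightarrow> normal xs \<and> e \<notin> set xs \<and> prodl K n xs = x" for xs
    using False by (auto simp: is_nf_def normal_nth)
  obtain xs where xs: "normal xs" "e \<notin> set xs" "prodl K n xs = x" using ex_normal assms by blast
  have "ys = zs" if "is_nf K n ys x" "is_nf K n zs x" "length ys \<le> length zs" for ys zs
  proof -
    have "zs = ys @ replicate (length zs - length ys) e"
      using normal_unique_padded that iff by auto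
    moreover have "e \<notin> set zs" using that iff by blast
    ultimately have "length zs - length ys = 0"
      by (metis Un_iff gr0I in_set_replicate set_append)
    then show ?thesis using \<open>zs = _\<close> by simp
  qed
  then have "ys = xs" if "is_nf K n ys x" for ys
    using that xs iff by (metis linear)
  then show ?thesis unfolding nf_def using theI[of "\<lambda>xs. is_nf K n xs x" xs] xs iff by blast
qed

lemma nf_normal: "x \<in> M \<Longrightarrow> normal (nf K n x)" "x \<in> M \<Longrightarrow> prodl K n (nf K n x) = x"
  using is_nf_nf[of x] unit_Simples by (auto simp: is_nf_def normal_nth)

section \<open>Initial segments of sequences and the embedded monoid\<close>

definition pre :: "nat \<Rightarrow> (nat \<Rightarrow> elt) \<Rightarrow> elt" where "pre k \<xi> = prodl K n (map \<xi> [0..<k])"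

lemma normal_iff_arrows:
  "normal (map \<xi> [0..<k]) \<longleftrightarrow> (\<forall>i<k. \<xi> i \<in> Sm) \<and> (\<forall>i. Suc i < k \<longrightarrow> arrow K n (\<xi> i) (\<xi> (Suc i)))"
  by (auto simp: normal_nth)

lemma Mbar_normal: "\<xi> \<in> Mbar K n \<Longrightarrow> normal (map \<xi> [0..<k])"
  by (auto simp: normal_iff_arrows Mbar_def)

lemma pre_Suc: "\<lbrakk>\<And>i. i \<le> k \<Longrightarrow> \<xi> i \<in> Sm\<rbrakk> \<Longrightarrow> pre (Suc k) \<xi> = pre k \<xi> \<odot> \<xi> k"
  unfolding pre_def using Simples_Mon by (subst upt_Suc_append) (auto simp: prodl_append image_subset_iff)

lemma pre_Mon: "\<lbrakk>\<And>i. i < k \<Longrightarrow> \<xi> i \<in> Sm\<rbrakk> \<Longrightarrow> pre k \<xi> \<in> M"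
  unfolding pre_def using Simples_Mon by (auto intro!: prodl_Mon)

lemma pre_cong: "\<lbrakk>\<And>i. i < k \<Longrightarrow> \<xi> i = \<zeta> i\<rbrakk> \<Longrightarrow> pre k \<xi> = pre k \<zeta>"
  unfolding pre_def by (rule arg_cong[where f = "prodl K n"]) auto

lemma Mbar_Simples: "\<xi> \<in> Mbar K n \<Longrightarrow> \<xi> i \<in> Sm"
  by (simp add: Mbar_def)

lemma pre_ldiv: "\<xi> \<in> Mbar K n \<Longrightarrow> k \<le> m \<Longrightarrow> pre k \<xi> \<preceq> pre m \<xi>"
proof (induction m)
  case 0
  then show ?case using ldiv_refl pre_Mon by simp
next
  case (Suc m)
  have "pre m \<xi> \<preceq> pre (Suc m) \<xi>"
    using pre_Suc[of m \<xi>] Mbar_Simples[OF Suc.prems(1)] Simples_Mon ldiv_mult by simp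
  then show ?case using Suc ldiv_refl pre_Mon Mbar_Simples ldiv_trans
    by (metis le_Suc_eq)
qed

lemma map_embed: "length (nf K n x) \<le> k \<Longrightarrow>
    map (embed K n x) [0..<k] = nf K n x @ replicate (k - length (nf K n x)) e"
  by (rule nth_equalityI) (auto simp: embed_def nth_append)

lemma embed_Mbar: assumes "x \<in> M" shows "embed K n x \<in> Mbar K n"
proof -
  have "normal (map (embed K n x) [0..<N])" if "length (nf K n x) \<le> N" for N
    using map_embed[OF that] normal_append_units[OF nf_normal(1)[OF assms]] by simp
  then have "embed K n x k \<in> Sm \<and> arrow K n (embed K n x k) (embed K n x (Suc k))" for k
    unfolding normal_iff_arrows by (elim meta_allE[of _ "k + 2 + length (nf K n x)"]) simp
  then show ?thesis by (simp add: Mbar_def)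
qed

lemma pre_embed:
  assumes "x \<in> M" "length (nf K n x) \<le> k" shows "pre k (embed K n x) = x"
proof -
  have u: "set (replicate m e) \<subseteq> M" for m by auto
  show ?thesis
    unfolding pre_def map_embed[OF assms(2)] prodl_append[OF normal_Mon[OF nf_normal(1)[OF assms(1)]] u]
    using nf_normal(2)[OF assms(1)] assms(1) by simp
qed

text \<open>Truncations of a sequence, read as elements of the monoid, agree with it up to the cut;
  this is the density of the monoid in \<open>Mbar\<close>.\<close>

lemma embed_pre:
  assumes "\<xi> \<in> Mbar K n" "i < m" shows "embed K n (pre m \<xi>) i = \<xi> i"
proof -
  let ?x = "pre m \<xi>"
  have x: "?x \<in> M" using pre_Mon Mbar_Simples assms by blast
  define N where "N = m + length (nf K n ?x)"
  have "map (embed K n ?x) [0..<N] = map \<xi> [0..<m] @ replicate (N - m) e"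
    using normal_unique_padded[OF Mbar_normal[OF assms(1)] Mbar_normal[OF embed_Mbar[OF x]], of m N]
      pre_embed[OF x, of N] by (simp add: N_def pre_def)
  then have "map (embed K n ?x) [0..<N] ! i = (map \<xi> [0..<m] @ replicate (N - m) e) ! i" by simp
  then show ?thesis using assms(2) by (simp add: nth_append N_def)
qed

end

section \<open>Cylinders and uniform measures\<close>

text \<open>Intersecting with \<open>E\<close> lets the empty index set contribute
  \<open>f E\<close>, an empty intersection being the whole type. The formula serves for the measure
  of cylinders and again for counting elements of given length.\<close>

lemma incl_excl_diff:
  fixes f :: "'a set \<Rightarrow> real"
  assumes "Incl_Excl P f" "finite A" "P E" "\<And>a. a \<in> A \<Longrightarrow> P (B a)" "\<And>a. a \<in> A \<Longrightarrow> B a \<subseteq> E"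
  shows "f (E - \<Union>(B ` A)) = (\<Sum>X\<in>Pow A. (-1) ^ card X * f (E \<inter> \<Inter>(B ` X)))"
proof -
  interpret Incl_Excl P f by fact
  have PU: "P (\<Union>(B ` C))" if "C \<subseteq> A" for C
  proof -
    have "finite C" using that assms(2) finite_subset by blast
    then show ?thesis using that by (induction C rule: finite_induct) (auto simp: empty intro!: Un assms(4))
  qed
  let ?U = "\<Union>(B ` A)"
  have "?U \<subseteq> E" using assms(5) by blast
  then have "(E - ?U) \<union> ?U = E" by blast
  then have "f E = f (E - ?U) + f ?U"
    using disj_add[of "E - ?U" ?U] Diff[OF assms(3) PU[of A]] PU[of A] by (auto simp: disjnt_def)
  moreover have "f ?U = (\<Sum>X | X \<subseteq> A \<and> X \<noteq> {}. (-1) ^ (card X + 1) * f (\<Inter>(B ` X)))"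
    using restricted_indexed assms by blast
  moreover have "\<dots> = - (\<Sum>X\<in>Pow A - {{}}. (-1) ^ card X * f (E \<inter> \<Inter>(B ` X)))"
    unfolding sum_negf[symmetric]
  proof (rule sum.cong)
    fix X assume "X \<in> Pow A - {{}}"
    then have "\<Inter>(B ` X) = E \<inter> \<Inter>(B ` X)" using assms(5) by blast
    then show "(-1) ^ (card X + 1) * f (\<Inter>(B ` X)) = - ((-1) ^ card X * f (E \<inter> \<Inter>(B ` X)))" by simp
  qed auto
  moreover have "(\<Sum>X\<in>Pow A. (-1) ^ card X * f (E \<inter> \<Inter>(B ` X))) =
      f E + (\<Sum>X\<in>Pow A - {{}}. (-1) ^ card X * f (E \<inter> \<Inter>(B ` X)))"
    using assms(2) by (subst sum.remove[of _ "{}"]) auto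
  ultimately show ?thesis by simp
qed

section \<open>Topology of the sequence space\<close>

context garside_germ
begin

lemma topspace_Mbar_top: "topspace (Mbar_top K n) = Mbar K n"
  unfolding Mbar_top_def by (auto simp: Mbar_def)

lemma openin_cylinder: "openin (Mbar_top K n) {\<xi> \<in> Mbar K n. Q (map \<xi> [0..<k])}"
proof -
  let ?T = "{\<xi> \<in> Pi\<^sub>E UNIV (\<lambda>_. Sm). Q (map \<xi> [0..<k])}"
  have "openin (product_topology (\<lambda>_. discrete_topology Sm) UNIV) ?T"
    unfolding openin_product_topology_alt
  proof
    fix \<xi> assume \<xi>: "\<xi> \<in> ?T"
    let ?U = "\<lambda>i. if i < k then {\<xi> i} else Sm"
    have "{i \<in> UNIV. ?U i \<noteq> topspace (discrete_topology Sm)} \<subseteq> {..<k}" by (auto split: if_splits)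
    then have 1: "finite {i \<in> UNIV. ?U i \<noteq> topspace (discrete_topology Sm)}" using finite_subset by blast
    have 2: "Pi\<^sub>E UNIV ?U \<subseteq> ?T"
    proof
      fix \<zeta> assume \<zeta>: "\<zeta> \<in> Pi\<^sub>E UNIV ?U"
      have eq: "\<zeta> i = \<xi> i" if "i < k" for i
        using PiE_mem[OF \<zeta>, of i] that by simp
      then have "map \<zeta> [0..<k] = map \<xi> [0..<k]" by simp
      then have "Q (map \<zeta> [0..<k])" using \<xi> by (simp only: mem_Collect_eq)
      moreover have "\<zeta> i \<in> Sm" for i
        using PiE_mem[OF \<zeta>, of i] \<xi> by (auto split: if_splits)
      ultimately show "\<zeta> \<in> ?T" using \<xi> by auto
    qed
    show "\<exists>U. finite {i \<in> UNIV. U i \<noteq> topspace (discrete_topology Sm)} \<and>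
        (\<forall>i\<in>UNIV. openin (discrete_topology Sm) (U i)) \<and> \<xi> \<in> Pi\<^sub>E UNIV U \<and> Pi\<^sub>E UNIV U \<subseteq> ?T"
      using 1 2 \<xi> by (intro exI[of _ ?U]) auto
  qed
  moreover have "{\<xi> \<in> Mbar K n. Q (map \<xi> [0..<k])} = ?T \<inter> Mbar K n"
    by (auto simp: Mbar_def)
  ultimately show ?thesis unfolding Mbar_top_def openin_subtopology by blast
qed

lemma open_contains_cylinder:
  assumes "openin (Mbar_top K n) T" "\<xi> \<in> T"
  obtains N where "\<And>\<zeta>. \<lbrakk>\<zeta> \<in> Mbar K n; \<And>i. i < N \<Longrightarrow> \<zeta> i = \<xi> i\<rbrakk> \<Longrightarrow> \<zeta> \<in> T"
proof -
  obtain T' where T': "openin (product_topology (\<lambda>_. discrete_topology Sm) UNIV) T'" "T = T' \<inter> Mbar K n"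
    using assms unfolding Mbar_top_def openin_subtopology by blast
  then have "\<xi> \<in> T'" using assms by blast
  then obtain U where U: "finite {i. U i \<noteq> Sm}" "\<xi> \<in> Pi\<^sub>E UNIV U" "Pi\<^sub>E UNIV U \<subseteq> T'"
    using T'(1) unfolding openin_product_topology_alt by auto
  obtain N where N: "\<And>i. U i \<noteq> Sm \<Longrightarrow> i < N"
    using finite_nat_bounded[OF U(1)] by auto
  show thesis
  proof (rule that[of N])
    fix \<zeta> assume \<zeta>: "\<zeta> \<in> Mbar K n" "\<And>i. i < N \<Longrightarrow> \<zeta> i = \<xi> i"
    have "\<zeta> i \<in> U i" for i
      using N[of i] \<zeta>(2)[of i] Mbar_Simples[OF \<zeta>(1), of i] PiE_mem[OF U(2), of i] by (cases "U i = Sm") auto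
    then have "\<zeta> \<in> Pi\<^sub>E UNIV U" by auto
    then show "\<zeta> \<in> T" using U T' \<zeta> by blast
  qed
qed

text \<open>A point of the closure agrees on its first entries with some multiple of the product,
  and \<open>normal_prefix\<close> brings the divisibility down to those entries. Conversely, long
  truncations of the sequence are multiples that converge to it.\<close>

lemma Up_eq:
  assumes "set xs \<subseteq> Sm"
  shows "Up K n (prodl K n xs) = {\<xi> \<in> Mbar K n. prodl K n xs \<preceq> pre (length xs) \<xi>}"
proof -
  let ?x = "prodl K n xs" and ?k = "length xs"
  have x: "?x \<in> M" using assms Simples_Mon prodl_Mon by blast
  show ?thesis
  proof (intro equalityI subsetI)
    fix \<xi> assume "\<xi> \<in> Up K n ?x"
    then have 1: "\<xi> \<in> Mbar K n" and 2: "\<And>T. \<xi> \<in> T \<Longrightarrow> openin (Mbar_top K n) T \<Longrightarrow>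
        \<exists>y. y \<in> embed K n ` {?x \<odot> z |z. z \<in> M} \<and> y \<in> T"
      unfolding Up_def in_closure_of topspace_Mbar_top by blast+
    let ?T = "{\<zeta> \<in> Mbar K n. map \<zeta> [0..<?k] = map \<xi> [0..<?k]}"
    obtain z where z: "z \<in> M" "embed K n (?x \<odot> z) \<in> ?T"
      using 2[of ?T] 1 openin_cylinder[of "\<lambda>l. l = map \<xi> [0..<?k]" ?k] by auto
    let ?y = "?x \<odot> z"
    have y: "?y \<in> M" using x z by simp
    define N where "N = ?k + length (nf K n ?y)"
    have "?x \<preceq> pre N (embed K n ?y)" using pre_embed[OF y, of N] ldiv_mult z by (simp add: N_def)
    then have "?x \<preceq> e \<odot> prodl K n (map (embed K n ?y) [0..<N])"
      using pre_Mon[of N "embed K n ?y"] Mbar_Simples[OF embed_Mbar[OF y]] by (simp add: pre_def)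
    then have "?x \<preceq> e \<odot> prodl K n (take ?k (map (embed K n ?y) [0..<N]))"
      by (rule normal_prefix[OF Mbar_normal[OF embed_Mbar[OF y]] assms unit_Mon])
    moreover have "take ?k (map (embed K n ?y) [0..<N]) = map (embed K n ?y) [0..<?k]"
      by (simp add: take_map N_def)
    ultimately have "?x \<preceq> pre ?k (embed K n ?y)"
      using pre_Mon[of ?k "embed K n ?y"] Mbar_Simples[OF embed_Mbar[OF y]] by (simp add: pre_def)
    moreover have "pre ?k (embed K n ?y) = pre ?k \<xi>"
      using z(2) unfolding pre_def mem_Collect_eq by presburger
    ultimately show "\<xi> \<in> {\<xi> \<in> Mbar K n. ?x \<preceq> pre ?k \<xi>}" using 1 by simp
  next
    fix \<xi> assume "\<xi> \<in> {\<xi> \<in> Mbar K n. ?x \<preceq> pre ?k \<xi>}"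
    then have \<xi>: "\<xi> \<in> Mbar K n" "?x \<preceq> pre ?k \<xi>" by auto
    have "\<exists>y. y \<in> embed K n ` {?x \<odot> z |z. z \<in> M} \<and> y \<in> T"
      if T: "\<xi> \<in> T" "openin (Mbar_top K n) T" for T
    proof -
      obtain N where N: "\<And>\<zeta>. \<lbrakk>\<zeta> \<in> Mbar K n; \<And>i. i < N \<Longrightarrow> \<zeta> i = \<xi> i\<rbrakk> \<Longrightarrow> \<zeta> \<in> T"
        using open_contains_cylinder[OF T(2,1)] by blast
      let ?m = "N + ?k"
      have m: "pre ?m \<xi> \<in> M" using pre_Mon Mbar_Simples \<xi> by blast
      have "?x \<preceq> pre ?m \<xi>" using \<xi> pre_ldiv[OF \<xi>(1), of ?k ?m] ldiv_trans x by simp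
      then have "embed K n (pre ?m \<xi>) \<in> embed K n ` {?x \<odot> z |z. z \<in> M}" by (auto simp: ldiv_def)
      moreover have "embed K n (pre ?m \<xi>) \<in> T"
        using N[OF embed_Mbar[OF m]] embed_pre[OF \<xi>(1)] by simp
      ultimately show ?thesis by blast
    qed
    then show "\<xi> \<in> Up K n ?x" unfolding Up_def in_closure_of topspace_Mbar_top using \<xi> by blast
  qed
qed

lemma hfun_alt:
  assumes "a \<in> Sm"
  shows "hfun K n p a = (\<Sum>X\<in>Pow (G - Rset K n a). (-1) ^ card X * p ^ len (a \<odot> DX X))"
proof -
  have "{X. X \<subseteq> G \<and> a \<odot> DX X \<in> Sm} = Pow (G - Rset K n a)"
    using mult_DX_Simples[OF assms] by auto
  then show ?thesis by (simp add: hfun_def)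
qed

text \<open>Let \<open>r\<close> be the quotient of the initial product by \<open>z\<close>. If only
  generators in \<open>Rset K n (x m)\<close> can divide \<open>r\<close>, then a normal form of
  \<open>r\<close> may be appended to \<open>x\<close>. The result has the same product as the first
  entries of \<xi>, and uniqueness of normal forms identifies it with their padding by
  units.\<close>

lemma cylinder_complement:
  assumes "normal (map x [0..<Suc m])"
  defines "z \<equiv> pre (Suc m) x"
  shows "{\<xi> \<in> Mbar K n. \<forall>i<Suc m. \<xi> i = x i} =
    {\<xi> \<in> Mbar K n. z \<preceq> pre (Suc m) \<xi>} - (\<Union>s\<in>G - Rset K n (x m). {\<xi> \<in> Mbar K n. z \<odot> ge s \<preceq> pre (Suc m) \<xi>})"
proof (intro equalityI subsetI)
  have xS: "\<And>i. i \<le> m \<Longrightarrow> x i \<in> Sm" using assms(1) unfolding normal_iff_arrows by simp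
  have zM: "z \<in> M" unfolding z_def using xS pre_Mon by (metis less_Suc_eq_le)
  {
    fix \<xi> assume \<xi>: "\<xi> \<in> {\<xi> \<in> Mbar K n. \<forall>i<Suc m. \<xi> i = x i}"
    then have "pre (Suc m) \<xi> = z" unfolding z_def by (intro pre_cong) auto
    moreover have "\<not> z \<odot> ge s \<preceq> z" if "s \<in> G" for s
      using ldiv_len[of "z \<odot> ge s" K n z] zM that by auto
    ultimately show "\<xi> \<in> {\<xi> \<in> Mbar K n. z \<preceq> pre (Suc m) \<xi>} - (\<Union>s\<in>G - Rset K n (x m). {\<xi> \<in> Mbar K n. z \<odot> ge s \<preceq> pre (Suc m) \<xi>})"
      using \<xi> ldiv_refl zM by auto
  next
    fix \<xi> assume a: "\<xi> \<in> {\<xi> \<in> Mbar K n. z \<preceq> pre (Suc m) \<xi>} - (\<Union>s\<in>G - Rset K n (x m). {\<xi> \<in> Mbar K n. z \<odot> ge s \<preceq> pre (Suc m) \<xi>})"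
    then have \<xi>: "\<xi> \<in> Mbar K n" "z \<preceq> pre (Suc m) \<xi>" by auto
    obtain r where r: "r \<in> M" "pre (Suc m) \<xi> = z \<odot> r" using \<xi> by (auto simp: ldiv_def)
    obtain rs where rs: "normal rs" "e \<notin> set rs" "prodl K n rs = r" using ex_normal r by blast
    have no: "\<not> ge s \<preceq> r" if "s \<in> G" "s \<notin> Rset K n (x m)" for s
    proof
      assume "ge s \<preceq> r"
      then have "z \<odot> ge s \<preceq> z \<odot> r" using ldiv_mult_mono that zM by simp
      then show False using a that r by auto
    qed
    have "normal (map x [0..<Suc m] @ rs)"
    proof (cases rs)
      case (Cons r1 rs')
      have r1: "r1 \<in> M" "prodl K n rs' \<in> M" using rs Cons Simples_Mon normal_Mon prodl_Mon by (auto simp: normal_Cons)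
      have "arrow K n (x m) r1"
        unfolding arrow_def
      proof
        fix s assume "s \<in> Lset K n r1"
        then have s: "s \<in> G" "ge s \<preceq> r1" by (auto simp: Lset_def)
        have "ge s \<preceq> r1 \<odot> prodl K n rs'" using ldiv_trans[OF _ s(2) ldiv_mult[OF r1(2)]] s by simp
        then have "ge s \<preceq> r" using rs Cons by simp
        then show "s \<in> Rset K n (x m)" using no s by blast
      qed
      then show ?thesis
        using rs(1) assms(1) Cons by (simp add: normal_def successively_append_iff)
    qed (use assms in simp)
    moreover have pr: "prodl K n (map x [0..<Suc m] @ rs) = prodl K n (map \<xi> [0..<Suc m])"
      using r rs prodl_append[OF normal_Mon[OF assms(1)] normal_Mon[OF rs(1)]]
      by (simp add: pre_def z_def del: upt_Suc)
    ultimately have "map x [0..<Suc m] @ rs = map \<xi> [0..<Suc m] @ replicate (length rs) e"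
      using normal_unique_padded[OF Mbar_normal[OF \<xi>(1)], of "map x [0..<Suc m] @ rs" "Suc m"]
      by (simp del: upt_Suc)
    then have "map x [0..<Suc m] = map \<xi> [0..<Suc m]" by (simp del: upt_Suc)
    then have "\<forall>i<Suc m. \<xi> i = x i" by (simp del: upt_Suc add: map_eq_conv)
    then show "\<xi> \<in> {\<xi> \<in> Mbar K n. \<forall>i<Suc m. \<xi> i = x i}" using \<xi> by simp
  }
qed

end

section \<open>Laws of cylinders under a uniform measure\<close>

locale uniform_garside = garside_germ +
  fixes p :: real and \<nu> :: "(nat \<Rightarrow> elt) measure"
  assumes unif: "unif_measure K n p \<nu>"
begin

abbreviation "h \<equiv> hfun K n p"

sublocale prob_space \<nu>
  using unif by (simp add: unif_measure_def)

lemma space_nu: "space \<nu> = Mbar K n"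
  using unif by (simp add: unif_measure_def)

lemma cylinder_sets: "{\<xi> \<in> Mbar K n. Q (map \<xi> [0..<k])} \<in> sets \<nu>"
  using unif openin_cylinder[of Q k] by (simp add: unif_measure_def Mbar_borel_def sigma_sets.Basic)

lemma pre_sets: "{\<xi> \<in> Mbar K n. Q (pre k \<xi>)} \<in> sets \<nu>"
  unfolding pre_def by (rule cylinder_sets)

lemma prefix_sets: "{\<xi> \<in> Mbar K n. \<forall>i<k. \<xi> i = x i} \<in> sets \<nu>"
proof -
  have "{\<xi> \<in> Mbar K n. \<forall>i<k. \<xi> i = x i} = {\<xi> \<in> Mbar K n. map \<xi> [0..<k] = map x [0..<k]}"
    by (auto simp: map_eq_conv)
  then show ?thesis using cylinder_sets[of "\<lambda>l. l = map x [0..<k]" k] by (simp only:)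
qed

lemma measure_prefix:
  assumes "set xs \<subseteq> Sm" "length xs = k"
  shows "measure \<nu> {\<xi> \<in> Mbar K n. prodl K n xs \<preceq> pre k \<xi>} = p ^ len (prodl K n xs)"
proof -
  have "prodl K n xs \<in> M" using assms Simples_Mon prodl_Mon by blast
  then have "measure \<nu> (Up K n (prodl K n xs)) = p ^ len (prodl K n xs)"
    using unif by (simp add: unif_measure_def)
  then show ?thesis using Up_eq[OF assms(1)] assms(2) by simp
qed

lemma measure_cylinder:
  assumes nx: "normal (map x [0..<Suc m])"
  shows "measure \<nu> {\<xi> \<in> Mbar K n. \<forall>i<Suc m. \<xi> i = x i} = p ^ len (pre m x) * h (x m)"
proof -
  have xS: "\<And>i. i \<le> m \<Longrightarrow> x i \<in> Sm" using nx unfolding normal_iff_arrows by simp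
  let ?z = "pre (Suc m) x" and ?A = "G - Rset K n (x m)"
  have pM: "pre m x \<in> M" "x m \<in> M" "?z \<in> M" using xS pre_Mon Simples_Mon
    by (metis less_imp_le_nat, blast, metis less_Suc_eq_le pre_Mon)
  have z: "?z = pre m x \<odot> x m" using pre_Suc[of m x] xS by blast
  let ?E = "{\<xi> \<in> Mbar K n. ?z \<preceq> pre (Suc m) \<xi>}"
  let ?B = "\<lambda>s. {\<xi> \<in> Mbar K n. ?z \<odot> ge s \<preceq> pre (Suc m) \<xi>}"
  have IE: "Incl_Excl (\<lambda>A. A \<in> sets \<nu>) (measure \<nu>)"
    by unfold_locales (auto intro!: finite_measure_Union simp: disjnt_def)
  have sub: "?B s \<subseteq> ?E" if "s \<in> ?A" for s
    using that ldiv_trans[OF pM(3) ldiv_mult[OF gelt_Mon]] by blast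
  have int: "?E \<inter> \<Inter>(?B ` X) = {\<xi> \<in> Mbar K n. ?z \<odot> DX X \<preceq> pre (Suc m) \<xi>}" if X: "X \<subseteq> ?A" for X
  proof -
    have XG: "X \<subseteq> G" using X by blast
    have "?z \<odot> DX X \<preceq> y \<longleftrightarrow> ?z \<preceq> y \<and> (\<forall>s\<in>X. ?z \<odot> ge s \<preceq> y)" if y: "y \<in> M" for y
    proof (cases "?z \<preceq> y")
      case True
      then obtain r where r: "r \<in> M" "y = ?z \<odot> r" by (auto simp: ldiv_def)
      then show ?thesis using True ldiv_DX[OF XG r(1)] ldiv_mult_cancel[OF pM(3)] XG
          Simples_Mon[OF DX_Simples[OF XG]] gelt_Mon by (meson subsetD)
    next
      case False
      then show ?thesis using ldiv_trans[OF pM(3) ldiv_mult] Simples_Mon[OF DX_Simples[OF XG]] by blast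
    qed
    moreover have "pre (Suc m) \<xi> \<in> M" if "\<xi> \<in> Mbar K n" for \<xi>
      using pre_Mon Mbar_Simples[OF that] by blast
    ultimately show ?thesis by auto
  qed
  have meas: "measure \<nu> {\<xi> \<in> Mbar K n. ?z \<odot> DX X \<preceq> pre (Suc m) \<xi>} = p ^ len (pre m x) * p ^ len (x m \<odot> DX X)"
    if X: "X \<subseteq> ?A" for X
  proof -
    have XG: "X \<subseteq> G" using X by blast
    have D: "DX X \<in> M" using Simples_Mon[OF DX_Simples[OF XG]] .
    have s: "x m \<odot> DX X \<in> Sm" using mult_DX_Simples[OF xS XG, of m] X by auto
    \<comment> \<open>\<open>DX X\<close> is absorbed into the last factor, so the product still has
      \<open>Suc m\<close> simple factors and \<open>measure_prefix\<close> applies.\<close>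
    let ?xs = "map x [0..<m] @ [x m \<odot> DX X]"
    have s1: "set (map x [0..<m]) \<subseteq> M" "set [x m \<odot> DX X] \<subseteq> M" using xS Simples_Mon s by auto
    have "prodl K n ?xs = ?z \<odot> DX X"
      using prodl_append[OF s1] z D pM mult_assoc[of "pre m x" K n "x m" "DX X"] by (simp add: pre_def)
    moreover have "set ?xs \<subseteq> Sm" using xS s by auto
    ultimately have "measure \<nu> {\<xi> \<in> Mbar K n. ?z \<odot> DX X \<preceq> pre (Suc m) \<xi>} = p ^ len (?z \<odot> DX X)"
      using measure_prefix[of ?xs "Suc m"] by simp
    also have "len (?z \<odot> DX X) = len (pre m x) + len (x m \<odot> DX X)" using z D pM by simp
    finally show ?thesis by (simp add: power_add)
  qed
  have "measure \<nu> (?E - \<Union>(?B ` ?A)) = (\<Sum>X\<in>Pow ?A. (-1) ^ card X * measure \<nu> (?E \<inter> \<Inter>(?B ` X)))"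
    by (rule incl_excl_diff[OF IE]) (use finite_Sigma_gens pre_sets sub in auto)
  also have "\<dots> = (\<Sum>X\<in>Pow ?A. p ^ len (pre m x) * ((-1) ^ card X * p ^ len (x m \<odot> DX X)))"
    by (rule sum.cong) (auto simp: int meas)
  also have "\<dots> = p ^ len (pre m x) * h (x m)"
    by (simp add: hfun_alt[OF xS] sum_distrib_left)
  finally show ?thesis using cylinder_complement[OF nx] by simp
qed

lemma measure_initial: "x \<in> Sm \<Longrightarrow> measure \<nu> {\<xi> \<in> Mbar K n. \<xi> 0 = x} = h x"
  using measure_cylinder[of "\<lambda>_. x" 0] by (simp add: normal_Cons pre_def)

lemma h_nonneg: "x \<in> Sm \<Longrightarrow> h x \<ge> 0"
  using measure_initial[of x] measure_nonneg[of \<nu> "{\<xi> \<in> Mbar K n. \<xi> 0 = x}"] by simp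

lemma measure_initial_sum:
  assumes "A \<in> sets \<nu>" "A \<subseteq> Mbar K n"
  shows "measure \<nu> A = (\<Sum>y\<in>Sm. measure \<nu> {\<xi> \<in> A. \<xi> k = y})"
proof -
  have eq: "{\<xi> \<in> A. \<xi> k = y} = A \<inter> {\<xi> \<in> Mbar K n. map \<xi> [0..<Suc k] ! k = y}" for y
    using assms by (auto simp del: upt_Suc)
  have s: "{\<xi> \<in> A. \<xi> k = y} \<in> sets \<nu>" for y
    unfolding eq using assms(1) cylinder_sets[of "\<lambda>l. l ! k = y" "Suc k"] by blast
  have "A = (\<Union>y\<in>Sm. {\<xi> \<in> A. \<xi> k = y})" using assms Mbar_Simples by auto
  also have "measure \<nu> \<dots> = (\<Sum>y\<in>Sm. measure \<nu> {\<xi> \<in> A. \<xi> k = y})"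
    by (rule finite_measure_finite_Union) (use s finite_Simples in \<open>auto simp: disjoint_family_on_def\<close>)
  finally show ?thesis .
qed

lemma h_sum: "(\<Sum>x\<in>Sm. h x) = 1"
proof -
  have "measure \<nu> (Mbar K n) = 1" using prob_space space_nu by simp
  then show ?thesis
    using measure_initial_sum[of "Mbar K n" 0] measure_initial sets.top[of \<nu>] space_nu by simp
qed

text \<open>The event that the first entry is \<open>x\<close> is split by the second entry. The
  identity is both the normalisation of the transition matrix and the source of positivity.\<close>

lemma h_step:
  assumes "x \<in> Sm"
  shows "h x = p ^ len x * (\<Sum>y\<in>Sm. if arrow K n x y then h y else 0)"
proof -
  have "measure \<nu> {\<xi> \<in> {\<xi> \<in> Mbar K n. \<xi> 0 = x}. \<xi> 1 = y} = p ^ len x * (if arrow K n x y then h y else 0)"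
    if y: "y \<in> Sm" for y
  proof -
    let ?x = "\<lambda>i::nat. if i = 0 then x else y"
    have eq: "{\<xi> \<in> {\<xi> \<in> Mbar K n. \<xi> 0 = x}. \<xi> 1 = y} = {\<xi> \<in> Mbar K n. \<forall>i<Suc 1. \<xi> i = ?x i}"
      by (auto simp: less_Suc_eq)
    show ?thesis
    proof (cases "arrow K n x y")
      case True
      then have "normal (map ?x [0..<Suc 1])" using assms y by (simp add: normal_Cons)
      from measure_cylinder[OF this] show ?thesis
        unfolding eq using True assms Simples_Mon by (simp add: pre_def)
    next
      case False
      then have "{\<xi> \<in> {\<xi> \<in> Mbar K n. \<xi> 0 = x}. \<xi> 1 = y} = {}" by (auto simp: Mbar_def)
      then show ?thesis using False by (simp del: Collect_empty_eq)
    qed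
  qed
  moreover have "{\<xi> \<in> Mbar K n. \<xi> 0 = x} \<in> sets \<nu>"
    using prefix_sets[of 1 "\<lambda>_. x"] by simp
  ultimately show ?thesis
    using measure_initial_sum[of "{\<xi> \<in> Mbar K n. \<xi> 0 = x}" 1] measure_initial[OF assms]
    by (auto simp: sum_distrib_left)
qed

lemma h_pos_backward:
  assumes "0 < p" "x \<in> Sm" "y \<in> Sm" "arrow K n x y" "h y > 0" shows "h x > 0"
proof -
  have "(\<Sum>y\<in>Sm. if arrow K n x y then h y else 0) \<ge> (if arrow K n x y then h y else 0)"
    by (rule member_le_sum) (use assms h_nonneg finite_Simples in auto)
  then show ?thesis unfolding h_step[OF assms(2)] using assms by (simp add: zero_less_mult_iff)
qed

text \<open>A nonempty cylinder whose last prescribed entry is the unit has \<open>h e\<close> as a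
  factor of its measure, and finitely many such cylinders cover the event.\<close>

lemma measure_unit_null:
  assumes "h e = 0" shows "measure \<nu> {\<xi> \<in> Mbar K n. \<xi> k = e} = 0"
proof -
  let ?L = "{xs. set xs \<subseteq> Sm \<and> length xs = Suc k \<and> xs ! k = e}"
  let ?C = "\<lambda>xs. {\<xi> \<in> Mbar K n. \<forall>i<Suc k. \<xi> i = xs ! i}"
  have fin: "finite ?L"
    by (rule finite_subset[OF _ finite_lists_length_eq[OF finite_Simples, of "Suc k"]]) auto
  have null: "measure \<nu> (?C xs) = 0" if "xs \<in> ?L" for xs
  proof (cases "normal xs")
    case True
    then have "normal (map ((!) xs) [0..<Suc k])" using that map_nth[of xs] by simp
    then show ?thesis using measure_cylinder[of "(!) xs" k] assms that by simp
  next
    case False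
    have "?C xs = {}"
    proof (rule ccontr)
      assume "?C xs \<noteq> {}"
      then obtain \<xi> where \<xi>: "\<xi> \<in> Mbar K n" "\<forall>i<Suc k. \<xi> i = xs ! i" by blast
      have "map \<xi> [0..<Suc k] = xs"
        using \<xi> that by (intro nth_equalityI) (auto simp del: upt_Suc)
      then show False using Mbar_normal[OF \<xi>(1), of "Suc k"] False by simp
    qed
    then show ?thesis by (simp del: Collect_empty_eq)
  qed
  have sub: "{\<xi> \<in> Mbar K n. \<xi> k = e} \<subseteq> (\<Union>xs\<in>?L. ?C xs)"
  proof
    fix \<xi> assume \<xi>: "\<xi> \<in> {\<xi> \<in> Mbar K n. \<xi> k = e}"
    then have "map \<xi> [0..<Suc k] \<in> ?L" using Mbar_Simples by (auto simp del: upt_Suc)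
    moreover have "\<xi> \<in> ?C (map \<xi> [0..<Suc k])" using \<xi> by (auto simp del: upt_Suc)
    ultimately show "\<xi> \<in> (\<Union>xs\<in>?L. ?C xs)" by blast
  qed
  have "measure \<nu> {\<xi> \<in> Mbar K n. \<xi> k = e} \<le> measure \<nu> (\<Union>xs\<in>?L. ?C xs)"
    by (rule finite_measure_mono[OF sub]) (intro sets.finite_UN fin prefix_sets)
  also have "\<dots> \<le> (\<Sum>xs\<in>?L. measure \<nu> (?C xs))"
    by (rule measure_UNION_le[OF fin]) (rule prefix_sets)
  also have "\<dots> = 0" using null by (intro sum.neutral) blast
  finally show ?thesis using measure_nonneg[of \<nu> "{\<xi> \<in> Mbar K n. \<xi> k = e}"] by linarith
qed

lemma markov_chain:
  assumes "0 < p" and unit: "h e > 0 \<longleftrightarrow> ereal p < qn K n"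
    and pos: "\<And>x. x \<in> Sm \<Longrightarrow> x \<noteq> e \<Longrightarrow> h x > 0"
  defines "V \<equiv> (if ereal p < qn K n then Sm else Sm - {e})"
  shows "measure \<nu> {xi \<in> space \<nu>. \<forall>k. xi k \<in> V} = 1"
    and "\<forall>k \<ge> 1. \<forall>x. (\<forall>i<k. x i \<in> V) \<longrightarrow>
        measure \<nu> {xi \<in> space \<nu>. \<forall>i<k. xi i = x i}
          = h (x 0) * (\<Prod>i<k - 1. trans_mat K n p (x i) (x (Suc i)))"
    and "\<forall>x \<in> V. (\<Sum>x' \<in> V. trans_mat K n p x x') = 1"
proof -
  have V: "V \<subseteq> Sm" "\<And>x. x \<in> V \<Longrightarrow> h x > 0" "\<And>x. x \<in> Sm \<Longrightarrow> x \<notin> V \<Longrightarrow> h x = 0 \<and> x = e \<and> \<not> ereal p < qn K n"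
    using unit pos h_nonneg[OF unit_Simples] by (auto simp: V_def split: if_splits)
  show "measure \<nu> {xi \<in> space \<nu>. \<forall>k. xi k \<in> V} = 1"
  proof (cases "ereal p < qn K n")
    case True
    then have "{xi \<in> space \<nu>. \<forall>k. xi k \<in> V} = space \<nu>" using Mbar_Simples by (auto simp: V_def space_nu)
    then show ?thesis using prob_space by simp
  next
    case False
    then have he: "h e = 0" using unit h_nonneg[OF unit_Simples] by auto
    have s: "{\<xi> \<in> Mbar K n. \<xi> k = e} \<in> sets \<nu>" for k
      using cylinder_sets[of "\<lambda>l. l ! k = e" "Suc k"] by (simp del: upt_Suc)
    have "{\<xi> \<in> Mbar K n. \<xi> k = e} \<in> null_sets \<nu>" for k
      using s measure_unit_null[OF he] by (auto simp: null_sets_def emeasure_eq_measure)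
    then have N: "(\<Union>k. {\<xi> \<in> Mbar K n. \<xi> k = e}) \<in> null_sets \<nu>" by (rule null_sets_UN)
    have "{xi \<in> space \<nu>. \<forall>k. xi k \<in> V} = space \<nu> - (\<Union>k. {\<xi> \<in> Mbar K n. \<xi> k = e})"
      using False Mbar_Simples by (auto simp: V_def space_nu)
    then show ?thesis
      using N prob_compl[of "\<Union>k. {\<xi> \<in> Mbar K n. \<xi> k = e}"] by (auto simp: null_sets_def emeasure_eq_measure)
  qed
  show "\<forall>x \<in> V. (\<Sum>x' \<in> V. trans_mat K n p x x') = 1"
  proof
    fix x assume x: "x \<in> V"
    have "(\<Sum>x' \<in> V. trans_mat K n p x x') = (\<Sum>x' \<in> Sm. trans_mat K n p x x')"
      by (rule sum.mono_neutral_left[OF finite_Simples V(1)]) (auto simp: trans_mat_def V(3))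
    also have "\<dots> = p ^ len x * (\<Sum>y\<in>Sm. if arrow K n x y then h y else 0) / h x"
      unfolding sum_distrib_left sum_divide_distrib by (rule sum.cong) (auto simp: trans_mat_def)
    also have "\<dots> = h x / h x" by (simp only: h_step[OF subsetD[OF V(1) x], symmetric])
    also have "\<dots> = 1" using V(2)[OF x] by simp
    finally show "(\<Sum>x' \<in> V. trans_mat K n p x x') = 1" .
  qed
  show "\<forall>k \<ge> 1. \<forall>x. (\<forall>i<k. x i \<in> V) \<longrightarrow>
        measure \<nu> {xi \<in> space \<nu>. \<forall>i<k. xi i = x i}
          = h (x 0) * (\<Prod>i<k - 1. trans_mat K n p (x i) (x (Suc i)))"
  proof (intro allI impI)
    fix k :: nat and x assume "1 \<le> k" and xV: "\<forall>i<k. x i \<in> V"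
    then obtain m where k: "k = Suc m" by (cases k) auto
    show "measure \<nu> {xi \<in> space \<nu>. \<forall>i<k. xi i = x i}
          = h (x 0) * (\<Prod>i<k - 1. trans_mat K n p (x i) (x (Suc i)))"
    proof (cases "normal (map x [0..<Suc m])")
      case True
      have arr: "arrow K n (x i) (x (Suc i))" if "i < m" for i
        using True that unfolding normal_iff_arrows by simp
      \<comment> \<open>The values of \<open>h\<close> telescope: a partial product keeps only the
        newest one, and the exponent of \<open>p\<close> collects the lengths passed.\<close>
      have "j \<le> m \<Longrightarrow> h (x 0) * (\<Prod>i<j. trans_mat K n p (x i) (x (Suc i))) = p ^ len (pre j x) * h (x j)" for j
      proof (induction j)
        case 0
        then show ?case by (simp add: pre_def)
      next
        case (Suc j)
        have xs: "\<And>i. i \<le> m \<Longrightarrow> x i \<in> Sm" using xV k V by auto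
        have m: "pre j x \<in> M" "x j \<in> M" using xs Suc.prems Simples_Mon by (auto intro!: pre_Mon)
        have hj: "h (x j) > 0" using V(2) xV k Suc.prems by simp
        have "pre (Suc j) x = pre j x \<odot> x j" using pre_Suc[of j x] xs Suc.prems by simp
        then have "p ^ len (pre (Suc j) x) = p ^ len (pre j x) * p ^ len (x j)"
          using m by (simp add: power_add)
        then show ?case using Suc arr[of j] hj by (simp add: trans_mat_def mult.assoc[symmetric])
      qed
      from this[of m] show ?thesis using measure_cylinder[OF True] k space_nu by simp
    next
      case False
      \<comment> \<open>A broken arrow makes the cylinder empty, and the same break puts a zero into
        the product.\<close>
      then obtain i where i: "Suc i < Suc m" "\<not> arrow K n (x i) (x (Suc i))"
        using xV k V(1) unfolding normal_iff_arrows by auto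
      have "{xi \<in> space \<nu>. \<forall>i<k. xi i = x i} = {}"
      proof (rule ccontr)
        assume "{xi \<in> space \<nu>. \<forall>i<k. xi i = x i} \<noteq> {}"
        then obtain \<xi> where "\<xi> \<in> Mbar K n" "\<xi> i = x i" "\<xi> (Suc i) = x (Suc i)"
          using i k by (auto simp: space_nu)
        then show False using i(2) by (auto simp: Mbar_def) metis
      qed
      moreover have "(\<Prod>i<k - 1. trans_mat K n p (x i) (x (Suc i))) = 0"
        using i k by (auto simp: trans_mat_def intro!: bexI[of _ i])
      ultimately show ?thesis by (simp del: Collect_empty_eq)
    qed
  qed
qed

end

section \<open>Growth series and positivity\<close>

lemma bounded_imp_conv_radius_ge:
  fixes a :: "nat \<Rightarrow> real"
  assumes "0 < t" "\<And>k. \<bar>a k\<bar> * t ^ k \<le> C"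
  shows "conv_radius a \<ge> ereal t"
proof (rule conv_radius_geI_ex')
  fix r :: real assume r: "0 < r" "ereal r < ereal t"
  have "summable (\<lambda>k. C * (r / t) ^ k)"
    using r assms(1) by (intro summable_mult summable_geometric) simp
  then show "summable (\<lambda>k. a k * of_real r ^ k)"
  proof (rule summable_comparison_test'[where N = 0])
    fix k :: nat
    have "norm (a k * of_real r ^ k) = (\<bar>a k\<bar> * t ^ k) * (r / t) ^ k"
      using r assms(1) by (simp add: abs_mult power_divide)
    also have "\<dots> \<le> C * (r / t) ^ k"
      using assms(2)[of k] r assms(1) by (intro mult_right_mono) auto
    finally show "norm (a k * of_real r ^ k) \<le> C * (r / t) ^ k" .
  qed
qed

text \<open>Fekete's argument.\<close>
lemma submultiplicative_ge_radius:
  fixes a :: "nat \<Rightarrow> real"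
  assumes pos: "\<And>k. 0 \<le> a k" and sub: "\<And>i j. a (i + j) \<le> a i * a j"
    and r: "0 < r" "conv_radius a = ereal r" and m: "0 < m"
  shows "1 \<le> a m * r ^ m"
proof (rule ccontr)
  assume "\<not> 1 \<le> a m * r ^ m"
  then have lt: "a m * r ^ m < 1" by simp
  \<comment> \<open>By continuity the strict inequality persists at some \<open>t\<close> beyond the
    radius \<open>r\<close>, and there the terms \<open>a k * t ^ k\<close> will turn out to be
    bounded.\<close>
  have "((\<lambda>t. a m * t ^ m) \<longlongrightarrow> a m * r ^ m) (at_right r)" by (intro tendsto_intros)
  then have "eventually (\<lambda>t. a m * t ^ m < 1) (at_right r)" using lt by (rule order_tendstoD)
  moreover have "eventually (\<lambda>t. r < t) (at_right r)" by (rule eventually_at_right_less)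
  ultimately have "eventually (\<lambda>t. r < t \<and> a m * t ^ m < 1) (at_right r)" by (rule eventually_conj[rotated])
  then obtain t where t: "r < t" "a m * t ^ m < 1"
    using eventually_happens trivial_limit_at_right_real by blast
  have t0: "0 < t" using t r by simp
  define C where "C = (\<Sum>j<m. a j * t ^ j)"
  \<comment> \<open>Each block of length \<open>m\<close> contributes a factor below 1, so a term is
    bounded by the one at the remainder modulo \<open>m\<close>.\<close>
  have mj: "a (j * m + i) * t ^ (j * m + i) \<le> a i * t ^ i" for i j
  proof (induction j)
    case (Suc j)
    have "a (Suc j * m + i) * t ^ (Suc j * m + i) \<le> (a m * a (j * m + i)) * t ^ (m + (j * m + i))"
      using sub[of m "j * m + i"] t0 by (simp add: add.assoc)
    also have "\<dots> = (a m * t ^ m) * (a (j * m + i) * t ^ (j * m + i))" by (simp add: power_add)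
    also have "\<dots> \<le> 1 * (a (j * m + i) * t ^ (j * m + i))"
      using t t0 pos by (intro mult_right_mono) auto
    finally show ?case using Suc by simp
  qed simp
  have "\<bar>a k\<bar> * t ^ k \<le> C" for k
  proof -
    have "a k * t ^ k \<le> a (k mod m) * t ^ (k mod m)" using mj[of "k div m" "k mod m"] by simp
    also have "\<dots> \<le> C" unfolding C_def using m pos t0 by (intro member_le_sum) auto
    finally show ?thesis using pos by simp
  qed
  then have "conv_radius a \<ge> ereal t" using bounded_imp_conv_radius_ge t0 by blast
  then show False using r t by simp
qed

lemma sum_Pow_alternating:
  fixes x :: real
  assumes "finite A" shows "(\<Sum>X\<in>Pow A. (-1) ^ card X * x ^ card X) = (1 - x) ^ card A"
  using prod_add[OF assms, of "\<lambda>_. - x" "\<lambda>_. 1"] by (simp add: power_minus[of x])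

context garside_germ
begin

definition cnt :: "nat \<Rightarrow> nat" where "cnt k = card {x \<in> M. len x = k}"

text \<open>The Moebius polynomial of the generators in \<open>Y\<close>. For \<open>Y = G\<close>
  it is the inverse of the growth series; for \<open>Y = G - Rset K n a\<close> its value at
  \<open>p\<close> is \<open>hfun K n p a\<close> without the factor
  \<open>p ^ len a\<close>.\<close>

definition moebius :: "gen set \<Rightarrow> real \<Rightarrow> real" where
  "moebius Y t = (\<Sum>X\<in>Pow Y. (-1) ^ card X * t ^ len (DX X))"

lemma qn_cnt: "qn K n = conv_radius (\<lambda>k. real (cnt k))"
  by (simp add: qn_def cnt_def)

lemma finite_len: "finite {x \<in> M. len x = k}"
proof -
  have "{x \<in> M. len x = k} \<subseteq> cls K n ` {w. set w \<subseteq> G \<and> length w = k}"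
    by (auto simp: Mon_def len_cls in_lists_conv_set)
  then show ?thesis
    by (rule finite_subset) (intro finite_imageI finite_lists_length_eq finite_Sigma_gens)
qed

lemma cnt_0: "cnt 0 = 1"
proof -
  have "{x \<in> M. len x = 0} = {e}" using len_0_iff by auto
  then show ?thesis by (simp add: cnt_def)
qed

text \<open>Cutting a word after \<open>i\<close> letters factors its element, so multiplication of
  pairs covers all elements of length \<open>i + j\<close>.\<close>

lemma cnt_submult: "cnt (i + j) \<le> cnt i * cnt j"
proof -
  let ?A = "\<lambda>k. {x \<in> M. len x = k}"
  have "?A (i + j) \<subseteq> (\<lambda>(x, y). x \<odot> y) ` (?A i \<times> ?A j)"
  proof
    fix x assume x: "x \<in> ?A (i + j)"
    then obtain w where w: "w \<in> lists G" "x = cls K n w" by (auto elim: MonE)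
    have l: "length w = i + j" using x w by (simp add: len_cls)
    have t: "take i w \<in> lists G" "drop i w \<in> lists G" using w
      by (metis append_in_lists_conv append_take_drop_id)+
    have "x = cls K n (take i w) \<odot> cls K n (drop i w)" using w by (simp add: mult_cls)
    moreover have "cls K n (take i w) \<in> ?A i" "cls K n (drop i w) \<in> ?A j"
      using t l by (auto simp: cls_Mon len_cls)
    ultimately show "x \<in> (\<lambda>(x, y). x \<odot> y) ` (?A i \<times> ?A j)" by force
  qed
  then have "card (?A (i + j)) \<le> card (?A i \<times> ?A j)"
    using finite_len by (meson card_image_le card_mono finite_SigmaI finite_imageI order_trans)
  then show ?thesis by (simp add: cnt_def card_cartesian_product)
qed

lemma card_multiples:
  assumes "d \<in> M"
  shows "card {x \<in> M. len x = k \<and> d \<preceq> x} = (if len d \<le> k then cnt (k - len d) else 0)"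
proof (cases "len d \<le> k")
  case True
  have "{x \<in> M. len x = k \<and> d \<preceq> x} = (\<lambda>z. d \<odot> z) ` {z \<in> M. len z = k - len d}"
    using True assms by (auto simp: ldiv_def)
  moreover have "inj_on (\<lambda>z. d \<odot> z) {z \<in> M. len z = k - len d}"
    using mult_left_cancel assms by (auto simp: inj_on_def)
  ultimately show ?thesis using True by (simp add: card_image cnt_def)
next
  case False
  then have "{x \<in> M. len x = k \<and> d \<preceq> x} = {}" using ldiv_len assms by fastforce
  then show ?thesis using False by (simp del: Collect_empty_eq)
qed

lemma card_free:
  assumes Y: "Y \<subseteq> G"
  shows "real (card {x \<in> M. len x = k \<and> (\<forall>s\<in>Y. \<not> ge s \<preceq> x)}) =
    (\<Sum>X\<in>Pow Y. (-1) ^ card X * real (if len (DX X) \<le> k then cnt (k - len (DX X)) else 0))"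
proof -
  let ?E = "{x \<in> M. len x = k}" and ?B = "\<lambda>s. {x \<in> M. len x = k \<and> ge s \<preceq> x}"
  have IE: "Incl_Excl finite (\<lambda>A. real (card A))"
    by unfold_locales (auto simp: card_Un_disjnt)
  have "finite Y" using Y finite_Sigma_gens finite_subset by blast
  have "real (card (?E - \<Union>(?B ` Y))) = (\<Sum>X\<in>Pow Y. (-1) ^ card X * real (card (?E \<inter> \<Inter>(?B ` X))))"
    by (rule incl_excl_diff[OF IE \<open>finite Y\<close> finite_len]) (auto intro: finite_subset[OF _ finite_len[of k]])
  also have "\<dots> = (\<Sum>X\<in>Pow Y. (-1) ^ card X * real (if len (DX X) \<le> k then cnt (k - len (DX X)) else 0))"
  proof (rule sum.cong[OF refl])
    fix X assume "X \<in> Pow Y"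
    then have XG: "X \<subseteq> G" using Y by auto
    have "?E \<inter> \<Inter>(?B ` X) = {x \<in> M. len x = k \<and> DX X \<preceq> x}"
      using ldiv_DX[OF XG] by auto
    then show "(-1) ^ card X * real (card (?E \<inter> \<Inter>(?B ` X))) =
       (-1) ^ card X * real (if len (DX X) \<le> k then cnt (k - len (DX X)) else 0)"
      using card_multiples[OF Simples_Mon[OF DX_Simples[OF XG]], of k] by simp
  qed
  moreover have "?E - \<Union>(?B ` Y) = {x \<in> M. len x = k \<and> (\<forall>s\<in>Y. \<not> ge s \<preceq> x)}" by auto
  ultimately show ?thesis by simp
qed

text \<open>By left cancellation the multiples of \<open>DX X\<close> are a copy of the monoid
  shifted by \<open>len (DX X)\<close> in length. Inclusion-exclusion over \<open>X\<close> then
  produces the polynomial as a factor.\<close>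

lemma sums_free:
  assumes Y: "Y \<subseteq> G" and t: "0 \<le> t" "ereal t < qn K n"
  shows "(\<lambda>k. real (card {x \<in> M. len x = k \<and> (\<forall>s\<in>Y. \<not> ge s \<preceq> x)}) * t ^ k) sums
    (moebius Y t * (\<Sum>k. real (cnt k) * t ^ k))"
proof -
  let ?g = "\<Sum>k. real (cnt k) * t ^ k"
  have sm: "summable (\<lambda>k. real (cnt k) * t ^ k)"
    using summable_in_conv_radius[of t "\<lambda>k. real (cnt k)"] t by (simp add: qn_cnt)
  have shift: "(\<lambda>k. real (if d \<le> k then cnt (k - d) else 0) * t ^ k) sums (t ^ d * ?g)" for d
  proof -
    have "(\<lambda>k. t ^ d * (real (cnt k) * t ^ k)) sums (t ^ d * ?g)"
      using sm by (intro sums_mult summable_sums)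
    then have "(\<lambda>k. real (if d \<le> k + d then cnt (k + d - d) else 0) * t ^ (k + d)) sums (t ^ d * ?g)"
      by (simp add: power_add ac_simps)
    then show ?thesis
      by (subst (asm) sums_iff_shift) simp
  qed
  have "(\<lambda>k. \<Sum>X\<in>Pow Y. (-1) ^ card X * (real (if len (DX X) \<le> k then cnt (k - len (DX X)) else 0) * t ^ k))
     sums (\<Sum>X\<in>Pow Y. (-1) ^ card X * (t ^ len (DX X) * ?g))"
    by (intro sums_sum sums_mult shift)
  then show ?thesis
    unfolding card_free[OF Y] moebius_def sum_distrib_right by (simp add: mult.assoc)
qed

lemma genfun_ge_1:
  assumes "0 \<le> t" "ereal t < qn K n" shows "1 \<le> (\<Sum>k. real (cnt k) * t ^ k)"
proof -
  have sm: "summable (\<lambda>k. real (cnt k) * t ^ k)"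
    using summable_in_conv_radius[of t "\<lambda>k. real (cnt k)"] assms by (simp add: qn_cnt)
  show ?thesis using sum_le_suminf[OF sm, of "{0}"] assms by (simp add: cnt_0)
qed

lemma not_gelt_ldiv_unit: "s \<in> G \<Longrightarrow> \<not> ge s \<preceq> e"
  using ldiv_len[of "ge s" K n e] by auto

text \<open>The unit is divisible by no generator, so the series of \<open>sums_free\<close> is at
  least 1, and the growth series is positive too.\<close>

lemma moebius_pos:
  assumes Y: "Y \<subseteq> G" and t: "0 \<le> t" "ereal t < qn K n"
  shows "moebius Y t > 0"
proof -
  let ?f = "\<lambda>k. real (card {x \<in> M. len x = k \<and> (\<forall>s\<in>Y. \<not> ge s \<preceq> x)}) * t ^ k"
  have "{x \<in> M. len x = 0 \<and> (\<forall>s\<in>Y. \<not> ge s \<preceq> x)} = {e}"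
    using len_0_iff Y not_gelt_ldiv_unit by auto
  then have "?f 0 = 1" by simp
  moreover have "sum ?f {0} \<le> suminf ?f"
    using sums_free[OF Y t] t by (intro sum_le_suminf) (auto simp: sums_iff)
  ultimately have "0 < moebius Y t * (\<Sum>k. real (cnt k) * t ^ k)"
    using sums_free[OF Y t] by (simp add: sums_iff)
  then show ?thesis using genfun_ge_1[OF t] by (simp add: zero_less_mult_iff)
qed

lemma moebius_genfun:
  assumes t: "0 \<le> t" "ereal t < qn K n"
  shows "moebius G t * (\<Sum>k. real (cnt k) * t ^ k) = 1"
proof -
  let ?F = "\<lambda>k. {x \<in> M. len x = k \<and> (\<forall>s\<in>G. \<not> ge s \<preceq> x)}"
  have "?F 0 = {e}" using len_0_iff not_gelt_ldiv_unit by auto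
  moreover have "?F k = {}" if "k > 0" for k
  proof -
    have "\<exists>s\<in>G. ge s \<preceq> x" if "x \<in> M" "len x = k" for x
      using Mon_has_gen[OF that(1)] that(2) \<open>k > 0\<close> by (metis len_unit less_irrefl)
    then show ?thesis by blast
  qed
  ultimately have "(\<lambda>k. real (card (?F k)) * t ^ k) = (\<lambda>k. if k = 0 then 1 else 0)"
    by (auto simp: fun_eq_iff simp del: Collect_empty_eq)
  moreover have "(\<lambda>k::nat. if k = 0 then 1 else 0 :: real) sums 1"
    using sums_single[of 0 "\<lambda>_. 1::real"] by simp
  ultimately show ?thesis using sums_free[OF order_refl t] sums_unique2 by metis
qed

text \<open>Submultiplicativity gives \<open>cnt k * r ^ k\<close> at least 1, so below the radius
  the growth series dominates the geometric series in \<open>t / r\<close>. Its inverse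
  \<open>moebius G t\<close> is then at most \<open>1 - t / r\<close>, which tends to 0.\<close>

lemma moebius_at_radius:
  assumes "0 < r" "qn K n = ereal r" shows "moebius G r \<le> 0"
proof -
  have le: "moebius G t \<le> 1 - t / r" if t: "0 \<le> t" "t < r" for t
  proof -
    let ?g = "\<Sum>k. real (cnt k) * t ^ k"
    have tq: "ereal t < qn K n" using t assms by simp
    have sm: "summable (\<lambda>k. real (cnt k) * t ^ k)"
      using summable_in_conv_radius[of t "\<lambda>k. real (cnt k)"] t tq by (simp add: qn_cnt)
    have ge: "(t / r) ^ k \<le> real (cnt k) * t ^ k" for k
    proof (cases "k = 0")
      case False
      have "1 \<le> real (cnt k) * r ^ k"
      proof (rule submultiplicative_ge_radius)
        show "real (cnt (i + j)) \<le> real (cnt i) * real (cnt j)" for i j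
          using cnt_submult[of i j] by (metis of_nat_le_iff of_nat_mult)
      qed (use assms False in \<open>auto simp: qn_cnt\<close>)
      then have "t ^ k * 1 \<le> t ^ k * (real (cnt k) * r ^ k)" using t by (intro mult_left_mono) auto
      then show ?thesis using assms by (simp add: power_divide field_simps)
    qed (simp add: cnt_0)
    have "(\<Sum>k. (t / r) ^ k) \<le> ?g"
      using ge sm t assms by (intro suminf_le summable_geometric) auto
    then have g: "1 / (1 - t / r) \<le> ?g" using t assms by (simp add: suminf_geometric)
    have "moebius G t * (1 / (1 - t / r)) \<le> moebius G t * ?g"
      using moebius_pos[OF order_refl t(1) tq] g by (intro mult_left_mono) auto
    then show ?thesis using moebius_genfun[OF t(1) tq] t assms by (simp add: field_simps)
  qed
  have "(moebius G \<longlongrightarrow> moebius G r) (at_left r)"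
    unfolding moebius_def by (intro tendsto_intros)
  moreover have "((\<lambda>t. 1 - t / r) \<longlongrightarrow> 1 - r / r) (at_left r)" using assms by (intro tendsto_intros) auto
  moreover have "eventually (\<lambda>t. moebius G t \<le> 1 - t / r) (at_left r)"
    using le assms(1) eventually_at_left_real[of 0 r] by (auto elim!: eventually_mono)
  ultimately have "moebius G r \<le> 1 - r / r"
    by (intro tendsto_le[OF trivial_limit_at_left_real]) auto
  then show ?thesis using assms by simp
qed

lemma hfun_moebius:
  assumes "a \<in> Sm" shows "hfun K n p a = p ^ len a * moebius (G - Rset K n a) p"
proof -
  have "len (a \<odot> DX X) = len a + len (DX X)" if "X \<in> Pow (G - Rset K n a)" for X
    using len_mult[OF Simples_Mon[OF assms] Simples_Mon[OF DX_Simples[of X]]] that by blast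
  then show ?thesis
    unfolding hfun_alt[OF assms] moebius_def sum_distrib_left
    by (intro sum.cong) (auto simp: power_add)
qed

lemma Rset_unit: "Rset K n e = {}"
  unfolding Rset_def using gelt_Simples by auto

lemma hfun_unit: "hfun K n p e = moebius G p"
  using hfun_moebius[OF unit_Simples] Rset_unit by simp

lemma qn_le_of_moebius_neg:
  assumes "Y \<subseteq> G" "0 \<le> t" "moebius Y t < 0" shows "qn K n \<le> ereal t"
  using moebius_pos[OF assms(1,2)] assms(3) by (meson not_le order_less_asym)

text \<open>Otherwise \<open>x\<close> times \<open>Delta\<close> would be simple, hence a divisor
  of \<open>Delta\<close>, and comparing lengths leaves only the unit.\<close>

lemma Rset_nonempty:
  assumes "x \<in> Sm" "x \<noteq> e" obtains s where "s \<in> Rset K n x"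
proof (rule ccontr)
  assume "\<not> thesis"
  then have "Rset K n x = {}" using that by blast
  then have "x \<odot> DX G \<in> Sm" using mult_DX_Simples[OF assms(1), of G] by simp
  then have "x \<odot> DX G \<preceq> DX G" by (simp add: Simples_def Delta_def)
  moreover have "x \<in> M" "DX G \<in> M" using assms Simples_Mon DX_Simples by auto
  ultimately have "len x = 0" using ldiv_len[of "x \<odot> DX G" K n "DX G"] by simp
  then show False using len_0_iff \<open>x \<in> M\<close> assms by blast
qed

lemma Lset_el: "z \<in> Z \<Longrightarrow> Lset K n (el z) = {s \<in> G. atm s \<in> z}"
  unfolding Lset_def using ldiv_gelt_el by blast

lemma Lset_gelt: "s \<in> G \<Longrightarrow> Lset K n (ge s) = {s}"
  using Lset_el[OF atom_Z] inj_at by (auto simp: el_atom inj_on_def)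

lemma word_of_atoms:
  assumes "\<And>X. X \<subseteq> Y \<Longrightarrow> atm ` X \<in> Z" "Y \<subseteq> G"
    "\<And>X s. \<lbrakk>X \<subseteq> Y; s \<in> X\<rbrakk> \<Longrightarrow> q s (atm ` X) = atm ` (X - {s})"
  shows "distinct xs \<Longrightarrow> set xs \<subseteq> Y \<Longrightarrow> word_of (atm ` set xs) xs"
proof (induction xs)
  case (Cons s xs)
  then have "q s (atm ` set (s # xs)) = atm ` set xs" using assms(3)[of "set (s # xs)" s] by simp
  then show ?case using Cons assms(2) by (auto simp: lang_Cons)
qed (simp add: lang_Nil)

definition arrows :: "(elt \<times> elt) set" where
  "arrows = {(x, y). x \<in> Sm \<and> y \<in> Sm \<and> arrow K n x y}"

text \<open>
  The alternative \<open>moebius Y (3/4) < 0\<close> serves to bound the radius away from 1; it is not available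
  for \<open>n = 2\<close>, where the radius is 1.
\<close>
definition ergodic :: bool where
  "ergodic \<longleftrightarrow> (\<forall>s\<in>G. \<exists>y\<in>Sm. (ge s, y) \<in> arrows\<^sup>* \<and>
     (\<forall>X \<subseteq> G - Rset K n y. len (DX X) = card X) \<and>
     (G - Rset K n y = {} \<or> (\<exists>Y \<subseteq> G. moebius Y (3/4) < 0)))"

end

section \<open>Positivity of the initial distribution\<close>

context uniform_garside
begin

lemma h_unit_pos_iff:
  assumes "0 < p" "ereal p \<le> qn K n" shows "h e > 0 \<longleftrightarrow> ereal p < qn K n"
proof (cases "ereal p < qn K n")
  case True
  then show ?thesis using moebius_pos[of G p] assms hfun_unit by simp
next
  case False
  then have "qn K n = ereal p" using assms by simp
  then show ?thesis using moebius_at_radius[of p] assms hfun_unit False by simp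
qed

text \<open>At the radius \<open>x\<close> has an arrow to every generator in its right set, because
  the only generator dividing a generator is itself. From there \<open>ergodic\<close> leads to an
  element whose Moebius factor is a power of \<open>1 - p\<close>.\<close>

lemma h_pos:
  assumes "0 < p" "ereal p \<le> qn K n" "ergodic" "x \<in> Sm" "x \<noteq> e"
  shows "h x > 0"
proof (cases "ereal p < qn K n")
  case True
  then have "h e > 0" using h_unit_pos_iff assms by blast
  then show ?thesis using h_pos_backward assms unit_Simples arrow_unit by blast
next
  case False
  obtain s where s: "s \<in> Rset K n x" using Rset_nonempty assms by blast
  then have sG: "s \<in> G" by (simp add: Rset_def)
  obtain y where y: "y \<in> Sm" "(ge s, y) \<in> arrows\<^sup>*" "\<And>X. X \<subseteq> G - Rset K n y \<Longrightarrow> len (DX X) = card X"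
    "G - Rset K n y = {} \<or> (\<exists>Y \<subseteq> G. moebius Y (3/4) < 0)"
    using assms(3) sG unfolding ergodic_def by blast
  let ?Y = "G - Rset K n y"
  have "moebius ?Y p = (\<Sum>X\<in>Pow ?Y. (-1) ^ card X * p ^ card X)"
    unfolding moebius_def using y(3) by (intro sum.cong) auto
  also have "\<dots> = (1 - p) ^ card ?Y" using finite_Sigma_gens by (intro sum_Pow_alternating) auto
  finally have m: "moebius ?Y p = (1 - p) ^ card ?Y" .
  have "moebius ?Y p > 0"
    using y(4)
  proof
    assume "\<exists>Y \<subseteq> G. moebius Y (3/4) < 0"
    then have "qn K n \<le> ereal (3/4)" using qn_le_of_moebius_neg by force
    then have "ereal p \<le> ereal (3/4)" using assms(2) order_trans by blast
    then show ?thesis unfolding m by simp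
  next
    assume Y: "?Y = {}"
    show ?thesis unfolding m unfolding Y by simp
  qed
  then have hy: "h y > 0" using hfun_moebius[OF y(1)] assms(1) by simp
  have "h (ge s) > 0"
    using y(2)
  proof (induction rule: converse_rtrancl_induct)
    case (step a b)
    then show ?case using h_pos_backward[OF assms(1)] by (auto simp: arrows_def)
  qed (rule hy)
  moreover have "arrow K n x (ge s)" using s Lset_gelt[OF sG] by (simp add: arrow_def)
  ultimately show ?thesis using h_pos_backward assms gelt_Simples sG by blast
qed

lemma uniform_markov_chain:
  assumes "0 < p" "ereal p \<le> qn K n" "ergodic"
  defines "V \<equiv> (if ereal p < qn K n then Sm else Sm - {e})"
  shows "measure \<nu> {xi \<in> space \<nu>. \<forall>k. xi k \<in> V} = 1
   \<and> (\<forall>k \<ge> 1. \<forall>x. (\<forall>i<k. x i \<in> V) \<longrightarrow>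
        measure \<nu> {xi \<in> space \<nu>. \<forall>i<k. xi i = x i}
          = h (x 0) * (\<Prod>i<k - 1. trans_mat K n p (x i) (x (Suc i))))
   \<and> (\<forall>x \<in> V. (\<Sum>x' \<in> V. trans_mat K n p x x') = 1)
   \<and> (\<forall>x \<in> Sm. measure \<nu> {xi \<in> space \<nu>. xi 0 = x} = h x)
   \<and> (\<forall>x \<in> Sm. h x \<ge> 0)
   \<and> (\<Sum>x \<in> Sm. h x) = 1
   \<and> (\<forall>x \<in> Sm - {e}. h x > 0)
   \<and> (h e > 0 \<longleftrightarrow> ereal p < qn K n)"
  using markov_chain[OF assms(1) h_unit_pos_iff[OF assms(1,2)] h_pos[OF assms(1-3)], folded V_def]
    measure_initial h_nonneg h_sum h_pos[OF assms(1-3)] h_unit_pos_iff[OF assms(1,2)] space_nu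
  by (intro conjI) (auto simp: space_nu)

end

section \<open>Pairs as atoms and tools for exhibiting arrows\<close>

definition pairs :: "nat \<Rightarrow> (nat \<times> nat) set" where
  "pairs n = {(a, b). 1 \<le> a \<and> a < b \<and> b \<le> n}"

text \<open>One atom map for both monoids: a generator goes to the pair of positions exchanged by
  its transposition.\<close>

primrec gpair :: "gen \<Rightarrow> nat \<times> nat" where
  "gpair (S k) = (k, Suc k)"
| "gpair (D i j) = (i, j)"

lemma finite_pairs: "finite (pairs n)"
  by (rule finite_subset[of _ "{..n} \<times> {..n}"]) (auto simp: pairs_def)

context garside_germ
begin

lemma arrow_elI:
  "y \<in> Z \<Longrightarrow> (\<And>s. \<lbrakk>s \<in> G; atm s \<in> y\<rbrakk> \<Longrightarrow> s \<in> Rset K n x) \<Longrightarrow> arrow K n x (el y)"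
  by (auto simp: arrow_def Lset_el)

lemma Rset_last: "x \<in> M \<Longrightarrow> s \<in> G \<Longrightarrow> s \<in> Rset K n (x \<odot> ge s)"
  unfolding Rset_def using gelt_square_not_simple by blast

lemma Rset_gelt: "s \<in> G \<Longrightarrow> s \<in> Rset K n (ge s)"
  using Rset_last[of e s] by simp

text \<open>No simple element ends with the same generator twice in a row, so a last letter of any
  spelling cannot be appended again.\<close>

lemma Rset_word_last:
  assumes "z \<in> Z" "word_of z (u @ [s])" shows "s \<in> Rset K n (el z)"
proof -
  have l: "u @ [s] \<in> lists G" using assms(2) lang_lists by blast
  have "el z = cls K n u \<odot> ge s" using el_word_of[OF assms] by (simp add: gelt_def mult_cls)
  then show ?thesis using Rset_last[of "cls K n u" s] l by (simp add: cls_Mon)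
qed

lemma el_Simples: "z \<in> Z \<Longrightarrow> el z \<in> Sm"
  using Simples_el by blast

lemma arrowsI: "\<lbrakk>x \<in> Sm; y \<in> Sm; arrow K n x y\<rbrakk> \<Longrightarrow> (x, y) \<in> arrows\<^sup>*"
  by (rule r_into_rtrancl) (simp add: arrows_def)

lemma len_DX_word:
  assumes "X \<subseteq> G" "j \<in> Z" "atm ` X \<subseteq> j" "\<And>z. \<lbrakk>z \<in> Z; atm ` X \<subseteq> z\<rbrakk> \<Longrightarrow> j \<subseteq> z" "word_of j w"
  shows "len (DX X) = length w"
  using atom_join_eqI[OF assms(1-4)] DeltaX_atom_join[OF assms(1)] el_word_of[OF assms(2,5)] len_cls by metis

lemma len_DX_empty: "len (DX {}) = 0"
  using len_DX_word[of "{}" "{}" "[]"] bot_Z by (simp add: lang_Nil)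

lemma len_DX_single: "s \<in> G \<Longrightarrow> len (DX {s}) = 1"
  using len_DX_word[of "{s}" "{atm s}" "[s]"] atom_Z word_of_atom by simp

end

section \<open>The classical braid monoid\<close>

text \<open>Inversion sets of permutations: the pair sets that are transitive and cotransitive.\<close>
definition inv_sets :: "nat \<Rightarrow> (nat \<times> nat) set set" where
  "inv_sets n = {z. z \<subseteq> pairs n \<and> (\<forall>a b c. (a, b) \<in> z \<longrightarrow> (b, c) \<in> z \<longrightarrow> (a, c) \<in> z) \<and>
     (\<forall>a b c. (a, c) \<in> z \<longrightarrow> a < b \<longrightarrow> b < c \<longrightarrow> (a, b) \<in> z \<or> (b, c) \<in> z)}"

definition swp :: "nat \<Rightarrow> nat \<Rightarrow> nat" where
  "swp k x = (if x = k then Suc k else if x = Suc k then k else x)"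

text \<open>The inversions left when a first letter \<open>S k\<close> is removed: the transposition
  turns \<open>(k, Suc k)\<close> into a decreasing pair, which \<open>a < b\<close> discards. The
  clause for \<open>D\<close> is a dummy.\<close>

primrec inv_quo :: "gen \<Rightarrow> (nat \<times> nat) set \<Rightarrow> (nat \<times> nat) set" where
  "inv_quo (S k) z = {(a, b). a < b \<and> (swp k a, swp k b) \<in> z}"
| "inv_quo (D i j) z = {}"

lemma swp_swp [simp]: "swp k (swp k x) = x"
  by (auto simp: swp_def)

lemma swp_inj [simp]: "swp k x = swp k y \<longleftrightarrow> x = y"
  by (metis swp_swp)

lemma swp_less: "a < b \<Longrightarrow> (a, b) \<noteq> (k, Suc k) \<Longrightarrow> swp k a < swp k b"
  by (auto simp: swp_def)

lemma swp_bounds: "1 \<le> k \<Longrightarrow> k < n \<Longrightarrow> 1 \<le> swp k a \<longleftrightarrow> 1 \<le> a" "1 \<le> k \<Longrightarrow> k < n \<Longrightarrow> swp k a \<le> n \<longleftrightarrow> a \<le> n"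
  by (auto simp: swp_def)

lemma inv_setsD:
  assumes "z \<in> inv_sets n"
  shows "(a, b) \<in> z \<Longrightarrow> 1 \<le> a" "(a, b) \<in> z \<Longrightarrow> a < b" "(a, b) \<in> z \<Longrightarrow> b \<le> n"
    "\<lbrakk>(a, b) \<in> z; (b, c) \<in> z\<rbrakk> \<Longrightarrow> (a, c) \<in> z"
    "\<lbrakk>(a, c) \<in> z; a < b; b < c\<rbrakk> \<Longrightarrow> (a, b) \<in> z \<or> (b, c) \<in> z"
  using assms unfolding inv_sets_def pairs_def by blast+

lemma inv_setsI:
  assumes "\<And>a b. (a, b) \<in> z \<Longrightarrow> 1 \<le> a \<and> a < b \<and> b \<le> n"
    "\<And>a b c. \<lbrakk>(a, b) \<in> z; (b, c) \<in> z\<rbrakk> \<Longrightarrow> (a, c) \<in> z"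
    "\<And>a b c. \<lbrakk>(a, c) \<in> z; a < b; b < c\<rbrakk> \<Longrightarrow> (a, b) \<in> z \<or> (b, c) \<in> z"
  shows "z \<in> inv_sets n"
  using assms unfolding inv_sets_def pairs_def by blast

lemma inv_quo_inv_sets:
  assumes z: "z \<in> inv_sets n" "(k, Suc k) \<in> z"
  shows "inv_quo (S k) z \<in> inv_sets n"
proof (rule inv_setsI)
  note zD = inv_setsD[OF z(1)]
  have k: "1 \<le> k" "k < n" using zD z(2) by fastforce+
  fix a b c
  show "(a, b) \<in> inv_quo (S k) z \<Longrightarrow> 1 \<le> a \<and> a < b \<and> b \<le> n"
    using zD(1,3)[of "swp k a" "swp k b"] swp_bounds[OF k] by auto
  show "\<lbrakk>(a, b) \<in> inv_quo (S k) z; (b, c) \<in> inv_quo (S k) z\<rbrakk> \<Longrightarrow> (a, c) \<in> inv_quo (S k) z"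
    using zD(4) by auto
  assume ac: "(a, c) \<in> inv_quo (S k) z" and b: "a < b" "b < c"
  then have ac': "(swp k a, swp k c) \<in> z" by simp
  consider "(a, b) = (k, Suc k)" | "(b, c) = (k, Suc k)" | "swp k a < swp k b" "swp k b < swp k c"
    using swp_less b by metis
  then show "(a, b) \<in> inv_quo (S k) z \<or> (b, c) \<in> inv_quo (S k) z"
  proof cases
    case 1
    then have "(swp k b, swp k a) \<in> z" using z(2) by (simp add: swp_def)
    then show ?thesis using zD(4) ac' b by auto
  next
    case 2
    then have "(swp k c, swp k b) \<in> z" using z(2) by (simp add: swp_def)
    then show ?thesis using zD(4) ac' b by auto
  next
    case 3
    then show ?thesis using zD(5)[OF ac'] b by auto
  qed
qed

definition prepend :: "nat \<Rightarrow> (nat \<times> nat) set \<Rightarrow> (nat \<times> nat) set" where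
  "prepend k z = insert (k, Suc k) (map_prod (swp k) (swp k) ` z)"

lemma in_prepend: "(a, b) \<in> prepend k z \<longleftrightarrow> (a, b) = (k, Suc k) \<or> (swp k a, swp k b) \<in> z"
proof -
  have "(a, b) \<in> map_prod (swp k) (swp k) ` z \<longleftrightarrow> (swp k a, swp k b) \<in> z" by force
  then show ?thesis by (simp add: prepend_def)
qed

lemma prepend_inv_sets:
  assumes z: "z \<in> inv_sets n" "(k, Suc k) \<notin> z" and k: "1 \<le> k" "k < n"
  shows "prepend k z \<in> inv_sets n" and "inv_quo (S k) (prepend k z) = z"
proof -
  note zD = inv_setsD[OF z(1)]
  have lt: "a < b" if "(swp k a, swp k b) \<in> z" for a b
  proof -
    have "(swp k a, swp k b) \<noteq> (k, Suc k)" using that z(2) by metis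
    from swp_less[OF zD(2)[OF that] this] show ?thesis by simp
  qed
  show "prepend k z \<in> inv_sets n"
  proof (rule inv_setsI)
    fix a b c
    show "(a, b) \<in> prepend k z \<Longrightarrow> 1 \<le> a \<and> a < b \<and> b \<le> n"
      using zD(1,3)[of "swp k a" "swp k b"] swp_bounds[OF k] lt[of a b] k by (auto simp: in_prepend)
    { assume ab: "(a, b) \<in> prepend k z" and bc: "(b, c) \<in> prepend k z"
      consider "(a, b) = (k, Suc k)" "(swp k b, swp k c) \<in> z" | "(b, c) = (k, Suc k)" "(swp k a, swp k b) \<in> z"
        | "(swp k a, swp k b) \<in> z" "(swp k b, swp k c) \<in> z"
        using ab bc by (auto simp: in_prepend)
      then show "(a, c) \<in> prepend k z"
      proof cases
        case 1
        then have 2: "(k, swp k c) \<in> z" by (simp add: swp_def)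
        then have "k < swp k c" "swp k c \<noteq> Suc k" using zD(2) z(2) by auto
        then have "(Suc k, swp k c) \<in> z" using zD(5)[OF 2, of "Suc k"] z(2) by auto
        then show ?thesis using 1 by (simp add: in_prepend swp_def)
      next
        case 2
        then have 3: "(swp k a, Suc k) \<in> z" by (simp add: swp_def)
        then have "swp k a < Suc k" "swp k a \<noteq> k" using zD(2) z(2) by auto
        then have "(swp k a, k) \<in> z" using zD(5)[OF 3, of k] z(2) by auto
        then show ?thesis using 2 by (simp add: in_prepend swp_def)
      next
        case 3
        then show ?thesis using zD(4) by (auto simp: in_prepend)
      qed }
    { assume ac: "(a, c) \<in> prepend k z" and b: "a < b" "b < c"
      then have ac': "(swp k a, swp k c) \<in> z" by (auto simp: in_prepend)
      consider "(a, b) = (k, Suc k)" | "(b, c) = (k, Suc k)" | "swp k a < swp k b" "swp k b < swp k c"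
        using swp_less b by metis
      then show "(a, b) \<in> prepend k z \<or> (b, c) \<in> prepend k z"
        using zD(5)[OF ac'] by cases (auto simp: in_prepend) }
  qed
  show "inv_quo (S k) (prepend k z) = z"
  proof (intro set_eqI, safe)
    fix a b assume "(a, b) \<in> inv_quo (S k) (prepend k z)"
    then have "a < b" "(swp k a, swp k b) \<in> prepend k z" by auto
    then show "(a, b) \<in> z" by (auto simp: in_prepend swp_def split: if_splits)
  next
    fix a b assume "(a, b) \<in> z"
    then show "(a, b) \<in> inv_quo (S k) (prepend k z)" using zD(2) by (auto simp: in_prepend)
  qed
qed

lemma prepend_inv_quo:
  assumes "z \<in> inv_sets n" "(k, Suc k) \<in> z" shows "prepend k (inv_quo (S k) z) = z"
proof (intro set_eqI, safe)
  fix a b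
  have *: "a < b \<Longrightarrow> (a, b) \<noteq> (k, Suc k) \<Longrightarrow> swp k a < swp k b" by (rule swp_less)
  show "(a, b) \<in> prepend k (inv_quo (S k) z) \<Longrightarrow> (a, b) \<in> z" using assms by (auto simp: in_prepend)
  show "(a, b) \<in> z \<Longrightarrow> (a, b) \<in> prepend k (inv_quo (S k) z)"
    using * inv_setsD(2)[OF assms(1)] by (auto simp: in_prepend)
qed

lemma prepend_mono: "y \<subseteq> z \<Longrightarrow> prepend k y \<subseteq> prepend k z"
  by (auto simp: prepend_def)

lemma inv_quo_mono: "y \<subseteq> z \<Longrightarrow> inv_quo (S k) y \<subseteq> inv_quo (S k) z"
  by auto

text \<open>Joins in the weak order are transitive closures of unions. Cotransitivity survives: on a
  chain from \<open>a\<close> to \<open>c\<close>, either \<open>b\<close> is a vertex or some edge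
  jumps over it, and cotransitivity of that edge connects \<open>b\<close> with one of its
  ends.\<close>

lemma trancl_in_inv_sets:
  assumes y: "y \<in> inv_sets n" and z: "z \<in> inv_sets n"
  shows "(y \<union> z)\<^sup>+ \<in> inv_sets n"
proof (rule inv_setsI)
  fix a b c
  show "(a, b) \<in> (y \<union> z)\<^sup>+ \<Longrightarrow> 1 \<le> a \<and> a < b \<and> b \<le> n"
    by (induction rule: trancl_induct) (use inv_setsD(1-3)[OF y] inv_setsD(1-3)[OF z] in fastforce)+
  show "\<lbrakk>(a, b) \<in> (y \<union> z)\<^sup>+; (b, c) \<in> (y \<union> z)\<^sup>+\<rbrakk> \<Longrightarrow> (a, c) \<in> (y \<union> z)\<^sup>+"
    by (rule trancl_trans)
  have cot: "(u, b) \<in> y \<union> z \<or> (b, v) \<in> y \<union> z" if "(u, v) \<in> y \<union> z" "u < b" "b < v" for u v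
    using inv_setsD(5)[OF y] inv_setsD(5)[OF z] that by blast
  assume "(a, c) \<in> (y \<union> z)\<^sup>+" "a < b" "b < c"
  then show "(a, b) \<in> (y \<union> z)\<^sup>+ \<or> (b, c) \<in> (y \<union> z)\<^sup>+"
  proof (induction rule: trancl_induct)
    case (base c)
    then show ?case using cot by blast
  next
    case (step c d)
    consider "b < c" | "b = c" | "c < b" by linarith
    then show ?case
    proof cases
      case 1
      then show ?thesis using step by (meson trancl.trancl_into_trancl)
    next
      case 2
      then show ?thesis using step by blast
    next
      case 3
      then have "(c, b) \<in> y \<union> z \<or> (b, d) \<in> y \<union> z" using cot[OF step.hyps(2)] step.prems by blast
      then show ?thesis using step by (meson r_into_trancl' trancl.trancl_into_trancl)
    qed
  qed
qed

lemma inv_sets_has_atom: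
  assumes "z \<in> inv_sets n" "(a, b) \<in> z"
  shows "\<exists>k. (k, Suc k) \<in> z"
  using assms(2)
proof (induction "b - a" arbitrary: a b rule: less_induct)
  case less
  have ab: "a < b" using inv_setsD(2)[OF assms(1)] less by blast
  show ?case
  proof (cases "b = Suc a")
    case False
    then have "(a, Suc a) \<in> z \<or> (Suc a, b) \<in> z" using inv_setsD(5)[OF assms(1) less(2), of "Suc a"] ab by simp
    then show ?thesis using less(1)[of b "Suc a"] ab by auto
  qed (use less in blast)
qed

lemma Classical_gens: "s \<in> Sigma_gens Classical n \<longleftrightarrow> (\<exists>k. s = S k \<and> 1 \<le> k \<and> k < n)"
  by (auto simp: Sigma_gens_def)

lemma pairs_inv_sets: "pairs n \<in> inv_sets n"
  by (rule inv_setsI) (auto simp: pairs_def)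

lemma nonadjacent_inv_sets:
  assumes "\<And>i. i \<in> I \<Longrightarrow> 1 \<le> i \<and> i < n" "\<And>i. i \<in> I \<Longrightarrow> Suc i \<notin> I"
  shows "(\<lambda>i. (i, Suc i)) ` I \<in> inv_sets n"
  by (rule inv_setsI) (auto dest: assms simp: Suc_le_eq)

lemma inv_quo_nonadjacent:
  assumes "\<And>i. i \<in> I \<Longrightarrow> Suc i \<notin> I" "k \<in> I"
  shows "inv_quo (S k) ((\<lambda>i. (i, Suc i)) ` I) = (\<lambda>i. (i, Suc i)) ` (I - {k})"
  using assms by (auto simp: swp_def image_iff split: if_splits)

lemma pair_inv_sets:
  "\<lbrakk>1 \<le> i; i < n; 1 \<le> j; j < n; i + 2 \<le> j \<or> j + 2 \<le> i\<rbrakk> \<Longrightarrow> {(i, Suc i), (j, Suc j)} \<in> inv_sets n"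
  by (rule inv_setsI) auto

lemma triple_inv_sets:
  "1 \<le> i \<Longrightarrow> i + 2 \<le> n \<Longrightarrow> {(i, Suc i), (i, Suc (Suc i)), (Suc i, Suc (Suc i))} \<in> inv_sets n"
  by (rule inv_setsI) auto

lemma triple_words:
  assumes "1 \<le> i" "i + 2 \<le> n"
  defines "j \<equiv> {(i, Suc i), (i, Suc (Suc i)), (Suc i, Suc (Suc i))}"
  shows "lang (Sigma_gens Classical n) gpair inv_quo j [S i, S (Suc i), S i]"
    "lang (Sigma_gens Classical n) gpair inv_quo j [S (Suc i), S i, S (Suc i)]"
  using assms by (auto simp: lang_def Classical_gens swp_def split: if_splits)

lemma braid_quo:
  assumes "z \<in> inv_sets n"
  shows "quo inv_quo z [S i, S (Suc i), S i] = quo inv_quo z [S (Suc i), S i, S (Suc i)]"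
proof -
  have *: "swp i (swp (Suc i) (swp i x)) = swp (Suc i) (swp i (swp (Suc i) x))" for x
    by (auto simp: swp_def)
  \<comment> \<open>Iterated \<open>inv_quo\<close> also requires the intermediate pairs to be
    increasing; once the final image in \<open>z\<close> is increasing, both words require the
    same.\<close>
  have "a < b \<and> swp i a < swp i b \<and> swp (Suc i) (swp i a) < swp (Suc i) (swp i b) \<longleftrightarrow>
      a < b \<and> swp (Suc i) a < swp (Suc i) b \<and> swp i (swp (Suc i) a) < swp i (swp (Suc i) b)"
    if "swp i (swp (Suc i) (swp i a)) < swp i (swp (Suc i) (swp i b))" for a b
    using that by (auto simp: swp_def split: if_splits)
  then show ?thesis using inv_setsD(2)[OF assms] by (auto simp: *)
qed

lemma commuting_quo:
  assumes "z \<in> inv_sets n" "i + 2 \<le> j"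
  shows "quo inv_quo z [S i, S j] = quo inv_quo z [S j, S i]"
proof -
  have *: "swp i (swp j x) = swp j (swp i x)" for x
    using assms(2) by (auto simp: swp_def)
  have "a < b \<and> swp j a < swp j b \<longleftrightarrow> a < b \<and> swp i a < swp i b"
    if "swp i (swp j a) < swp i (swp j b)" for a b
    using that assms(2) by (auto simp: swp_def split: if_splits)
  then show ?thesis using inv_setsD(2)[OF assms(1)] by (auto simp: *)
qed

lemma commuting_words:
  assumes "1 \<le> i" "i < n" "1 \<le> j" "j < n" "i + 2 \<le> j \<or> j + 2 \<le> i"
  shows "lang (Sigma_gens Classical n) gpair inv_quo {(i, Suc i), (j, Suc j)} [S i, S j]"
  using assms by (auto simp: lang_def Classical_gens swp_def split: if_splits)

lemma classical_germ: "garside_germ Classical n (inv_sets n) (pairs n) gpair inv_quo"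
proof
  show "finite (pairs n)" by (rule finite_pairs)
  show "z \<subseteq> pairs n" if "z \<in> inv_sets n" for z using that by (simp add: inv_sets_def)
  show "{} \<in> inv_sets n" by (rule inv_setsI) auto
  show "pairs n \<in> inv_sets n" by (rule pairs_inv_sets)
  show "\<exists>j\<in>inv_sets n. y \<subseteq> j \<and> z \<subseteq> j \<and> (\<forall>u\<in>inv_sets n. y \<subseteq> u \<longrightarrow> z \<subseteq> u \<longrightarrow> j \<subseteq> u)"
    if "y \<in> inv_sets n" "z \<in> inv_sets n" for y z
  proof (intro bexI[of _ "(y \<union> z)\<^sup>+"] conjI ballI impI)
    fix u assume u: "u \<in> inv_sets n" "y \<subseteq> u" "z \<subseteq> u"
    show "(y \<union> z)\<^sup>+ \<subseteq> u"
    proof (intro subsetI, clarify)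
      fix a b assume "(a, b) \<in> (y \<union> z)\<^sup>+"
      then show "(a, b) \<in> u"
        by (induction rule: trancl_induct) (use u inv_setsD(4)[OF u(1)] in blast)+
    qed
  qed (use that trancl_in_inv_sets in auto)
  show "{gpair s} \<in> inv_sets n" if "s \<in> Sigma_gens Classical n" for s
    using that nonadjacent_inv_sets[of "{k}" n for k] by (auto simp: Classical_gens)
  show "inj_on gpair (Sigma_gens Classical n)" by (auto simp: inj_on_def Classical_gens)
  show "\<exists>s\<in>Sigma_gens Classical n. gpair s \<in> z" if z: "z \<in> inv_sets n" "z \<noteq> {}" for z
  proof -
    obtain k where k: "(k, Suc k) \<in> z" using inv_sets_has_atom[OF z(1)] z(2) by auto
    then have "S k \<in> Sigma_gens Classical n" using inv_setsD(1,3)[OF z(1) k] by (simp add: Classical_gens)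
    then show ?thesis using k by (intro bexI[of _ "S k"]) auto
  qed
  show "z = pairs n" if z: "z \<in> inv_sets n" "gpair ` Sigma_gens Classical n \<subseteq> z" for z
  proof -
    have at: "(k, Suc k) \<in> z" if "1 \<le> k" "k < n" for k
      using z(2) that by (force simp: Classical_gens)
    have "(a, b) \<in> z" if "1 \<le> a" "a < b" "b \<le> n" for a b
      using that(2,3)
    proof (induction b)
      case (Suc b)
      then show ?case using at[of b] \<open>1 \<le> a\<close> inv_setsD(4)[OF z(1), of a b "Suc b"] by (cases "a = b") auto
    qed simp
    then show ?thesis using inv_setsD(1-3)[OF z(1)] by (auto simp: pairs_def)
  qed
  show "inv_quo s z \<in> inv_sets n" if "s \<in> Sigma_gens Classical n" "z \<in> inv_sets n" "gpair s \<in> z" for s z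
    using that inv_quo_inv_sets by (auto simp: Classical_gens simp del: inv_quo.simps)
  show "card (inv_quo s z) < card z" if s: "s \<in> Sigma_gens Classical n" "z \<in> inv_sets n" "gpair s \<in> z" for s z
  proof -
    obtain k where k: "s = S k" using s by (auto simp: Classical_gens)
    have fin: "finite z" using s(2) finite_pairs finite_subset by (auto simp: inv_sets_def)
    have "card (inv_quo s z) \<le> card (z - {(k, Suc k)})"
    proof (rule card_inj_on_le)
      show "inj_on (map_prod (swp k) (swp k)) (inv_quo s z)" by (auto simp: inj_on_def)
      show "map_prod (swp k) (swp k) ` inv_quo s z \<subseteq> z - {(k, Suc k)}"
        by (auto simp: k swp_def split: if_splits)
    qed (use fin in simp)
    also have "\<dots> < card z" using fin s k by (intro psubset_card_mono) auto
    finally show ?thesis .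
  qed
  show "inv_quo s y \<subseteq> inv_quo s z \<longleftrightarrow> y \<subseteq> z"
    if yz: "s \<in> Sigma_gens Classical n" "y \<in> inv_sets n" "z \<in> inv_sets n" "gpair s \<in> y" "gpair s \<in> z" for s y z
  proof -
    obtain k where k: "s = S k" using yz(1) by (auto simp: Classical_gens)
    have "prepend k (inv_quo s y) = y" "prepend k (inv_quo s z) = z" using prepend_inv_quo yz k by auto
    then show ?thesis using prepend_mono[of "inv_quo s y" "inv_quo s z" k] inv_quo_mono[of y z k] k by metis
  qed
  show "inv_quo s {gpair s} = {}" if "s \<in> Sigma_gens Classical n" for s
    using that by (auto simp: Classical_gens swp_def split: if_splits)
  show "gpair s \<notin> inv_quo s z" if "s \<in> Sigma_gens Classical n" "z \<in> inv_sets n" "gpair s \<in> z" for s z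
    using that by (auto simp: Classical_gens swp_def dest: inv_setsD(2))
  show "\<exists>x\<in>inv_sets n. gpair s \<in> x \<and> inv_quo s x = y"
    if s: "s \<in> Sigma_gens Classical n" "z \<in> inv_sets n" "gpair s \<in> z" "y \<in> inv_sets n" "y \<subseteq> inv_quo s z" for s z y
  proof -
    obtain k where k: "s = S k" "1 \<le> k" "k < n" using s by (auto simp: Classical_gens)
    have "(k, Suc k) \<notin> inv_quo s z" using inv_setsD(2)[OF s(2), of "Suc k" k] by (auto simp: k swp_def)
    then have "(k, Suc k) \<notin> y" using s by blast
    then show ?thesis using prepend_inv_sets[OF s(4) _ k(2,3)] k
      by (intro bexI[of _ "prepend k y"]) (auto simp: prepend_def simp del: inv_quo.simps)
  qed
  show "\<exists>j\<in>inv_sets n. lang (Sigma_gens Classical n) gpair inv_quo j l \<and> lang (Sigma_gens Classical n) gpair inv_quo j r \<and>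
             (\<forall>z\<in>inv_sets n. j \<subseteq> z \<longrightarrow> quo inv_quo z l = quo inv_quo z r)"
    if lr: "(l, r) \<in> rels Classical n" for l r
  proof -
    consider i j where "l = [S i, S j]" "r = [S j, S i]" "1 \<le> i" "i < n" "1 \<le> j" "j < n" "i + 2 \<le> j \<or> j + 2 \<le> i"
      | i where "l = [S i, S (Suc i), S i]" "r = [S (Suc i), S i, S (Suc i)]" "1 \<le> i" "i + 2 \<le> n"
      | i where "r = [S i, S (Suc i), S i]" "l = [S (Suc i), S i, S (Suc i)]" "1 \<le> i" "i + 2 \<le> n"
      using lr by (auto simp: rels_def Classical_gens)
    then show ?thesis
    proof cases
      case 1
      have "{(i, Suc i), (j, Suc j)} \<in> inv_sets n"
        using pair_inv_sets 1 by blast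
      moreover have "quo inv_quo z l = quo inv_quo z r" if "z \<in> inv_sets n" for z
        using commuting_quo[OF that] 1 by metis
      moreover have "{(i, Suc i), (j, Suc j)} = {(j, Suc j), (i, Suc i)}" by auto
      ultimately show ?thesis
        using commuting_words[of i n j] commuting_words[of j n i] 1 by metis
    next
      case 2
      then show ?thesis using triple_words[of i n] triple_inv_sets[of i n] braid_quo[of _ n i] by metis
    next
      case 3
      then show ?thesis using triple_words[of i n] triple_inv_sets[of i n] braid_quo[of _ n i] by metis
    qed
  qed
  show "(s, t) \<in> {(s, t). gpair s \<in> z \<and> gpair t \<in> z \<and>
             (\<exists>u v. ((s # u, t # v) \<in> rels Classical n \<or> (t # v, s # u) \<in> rels Classical n) \<and>
               (\<exists>j\<in>inv_sets n. j \<subseteq> z \<and> lang (Sigma_gens Classical n) gpair inv_quo j (s # u)))}\<^sup>*"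
    (is "_ \<in> ?R\<^sup>*")
    if z: "z \<in> inv_sets n" and st: "s \<in> Sigma_gens Classical n" "t \<in> Sigma_gens Classical n" "gpair s \<in> z" "gpair t \<in> z" for z s t
  proof -
    obtain i j where ij: "s = S i" "t = S j" "1 \<le> i" "i < n" "1 \<le> j" "j < n" using st by (auto simp: Classical_gens)
    have m: "(i, Suc i) \<in> z" "(j, Suc j) \<in> z" using st ij by auto
    have link: "(s, t) \<in> ?R" if "(s # u, t # v) \<in> rels Classical n" "y \<in> inv_sets n" "y \<subseteq> z"
      "lang (Sigma_gens Classical n) gpair inv_quo y (s # u)" for u v y
      using that st by blast
    consider "i = j" | "i + 2 \<le> j \<or> j + 2 \<le> i" | "j = Suc i" | "i = Suc j" by linarith
    then show ?thesis
    proof cases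
      case 2
      have "{(i, Suc i), (j, Suc j)} \<in> inv_sets n"
        using pair_inv_sets 2 ij by blast
      moreover have "([S i, S j], [S j, S i]) \<in> rels Classical n"
        using ij 2 by (auto simp: rels_def Classical_gens)
      ultimately have "(s, t) \<in> ?R"
        using commuting_words[of i n j] 2 ij m by (intro link[of "[S j]" "[S i]"]) auto
      then show ?thesis by blast
    next
      case 3
      have "([S i, S j, S i], [S j, S i, S j]) \<in> rels Classical n"
        using ij 3 by (auto simp: rels_def Classical_gens)
      moreover have "{(i, Suc i), (i, Suc (Suc i)), (Suc i, Suc (Suc i))} \<subseteq> z"
        using m 3 inv_setsD(4)[OF z, of i "Suc i" "Suc (Suc i)"] by auto
      ultimately have "(s, t) \<in> ?R"
        using triple_words[of i n] triple_inv_sets[of i n] ij 3 by (intro link[of "[S j, S i]" "[S i, S j]"]) auto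
      then show ?thesis by blast
    next
      case 4
      have "([S i, S j, S i], [S j, S i, S j]) \<in> rels Classical n"
        using ij 4 by (auto simp: rels_def Classical_gens)
      moreover have "{(j, Suc j), (j, Suc (Suc j)), (Suc j, Suc (Suc j))} \<subseteq> z"
        using m 4 inv_setsD(4)[OF z, of j "Suc j" "Suc (Suc j)"] by auto
      ultimately have "(s, t) \<in> ?R"
        using triple_words[of j n] triple_inv_sets[of j n] ij 4 by (intro link[of "[S j, S i]" "[S i, S j]"]) auto
      then show ?thesis by blast
    qed (use ij in simp)
  qed
qed


section \<open>Paths of arrows in the classical monoid\<close>

locale classical_braid =
  fixes n :: nat assumes n2: "2 \<le> n"

sublocale classical_braid \<subseteq> garside_germ Classical n "inv_sets n" "pairs n" gpair inv_quo
  by (rule classical_germ)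

definition base :: "nat set \<Rightarrow> (nat \<times> nat) set" where
  "base I = (\<lambda>i. (i, Suc i)) ` I"

text \<open>
  \<open>layers W I\<close> is the inversion set of the product of the commuting generators with indices in \<open>W\<close>,
  followed by those with indices in \<open>I\<close>. With \<open>W\<close> and \<open>I\<close> consecutive classes \<open>par r\<close> and \<open>par (Suc r)\<close>
  these are bipartite Coxeter elements, which form a path in the arrow relation.
\<close>
definition layer :: "nat set \<Rightarrow> nat \<Rightarrow> nat" where
  "layer W x = (if x \<in> W then Suc x else if 0 < x \<and> x - 1 \<in> W then x - 1 else x)"

definition layers :: "nat set \<Rightarrow> nat set \<Rightarrow> (nat \<times> nat) set" where
  "layers W I = base W \<union> map_prod (layer W) (layer W) ` base I"

definition par :: "nat \<Rightarrow> nat set" where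
  "par r = {i. 1 \<le> i \<and> i \<le> r \<and> even (r - i)}"

lemma layers_empty: "layers {} I = base I"
  by (force simp: layers_def base_def layer_def)

lemma prepend_layers:
  assumes "s \<notin> W" "Suc s \<notin> W" "\<And>i. i \<in> W \<Longrightarrow> Suc i \<noteq> s"
  shows "prepend s (layers W I) = layers (insert s W) I"
proof -
  have g: "swp s (layer W x) = layer (insert s W) x" for x
    using assms by (cases x; cases s) (auto simp: layer_def swp_def)
  have "(swp s i, swp s (Suc i)) = (i, Suc i)" if "i \<in> W" for i
    using assms that by (auto simp: swp_def)
  then have "map_prod (swp s) (swp s) ` base W = base W"
    by (force simp: base_def)
  moreover have "map_prod (swp s) (swp s) ` map_prod (layer W) (layer W) ` base I =
      map_prod (layer (insert s W)) (layer (insert s W)) ` base I"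
    by (simp add: image_image map_prod_def g case_prod_unfold)
  ultimately show ?thesis by (auto simp: prepend_def layers_def image_Un base_def)
qed

context classical_braid
begin

lemma S_gen [simp]: "S k \<in> G \<longleftrightarrow> 1 \<le> k \<and> k < n"
  by (simp add: Classical_gens)

text \<open>The path passes through the product of \<open>S (Suc i)\<close> and \<open>S i\<close>:
  its first letter is the only generator dividing it on the left, and it ends in
  \<open>S i\<close>.\<close>

lemma gelt_step_down:
  assumes "1 \<le> i" "Suc i < n"
  shows "(ge (S (Suc i)), ge (S i)) \<in> arrows\<^sup>*"
proof -
  let ?z = "{(i, Suc i)}" and ?y = "prepend (Suc i) {(i, Suc i)}"
  have z: "?z \<in> inv_sets n" using atom_Z[of "S i"] assms by simp
  have y: "?y \<in> inv_sets n" "inv_quo (S (Suc i)) ?y = ?z" using prepend_inv_sets[OF z, of "Suc i"] assms by auto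
  have w: "word_of ?y ([S (Suc i)] @ [S i])"
    using y(2) word_of_atom[of "S i"] assms by (simp add: lang_Cons prepend_def del: inv_quo.simps)
  have "arrow Classical n (ge (S (Suc i))) (el ?y)"
  proof (rule arrow_elI[OF y(1)])
    fix s assume "s \<in> G" "gpair s \<in> ?y"
    then obtain k where "s = S k" "(k, Suc k) \<in> ?y" by (auto simp: Classical_gens)
    then have "s = S (Suc i)" by (auto simp: in_prepend swp_def split: if_splits)
    then show "s \<in> Rset Classical n (ge (S (Suc i)))" using Rset_gelt assms by simp
  qed
  then have "(ge (S (Suc i)), el ?y) \<in> arrows\<^sup>*"
    using arrowsI gelt_Simples el_Simples y assms by simp
  moreover have "S i \<in> Rset Classical n (el ?y)" using Rset_word_last[OF y(1) w] .
  then have "(el ?y, ge (S i)) \<in> arrows\<^sup>*"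
    using Lset_gelt[of "S i"] assms y by (intro arrowsI) (auto simp: arrow_def gelt_Simples el_Simples)
  ultimately show ?thesis by (rule rtrancl_trans)
qed

lemma gelt_down: "1 \<le> i \<Longrightarrow> i < n \<Longrightarrow> (ge (S i), ge (S 1)) \<in> arrows\<^sup>*"
proof (induction i)
  case (Suc i)
  then show ?case using gelt_step_down[of i] by (cases "i = 0") (auto intro: rtrancl_trans)
qed simp

lemma base_word:
  assumes "\<And>i. i \<in> I \<Longrightarrow> 1 \<le> i \<and> i < n" "\<And>i. i \<in> I \<Longrightarrow> Suc i \<notin> I" "distinct xs" "set xs \<subseteq> I"
  shows "word_of (base (set xs)) (map S xs)"
proof -
  have im: "gpair ` S ` J = base J" for J by (auto simp: base_def image_image)
  have "word_of (gpair ` set (map S xs)) (map S xs)"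
  proof (rule word_of_atoms[where Y = "S ` I"])
    fix X assume "X \<subseteq> S ` I"
    then obtain J where J: "X = S ` J" "J \<subseteq> I" by (auto simp: subset_image_iff)
    show "gpair ` X \<in> inv_sets n"
      unfolding J(1) im base_def using assms J by (intro nonadjacent_inv_sets) blast+
    fix s assume "s \<in> X"
    then obtain k where k: "s = S k" "k \<in> J" using J by auto
    have "inv_quo s (base J) = base (J - {k})"
      unfolding k base_def using assms J k by (intro inv_quo_nonadjacent) blast+
    moreover have "S ` J - {S k} = S ` (J - {k})" by auto
    ultimately show "inv_quo s (gpair ` X) = gpair ` (X - {s})" unfolding J(1) k(1) im by (simp add: im)
  qed (use assms in \<open>auto simp: distinct_map inj_on_def\<close>)
  then show ?thesis by (simp add: im)
qed

lemma par_bound: "i \<in> par r \<Longrightarrow> r < n \<Longrightarrow> 1 \<le> i \<and> i < n"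
  by (auto simp: par_def)

lemma par_nonadjacent: "i \<in> par r \<Longrightarrow> Suc i \<notin> par r"
  by (auto simp: par_def Suc_diff_Suc)

lemma par_disjoint: "i \<in> par (Suc r) \<Longrightarrow> i \<notin> par r"
  by (auto simp: par_def Suc_diff_le)

text \<open>The first layer is a subset of \<open>par r\<close> so that it can be built letter by
  letter. The second may be listed in any order, which later lets each of its letters come
  last.\<close>

lemma layers_word:
  assumes r: "Suc r < n"
  shows "\<lbrakk>distinct xs; set xs \<subseteq> par r; distinct ys; set ys = par (Suc r)\<rbrakk> \<Longrightarrow>
    layers (set xs) (par (Suc r)) \<in> inv_sets n \<and> word_of (layers (set xs) (par (Suc r))) (map S xs @ map S ys)"
proof (induction xs)
  case Nil
  have "base (par (Suc r)) \<in> inv_sets n"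
    unfolding base_def using par_bound[of _ "Suc r"] par_nonadjacent r by (intro nonadjacent_inv_sets) auto
  moreover have "word_of (base (set ys)) (map S ys)"
    using par_bound[of _ "Suc r"] par_nonadjacent r Nil by (intro base_word[of "par (Suc r)"]) auto
  ultimately show ?case using Nil by (simp add: layers_empty)
next
  case (Cons s xs)
  let ?W = "set xs" and ?I = "par (Suc r)"
  have s: "s \<notin> ?W" "s \<in> par r" "?W \<subseteq> par r" using Cons.prems by auto
  have u: "prepend s (layers ?W ?I) = layers (insert s ?W) ?I"
    using s par_nonadjacent by (intro prepend_layers) blast+
  have ih: "layers ?W ?I \<in> inv_sets n" "word_of (layers ?W ?I) (map S xs @ map S ys)" using Cons by auto
  have "(s, Suc s) \<notin> layers ?W ?I"
  proof
    assume "(s, Suc s) \<in> layers ?W ?I"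
    then obtain i where i: "i \<in> ?I" "s = layer ?W i" using s by (auto simp: layers_def base_def)
    then have "i \<notin> ?W" using par_disjoint s by blast
    then have "s = i \<or> s \<in> ?W" using i by (auto simp: layer_def split: if_splits)
    then show False using s i par_disjoint by blast
  qed
  then have "layers (insert s ?W) ?I \<in> inv_sets n" "inv_quo (S s) (layers (insert s ?W) ?I) = layers ?W ?I"
    using prepend_inv_sets[OF ih(1), of s] u par_bound[OF s(2)] r by auto
  moreover have "(s, Suc s) \<in> layers (insert s ?W) ?I" by (simp add: layers_def base_def)
  ultimately show ?case using ih par_bound[OF s(2)] r by (simp add: lang_Cons del: inv_quo.simps)
qed

text \<open>Every index \<open>i\<close> of the second layer has a neighbour in the first,
  \<open>i - 1\<close> or, for \<open>i = 1\<close>, \<open>i + 1\<close>. So the first layer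
  stretches the pair \<open>(i, Suc i)\<close> to a nonadjacent one, and no further atom
  arises.\<close>

lemma layers_atoms:
  assumes "1 \<le> r" "(k, Suc k) \<in> layers (par r) (par (Suc r))" shows "k \<in> par r"
proof (rule ccontr)
  assume k: "k \<notin> par r"
  then obtain i where i: "i \<in> par (Suc r)" "k = layer (par r) i" "Suc k = layer (par r) (Suc i)"
    using assms(2) by (auto simp: layers_def base_def)
  have p: "i - 1 \<in> par r" if "1 < i" using i(1) that by (auto simp: par_def)
  have q: "Suc i \<in> par r" if "Suc i \<le> r"
    using i(1) that by (auto simp: par_def Suc_diff_le)
  have ni: "i \<notin> par r" using par_disjoint i by blast
  have 0: "0 \<notin> par r" "1 \<le> i" "i \<le> Suc r" using i(1) by (auto simp: par_def)
  show False
  proof (cases "1 < i")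
    case True
    then have "k = i - 1" using i(2) ni p by (simp add: layer_def)
    then show False using p True k by simp
  next
    case False
    then have i1: "i = 1" using 0 by simp
    then have "k = 1" using i(2) ni 0 by (simp add: layer_def)
    then have "2 \<notin> par r" using i(3) i1 by (auto simp: layer_def numeral_2_eq_2)
    then have "\<not> 2 \<le> r" using q i1 by (auto simp: numeral_2_eq_2)
    then have "r = 1" using assms(1) by simp
    then show False using i(1) i1 by (simp add: par_def)
  qed
qed

text \<open>The element with layers \<open>par r\<close> and \<open>par (Suc r)\<close> starts only
  with letters in which its predecessor can end, and it ends in every letter of
  \<open>par (Suc r)\<close>. Each step thus raises the top index by one.\<close>

lemma alternating_reachable:
  "1 \<le> r \<Longrightarrow> r < n \<Longrightarrow> \<exists>y\<in>Sm. (ge (S 1), y) \<in> arrows\<^sup>* \<and> (\<forall>k\<in>par r. S k \<in> Rset Classical n y)"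
proof (induction r rule: nat_induct_at_least)
  case base
  have "par 1 = {1}" by (auto simp: par_def)
  then show ?case using Rset_gelt[of "S 1"] gelt_Simples[of "S 1"] base by (intro bexI[of _ "ge (S 1)"]) auto
next
  case (Suc r)
  then obtain x where x: "x \<in> Sm" "(ge (S 1), x) \<in> arrows\<^sup>*" "\<forall>k\<in>par r. S k \<in> Rset Classical n x" by auto
  let ?z = "layers (par r) (par (Suc r))"
  have fin: "finite (par m)" for m by (rule finite_subset[of _ "{..m}"]) (auto simp: par_def)
  obtain xs where xs: "distinct xs" "set xs = par r" using finite_distinct_list[OF fin] by blast
  note w = layers_word[OF Suc.prems(1) xs(1) eq_refl[OF xs(2)], unfolded xs(2)]
  have z: "?z \<in> inv_sets n" using w finite_distinct_list[OF fin] by blast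
  have "arrow Classical n x (el ?z)"
  proof (rule arrow_elI[OF z])
    fix s assume "s \<in> G" "gpair s \<in> ?z"
    then obtain k where "s = S k" "(k, Suc k) \<in> ?z" by (auto simp: Classical_gens)
    then show "s \<in> Rset Classical n x" using layers_atoms[of r k] Suc.hyps x by auto
  qed
  then have "(ge (S 1), el ?z) \<in> arrows\<^sup>*"
    using x arrowsI el_Simples[OF z] by (blast intro: rtrancl_trans)
  moreover have "S k \<in> Rset Classical n (el ?z)" if k: "k \<in> par (Suc r)" for k
  proof -
    obtain ys where ys: "distinct ys" "set ys = par (Suc r) - {k}"
      using finite_distinct_list[of "par (Suc r) - {k}"] fin by blast
    have "word_of ?z (map S xs @ map S (ys @ [k]))" using w[of "ys @ [k]"] ys k by auto
    then show ?thesis using Rset_word_last[OF z, of "map S xs @ map S ys" "S k"] by simp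
  qed
  ultimately show ?case using el_Simples[OF z] by blast
qed

text \<open>Two adjacent generators have a least common multiple of length 3, so the polynomial is
  \<open>1 - 2t + t^3\<close>, with value -5/64 at 3/4.\<close>

lemma moebius_neg: "3 \<le> n \<Longrightarrow> moebius {S 1, S 2} (3/4) < 0"
proof -
  assume n: "3 \<le> n"
  have "len (DX {S 1, S 2}) = length [S 1, S (Suc 1), S 1]"
  proof (rule len_DX_word)
    show "{(1, Suc 1), (1, Suc (Suc 1)), (Suc 1, Suc (Suc 1))} \<in> inv_sets n" using triple_inv_sets[of 1 n] n by simp
    show "word_of {(1, Suc 1), (1, Suc (Suc 1)), (Suc 1, Suc (Suc 1))} [S 1, S (Suc 1), S 1]"
      using triple_words(1)[of 1 n] n by simp
    show "{(1, Suc 1), (1, Suc (Suc 1)), (Suc 1, Suc (Suc 1))} \<subseteq> z" if "z \<in> inv_sets n" "gpair ` {S 1, S 2} \<subseteq> z" for z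
      using that inv_setsD(4)[OF that(1), of 1 2 3] by (auto simp: numeral_2_eq_2 numeral_3_eq_3)
  qed (use n in \<open>auto simp: numeral_2_eq_2\<close>)
  then have "len (DX {S 1, S 2}) = 3" by simp
  moreover have "Pow {S 1, S 2} = {{}, {S 1}, {S 2}, {S 1, S 2}}" by (auto simp: Pow_insert)
  ultimately show ?thesis
    using len_DX_empty len_DX_single[of "S 1"] len_DX_single[of "S 2"] n
    by (simp add: moebius_def power3_eq_cube)
qed

lemma ergodic: ergodic
  unfolding ergodic_def
proof
  fix s assume "s \<in> G"
  then obtain i where i: "s = S i" "1 \<le> i" "i < n" by (auto simp: Classical_gens)
  \<comment> \<open>The last bipartite element can end in every index of the parity of
    \<open>n - 1\<close>, so the generators outside its right set have indices of the other parity
    and commute pairwise.\<close>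
  have "1 \<le> n - 1" "n - 1 < n" using n2 by auto
  then obtain y where y: "y \<in> Sm" "(ge (S 1), y) \<in> arrows\<^sup>*" "\<forall>k\<in>par (n - 1). S k \<in> Rset Classical n y"
    using alternating_reachable by blast
  let ?Y = "G - Rset Classical n y" and ?I = "{k. 1 \<le> k \<and> k < n \<and> k \<notin> par (n - 1)}"
  have Y: "?Y \<subseteq> S ` ?I"
  proof
    fix t assume "t \<in> ?Y"
    then obtain k where "t = S k" "1 \<le> k" "k < n" "S k \<notin> Rset Classical n y" by (auto simp: Classical_gens)
    then show "t \<in> S ` ?I" using y(3) by blast
  qed
  have I: "Suc k \<notin> ?I" if "k \<in> ?I" for k
  proof
    assume "Suc k \<in> ?I"
    then have "odd (n - 1 - k)" "odd (n - 1 - Suc k)" "Suc k \<le> n - 1" using that by (auto simp: par_def)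
    moreover have "n - 1 - k = Suc (n - 1 - Suc k)" using \<open>Suc k \<le> n - 1\<close> by simp
    ultimately show False by simp
  qed
  have "len (DX X) = card X" if X: "X \<subseteq> ?Y" for X
  proof -
    obtain J where J: "X = S ` J" "J \<subseteq> ?I" using X Y by (metis (no_types, lifting) subset_image_iff subset_trans)
    have "finite J" using J finite_subset[of J "{..n}"] by force
    then obtain xs where xs: "distinct xs" "set xs = J" using finite_distinct_list by blast
    have w: "word_of (base J) (map S xs)" using base_word[of ?I xs] I J xs by auto
    have im: "gpair ` X = base J" using J(1) by (simp add: base_def image_image)
    have "len (DX X) = length (map S xs)"
    proof (rule len_DX_word[OF _ _ _ _ w])
      show "base J \<in> inv_sets n" unfolding base_def using J I by (intro nonadjacent_inv_sets) blast+
    qed (use X im in auto)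
    also have "\<dots> = card X" using xs J(1) distinct_card[OF xs(1)] by (simp add: card_image inj_on_def)
    finally show ?thesis .
  qed
  moreover have "?Y = {} \<or> (\<exists>Y \<subseteq> G. moebius Y (3/4) < 0)"
  proof (cases "n = 2")
    case True
    then have "?I = {}" by (auto simp: par_def)
    then show ?thesis using Y by blast
  next
    case False
    then show ?thesis using moebius_neg n2 by (intro disjI2 exI[of _ "{S 1, S 2}"]) auto
  qed
  moreover have "(ge s, y) \<in> arrows\<^sup>*" using gelt_down[of i] i y by (auto intro: rtrancl_trans)
  ultimately show "\<exists>y\<in>Sm. (ge s, y) \<in> arrows\<^sup>* \<and> (\<forall>X\<subseteq>G - Rset Classical n y. len (DX X) = card X) \<and>
       (G - Rset Classical n y = {} \<or> (\<exists>Y\<subseteq>G. moebius Y (3 / 4) < 0))"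
    using y(1) by blast
qed

end

context garside_germ
begin

text \<open>\<open>quo q tp w\<close> is the state of the complement of \<open>el z\<close> in
  \<open>Delta\<close>, so the generators outside the right set are the atoms of that
  complement.\<close>

lemma Rset_el:
  assumes "z \<in> Z" "word_of z w"
  shows "s \<in> Rset K n (el z) \<longleftrightarrow> s \<in> G \<and> atm s \<notin> quo q tp w"
proof (cases "s \<in> G")
  case True
  have p: "rpath tp w" using word_of_subset_iff[OF assms(1) tp_Z assms(2)] le_tp[OF assms(1)] by blast
  have "el z \<odot> ge s = cls K n (w @ [s])" using el_word_of[OF assms] by (simp add: gelt_def flip: mult_cls)
  moreover have "cls K n (w @ [s]) \<in> Sm \<longleftrightarrow> rpath tp (w @ [s])"
  proof
    assume "cls K n (w @ [s]) \<in> Sm"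
    then obtain y where y: "y \<in> Z" "cls K n (wd y) = cls K n (w @ [s])" by (auto simp: Simples_el el_def)
    then have "word_of y (w @ [s])" using weq_word_of[OF _ y(1) word_of_wd[OF y(1)]] cls_eq_iff by blast
    then show "rpath tp (w @ [s])" using word_of_subset_iff[OF y(1) tp_Z] le_tp[OF y(1)] by blast
  next
    assume "rpath tp (w @ [s])"
    then obtain y where "y \<in> Z" "word_of y (w @ [s])" using path_word_of tp_Z by blast
    then show "cls K n (w @ [s]) \<in> Sm" using el_word_of Simples_el by blast
  qed
  ultimately show ?thesis using True p by (simp add: Rset_def pth_append)
qed (simp add: Rset_def)

end

section \<open>The dual braid monoid\<close>

text \<open>
  A noncrossing partition is given by the pairs \<open>a < b\<close> lying in a common block. Dividing by the
  generator \<open>D i j\<close> splits the block of \<open>i\<close> and \<open>j\<close> along the interval \<open>[i, j)\<close>; the other blocks do not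
  meet both sides.
\<close>
definition nc_sets :: "nat \<Rightarrow> (nat \<times> nat) set set" where
  "nc_sets n = {z. z \<subseteq> pairs n \<and> (\<forall>a b c. (a, b) \<in> z \<longrightarrow> (b, c) \<in> z \<longrightarrow> (a, c) \<in> z) \<and>
     (\<forall>a b c. (a, b) \<in> z \<longrightarrow> (a, c) \<in> z \<longrightarrow> b < c \<longrightarrow> (b, c) \<in> z) \<and>
     (\<forall>a b c. (a, c) \<in> z \<longrightarrow> (b, c) \<in> z \<longrightarrow> a < b \<longrightarrow> (a, b) \<in> z) \<and>
     (\<forall>a b c d. a < b \<longrightarrow> b < c \<longrightarrow> c < d \<longrightarrow> (a, c) \<in> z \<longrightarrow> (b, d) \<in> z \<longrightarrow> (a, b) \<in> z)}"

primrec nc_quo :: "gen \<Rightarrow> (nat \<times> nat) set \<Rightarrow> (nat \<times> nat) set" where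
  "nc_quo (D i j) z = {(a, b) \<in> z. (i \<le> a \<and> a < j) = (i \<le> b \<and> b < j)}"
| "nc_quo (S k) z = {}"

lemma nc_setsD:
  assumes "z \<in> nc_sets n"
  shows "(a, b) \<in> z \<Longrightarrow> 1 \<le> a" "(a, b) \<in> z \<Longrightarrow> a < b" "(a, b) \<in> z \<Longrightarrow> b \<le> n"
    "\<lbrakk>(a, b) \<in> z; (b, c) \<in> z\<rbrakk> \<Longrightarrow> (a, c) \<in> z"
    "\<lbrakk>(a, b) \<in> z; (a, c) \<in> z; b < c\<rbrakk> \<Longrightarrow> (b, c) \<in> z"
    "\<lbrakk>(a, c) \<in> z; (b, c) \<in> z; a < b\<rbrakk> \<Longrightarrow> (a, b) \<in> z"
    "\<lbrakk>a < b; b < c; c < d; (a, c) \<in> z; (b, d) \<in> z\<rbrakk> \<Longrightarrow> (a, b) \<in> z"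
proof -
  note c0 = assms[unfolded nc_sets_def mem_Collect_eq]
  note c = c0[THEN conjunct1] c0[THEN conjunct2, THEN conjunct1]
    c0[THEN conjunct2, THEN conjunct2, THEN conjunct1]
    c0[THEN conjunct2, THEN conjunct2, THEN conjunct2, THEN conjunct1]
    c0[THEN conjunct2, THEN conjunct2, THEN conjunct2, THEN conjunct2]
  show "(a, b) \<in> z \<Longrightarrow> 1 \<le> a" "(a, b) \<in> z \<Longrightarrow> a < b" "(a, b) \<in> z \<Longrightarrow> b \<le> n"
    using c(1) unfolding pairs_def by auto
  show "\<lbrakk>(a, b) \<in> z; (b, c) \<in> z\<rbrakk> \<Longrightarrow> (a, c) \<in> z" using c(2) by blast
  show "\<lbrakk>(a, b) \<in> z; (a, c) \<in> z; b < c\<rbrakk> \<Longrightarrow> (b, c) \<in> z" using c(3) by blast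
  show "\<lbrakk>(a, c) \<in> z; (b, c) \<in> z; a < b\<rbrakk> \<Longrightarrow> (a, b) \<in> z" using c(4) by blast
  show "\<lbrakk>a < b; b < c; c < d; (a, c) \<in> z; (b, d) \<in> z\<rbrakk> \<Longrightarrow> (a, b) \<in> z" using c(5) by blast
qed

lemma nc_sets_subset: "z \<in> nc_sets n \<Longrightarrow> z \<subseteq> pairs n"
  by (simp add: nc_sets_def)

lemma nc_setsI:
  assumes "\<And>a b. (a, b) \<in> z \<Longrightarrow> 1 \<le> a \<and> a < b \<and> b \<le> n"
    "\<And>a b c. \<lbrakk>(a, b) \<in> z; (b, c) \<in> z\<rbrakk> \<Longrightarrow> (a, c) \<in> z"
    "\<And>a b c. \<lbrakk>(a, b) \<in> z; (a, c) \<in> z; b < c\<rbrakk> \<Longrightarrow> (b, c) \<in> z"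
    "\<And>a b c. \<lbrakk>(a, c) \<in> z; (b, c) \<in> z; a < b\<rbrakk> \<Longrightarrow> (a, b) \<in> z"
    "\<And>a b c d. \<lbrakk>a < b; b < c; c < d; (a, c) \<in> z; (b, d) \<in> z\<rbrakk> \<Longrightarrow> (a, b) \<in> z"
  shows "z \<in> nc_sets n"
  unfolding nc_sets_def mem_Collect_eq
proof (intro conjI allI impI)
  show "z \<subseteq> pairs n" using assms(1) by (auto simp: pairs_def)
qed (fact assms(2-5))+

lemma Inter_nc_sets: "A \<subseteq> nc_sets n \<Longrightarrow> A \<noteq> {} \<Longrightarrow> \<Inter>A \<in> nc_sets n"
proof (rule nc_setsI)
  assume A: "A \<subseteq> nc_sets n" "A \<noteq> {}"
  note AD = nc_setsD[OF subsetD[OF A(1)]]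
  fix a b c d
  show "(a, b) \<in> \<Inter>A \<Longrightarrow> 1 \<le> a \<and> a < b \<and> b \<le> n" using AD(1-3)[of _ a b] A(2) by blast
  show "\<lbrakk>(a, b) \<in> \<Inter>A; (b, c) \<in> \<Inter>A\<rbrakk> \<Longrightarrow> (a, c) \<in> \<Inter>A" using AD(4)[of _ a b c] by blast
  show "\<lbrakk>(a, b) \<in> \<Inter>A; (a, c) \<in> \<Inter>A; b < c\<rbrakk> \<Longrightarrow> (b, c) \<in> \<Inter>A" using AD(5)[of _ a b c] by blast
  show "\<lbrakk>(a, c) \<in> \<Inter>A; (b, c) \<in> \<Inter>A; a < b\<rbrakk> \<Longrightarrow> (a, b) \<in> \<Inter>A" using AD(6)[of _ a c b] by blast
  show "\<lbrakk>a < b; b < c; c < d; (a, c) \<in> \<Inter>A; (b, d) \<in> \<Inter>A\<rbrakk> \<Longrightarrow> (a, b) \<in> \<Inter>A"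
    using AD(7)[of _ a b c d] by blast
qed

lemma pairs_nc_sets: "pairs n \<in> nc_sets n"
  by (rule nc_setsI) (auto simp: pairs_def)

lemma nc_quo_nc_sets:
  assumes "z \<in> nc_sets n" shows "nc_quo (D i j) z \<in> nc_sets n"
proof (rule nc_setsI)
  note zD = nc_setsD[OF assms]
  fix a b c d
  show "(a, b) \<in> nc_quo (D i j) z \<Longrightarrow> 1 \<le> a \<and> a < b \<and> b \<le> n" using zD(1-3)[of a b] by auto
  show "\<lbrakk>(a, b) \<in> nc_quo (D i j) z; (b, c) \<in> nc_quo (D i j) z\<rbrakk> \<Longrightarrow> (a, c) \<in> nc_quo (D i j) z"
    using zD(4)[of a b c] by auto
  show "\<lbrakk>(a, b) \<in> nc_quo (D i j) z; (a, c) \<in> nc_quo (D i j) z; b < c\<rbrakk> \<Longrightarrow> (b, c) \<in> nc_quo (D i j) z"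
    using zD(5)[of a b c] by auto
  show "\<lbrakk>(a, c) \<in> nc_quo (D i j) z; (b, c) \<in> nc_quo (D i j) z; a < b\<rbrakk> \<Longrightarrow> (a, b) \<in> nc_quo (D i j) z"
    using zD(6)[of a c b] by auto
  show "\<lbrakk>a < b; b < c; c < d; (a, c) \<in> nc_quo (D i j) z; (b, d) \<in> nc_quo (D i j) z\<rbrakk> \<Longrightarrow> (a, b) \<in> nc_quo (D i j) z"
    using zD(7)[of a b c d] by auto
qed

text \<open>A pair of \<open>y\<close> with ends on both sides of the cut is linked inside
  \<open>y\<close> to \<open>i\<close> and \<open>j\<close>, through the noncrossing property if
  necessary. These links stay on one side, so they belong to \<open>z\<close>, and
  \<open>(i, j)\<close> in \<open>z\<close> recombines them.\<close>

lemma nc_quo_reflects_subset: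
  assumes y: "y \<in> nc_sets n" "(i, j) \<in> y" and z: "z \<in> nc_sets n" "(i, j) \<in> z"
    and sub: "nc_quo (D i j) y \<subseteq> nc_quo (D i j) z"
  shows "y \<subseteq> z"
proof clarify
  note yD = nc_setsD[OF y(1)] and zD = nc_setsD[OF z(1)]
  fix a b assume ab: "(a, b) \<in> y"
  have ab': "a < b" "i < j" using yD(2) ab y(2) by auto
  have tr: "(u, v) \<in> z" if "(u, v) \<in> y" "(i \<le> u \<and> u < j) = (i \<le> v \<and> v < j)" for u v
    using sub that by auto
  consider "(i \<le> a \<and> a < j) = (i \<le> b \<and> b < j)" | "a = i" "j \<le> b" | "i < a" "a < j" "b = j"
    | "i < a" "a < j" "j < b" | "a < i" "b = i" | "a < i" "i < b" "b < j"
    using ab' by linarith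
  then show "(a, b) \<in> z"
  proof cases
    case 1
    then show ?thesis using tr ab by blast
  next
    case 2
    show ?thesis
    proof (cases "b = j")
      case False
      then have "(j, b) \<in> y" using yD(5)[of i j b] y(2) ab 2 by simp
      then have "(j, b) \<in> z" using tr[of j b] 2 by auto
      then show ?thesis using zD(4)[OF z(2)] 2 by blast
    qed (use z 2 in simp)
  next
    case 3
    then have "(i, a) \<in> y" using yD(6)[of i j a] y(2) ab by simp
    then have "(i, a) \<in> z" using tr[of i a] 3 by auto
    then show ?thesis using zD(5)[of i a j] z(2) 3 by blast
  next
    case 4
    have ia: "(i, a) \<in> y" using yD(7)[of i a j b] y(2) ab 4 by simp
    then have "(i, b) \<in> y" using yD(4) ab by blast
    then have "(j, b) \<in> y" using yD(5) y(2) 4 by blast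
    then have "(i, a) \<in> z" "(j, b) \<in> z" using tr[of i a] tr[of j b] ia 4 by auto
    then show ?thesis using zD(5)[of i a j] zD(4)[of a j b] z(2) 4 by blast
  next
    case 5
    then have "(a, j) \<in> y" using yD(4) ab y(2) by blast
    then have "(a, j) \<in> z" using tr[of a j] 5 ab' by auto
    then show ?thesis using zD(6)[of a j i] z(2) 5 by blast
  next
    case 6
    have ai: "(a, i) \<in> y" using yD(7)[of a i b j] y(2) ab 6 by simp
    then have "(a, j) \<in> y" "(i, b) \<in> y" using yD(4)[of a i j] yD(5)[of a i b] ab y(2) 6 by auto
    then have "(a, j) \<in> z" "(i, b) \<in> z" using tr[of a j] tr[of i b] 6 ab' by auto
    then show ?thesis using zD(6)[of a j i] zD(4)[of a i b] z(2) 6 by blast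
  qed
qed

text \<open>The preimage merges the blocks of \<open>i\<close> and \<open>j\<close>. Every block of
  \<open>y\<close> lies either inside or outside \<open>[i, j)\<close>, which keeps the merged block
  from crossing the others.\<close>

lemma nc_quo_lift:
  assumes y: "y \<in> nc_sets n" and ij: "1 \<le> i" "i < j" "j \<le> n"
    and K: "\<And>a b. (a, b) \<in> y \<Longrightarrow> (i \<le> a \<and> a < j) = (i \<le> b \<and> b < j)"
  shows "\<exists>x\<in>nc_sets n. (i, j) \<in> x \<and> nc_quo (D i j) x = y"
proof -
  note yD = nc_setsD[OF y]
  \<comment> \<open>\<open>E\<close> is \<open>y\<close> as an equivalence relation,
    \<open>B\<close> the union of the blocks of \<open>i\<close> and \<open>j\<close>, and
    \<open>R\<close> the equivalence after merging them.\<close>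
  define E where "E u v \<longleftrightarrow> u = v \<or> (u, v) \<in> y \<or> (v, u) \<in> y" for u v
  define B where "B u \<longleftrightarrow> E u i \<or> E u j" for u
  define R where "R u v \<longleftrightarrow> E u v \<or> (B u \<and> B v)" for u v
  define x where "x = {(a, b). a < b \<and> R a b}"
  have Esym: "E u v \<Longrightarrow> E v u" for u v by (auto simp: E_def)
  have Etrans: "E u v \<Longrightarrow> E v w \<Longrightarrow> E u w" for u v w
    using yD(4)[of u v w] yD(4)[of w v u] yD(5)[of v u w] yD(5)[of v w u] yD(6)[of u v w] yD(6)[of w v u]
    unfolding E_def by (cases u w rule: linorder_cases) blast+
  have Ey: "(a, b) \<in> y" if "E a b" "a < b" for a b
    using that yD(2)[of b a] unfolding E_def by auto
  have Ecr: "E a b" if "a < b" "b < c" "c < d" "E a c" "E b d" for a b c d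
  proof -
    have "(a, c) \<in> y" "(b, d) \<in> y" using Ey that by auto
    then show ?thesis using yD(7)[OF that(1-3)] by (simp add: E_def)
  qed
  have EK: "(i \<le> a \<and> a < j) = (i \<le> b \<and> b < j)" if "E a b" for a b
    using that K unfolding E_def by blast
  have Ei: "i \<le> u \<and> u < j" if "E u i" for u using EK[OF that] ij by simp
  have Ej: "\<not> (i \<le> u \<and> u < j)" if "E u j" for u using EK[OF that] by simp
  have Erange: "1 \<le> u \<and> u \<le> n" if "B u" for u
    using that yD(1-3)[of u i] yD(1-3)[of i u] yD(1-3)[of u j] yD(1-3)[of j u] ij
    unfolding B_def E_def by (elim disjE) auto
  have Rsym: "R u v \<Longrightarrow> R v u" for u v using Esym by (auto simp: R_def)
  have BE: "B v" if "B u" "E u v" for u v using that Esym Etrans unfolding B_def by blast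
  have Rtrans: "R u v \<Longrightarrow> R v w \<Longrightarrow> R u w" for u v w
    unfolding R_def using Etrans Esym BE by blast
  have cr: "R a b" if o: "a < b" "b < c" "c < d" and ac: "R a c" and bd: "R b d" for a b c d
  proof -
    have ac': "E a c \<or> (E a i \<and> E c j) \<or> (E a j \<and> E c i)"
      using ac Etrans[OF _ Esym] unfolding R_def B_def by blast
    have bd': "E b d \<or> (E b i \<and> E d j) \<or> (E b j \<and> E d i)"
      using bd Etrans[OF _ Esym] unfolding R_def B_def by blast
    consider "E a c" "E b d" | "B a" "B b" | "E a i" "E c j" "E b d" | "E a j" "E c i" "E b d"
      | "E a c" "E b i" "E d j" | "E a c" "E b j" "E d i"
      using ac' bd' unfolding B_def by blast
    then show ?thesis
    proof cases
      case 1
      then show ?thesis using Ecr o by (auto simp: R_def)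
    next
      case 2
      then show ?thesis by (simp add: R_def)
    next
      case 3
      have "i \<le> a" "a < j" "j \<le> c" using Ei[OF 3(1)] Ej[OF 3(2)] o by auto
      then have "j \<le> b" using EK[OF 3(3)] o by auto
      have "B b"
      proof (cases "b = j")
        case False
        then have "E j b" using Ecr[of j b c d] o 3 Esym \<open>j \<le> b\<close> by simp
        then show ?thesis using Esym by (simp add: B_def)
      qed (simp add: B_def E_def)
      then show ?thesis using 3 by (simp add: R_def B_def)
    next
      case 4
      have c: "i \<le> c" "c < j" "a < i" using Ei[OF 4(2)] Ej[OF 4(1)] o by auto
      show ?thesis
      proof (cases "d < j")
        case True
        then have "i \<le> b" using EK[OF 4(3)] c o by auto
        have "B b"
        proof (cases "b = i")
          case False
          then have "E i b" using Ecr[of i b c d] o 4 Esym \<open>i \<le> b\<close> by simp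
          then show ?thesis using Esym by (simp add: B_def)
        qed (simp add: B_def E_def)
        then show ?thesis using 4 by (simp add: R_def B_def)
      next
        case False
        show ?thesis
        proof (cases "d = j")
          case True
          then show ?thesis using 4 by (simp add: R_def B_def)
        next
          case F: False
          then have "E a b" using Ecr[of a b j d] 4 o c False by simp
          then show ?thesis by (simp add: R_def)
        qed
      qed
    next
      case 5
      have b: "i \<le> b" "b < j" "j \<le> d" using Ei[OF 5(2)] Ej[OF 5(3)] o by auto
      have "B a"
      proof (cases "c < j")
        case True
        then have ia: "i \<le> a" using EK[OF 5(1)] b o by auto
        show ?thesis
        proof (cases "a = i")
          case False
          then have "E i a" using Ecr[of i a b c] o 5 ia Esym by simp
          then show ?thesis using Esym by (simp add: B_def)
        qed (simp add: B_def E_def)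
      next
        case False
        then have ai: "a < i" using EK[OF 5(1)] b o by auto
        show ?thesis
        proof (cases "c = j")
          case True
          then show ?thesis using 5 by (simp add: B_def)
        next
          case F: False
          then have "E a j" using Ecr[of a j c d] 5 o ai b False ij Esym by simp
          then show ?thesis by (simp add: B_def)
        qed
      qed
      then show ?thesis using 5 by (simp add: R_def B_def)
    next
      case 6
      have d: "i \<le> d" "d < j" "b < i" using Ei[OF 6(3)] Ej[OF 6(2)] o by auto
      then have "E a b" using Ecr[of a b c j] 6 o by simp
      then show ?thesis by (simp add: R_def)
    qed
  qed
  have "x \<in> nc_sets n"
  proof (rule nc_setsI)
    fix a b c d
    show "(a, b) \<in> x \<Longrightarrow> 1 \<le> a \<and> a < b \<and> b \<le> n"
      using Ey[of a b] yD(1,3)[of a b] Erange by (auto simp: x_def R_def)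
    show "\<lbrakk>(a, b) \<in> x; (b, c) \<in> x\<rbrakk> \<Longrightarrow> (a, c) \<in> x" using Rtrans[of a b c] by (auto simp: x_def)
    show "\<lbrakk>(a, b) \<in> x; (a, c) \<in> x; b < c\<rbrakk> \<Longrightarrow> (b, c) \<in> x" using Rtrans[of b a c] Rsym by (auto simp: x_def)
    show "\<lbrakk>(a, c) \<in> x; (b, c) \<in> x; a < b\<rbrakk> \<Longrightarrow> (a, b) \<in> x" using Rtrans[of a c b] Rsym by (auto simp: x_def)
    show "\<lbrakk>a < b; b < c; c < d; (a, c) \<in> x; (b, d) \<in> x\<rbrakk> \<Longrightarrow> (a, b) \<in> x" using cr by (auto simp: x_def)
  qed
  moreover have "(i, j) \<in> x" using ij by (simp add: x_def R_def B_def E_def)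
  moreover have "nc_quo (D i j) x = y"
  proof (intro set_eqI, safe)
    fix a b assume "(a, b) \<in> nc_quo (D i j) x"
    then have ab: "a < b" "R a b" "(i \<le> a \<and> a < j) = (i \<le> b \<and> b < j)" by (auto simp: x_def)
    have "E a b \<or> (E a i \<and> E b j) \<or> (E a j \<and> E b i)"
      using ab(2) Etrans[OF _ Esym] unfolding R_def B_def by blast
    then have "E a b" using ab(3) Ei Ej by blast
    then show "(a, b) \<in> y" using Ey ab by blast
  next
    fix a b assume "(a, b) \<in> y"
    then show "(a, b) \<in> nc_quo (D i j) x" using K yD(2) by (auto simp: x_def R_def E_def)
  qed
  ultimately show ?thesis by blast
qed

lemma Dual_gens: "s \<in> Sigma_gens Dual n \<longleftrightarrow> (\<exists>i j. s = D i j \<and> 1 \<le> i \<and> i < j \<and> j \<le> n)"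
  by (auto simp: Sigma_gens_def)

lemma triangle_nc_sets:
  "\<lbrakk>1 \<le> i; i < j; j < k; k \<le> n\<rbrakk> \<Longrightarrow> {(i, j), (j, k), (i, k)} \<in> nc_sets n"
  by (rule nc_setsI) auto

lemma triangle_words:
  assumes "1 \<le> i" "i < j" "j < k" "k \<le> n"
  shows "lang (Sigma_gens Dual n) gpair nc_quo {(i, j), (j, k), (i, k)} [D i j, D j k]"
    "lang (Sigma_gens Dual n) gpair nc_quo {(i, j), (j, k), (i, k)} [D j k, D i k]"
    "lang (Sigma_gens Dual n) gpair nc_quo {(i, j), (j, k), (i, k)} [D i k, D i j]"
  using assms by (auto simp: lang_def Dual_gens)

lemma triangle_quo:
  assumes "i < j" "j < k"
  shows "quo nc_quo z [D i j, D j k] = quo nc_quo z [D j k, D i k]" "quo nc_quo z [D j k, D i k] = quo nc_quo z [D i k, D i j]"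
  using assms by auto

lemma two_arcs_nc_sets:
  "\<lbrakk>1 \<le> i; i < j; j \<le> n; 1 \<le> k; k < l; l \<le> n; j < k \<or> (i < k \<and> l < j)\<rbrakk> \<Longrightarrow> {(i, j), (k, l)} \<in> nc_sets n"
  by (rule nc_setsI) auto

lemma two_arcs_words:
  assumes "1 \<le> i" "i < j" "j \<le> n" "1 \<le> k" "k < l" "l \<le> n" "j < k \<or> (i < k \<and> l < j)"
  shows "lang (Sigma_gens Dual n) gpair nc_quo {(i, j), (k, l)} [D i j, D k l]"
    "lang (Sigma_gens Dual n) gpair nc_quo {(i, j), (k, l)} [D k l, D i j]"
  using assms by (auto simp: lang_def Dual_gens)

lemma dual_germ: "garside_germ Dual n (nc_sets n) (pairs n) gpair nc_quo"
proof
  show "finite (pairs n)" by (rule finite_pairs)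
  show "z \<subseteq> pairs n" if "z \<in> nc_sets n" for z using that by (rule nc_sets_subset)
  show "{} \<in> nc_sets n" by (rule nc_setsI) auto
  show "pairs n \<in> nc_sets n" by (rule pairs_nc_sets)
  show "\<exists>j\<in>nc_sets n. y \<subseteq> j \<and> z \<subseteq> j \<and> (\<forall>u\<in>nc_sets n. y \<subseteq> u \<longrightarrow> z \<subseteq> u \<longrightarrow> j \<subseteq> u)"
    if "y \<in> nc_sets n" "z \<in> nc_sets n" for y z
  proof -
    \<comment> \<open>Noncrossing partitions are closed under intersection and have a top, so the
      intersection of all upper bounds is the join.\<close>
    let ?A = "{u \<in> nc_sets n. y \<subseteq> u \<and> z \<subseteq> u}"
    have "pairs n \<in> ?A" using that pairs_nc_sets nc_sets_subset by blast
    then have "\<Inter>?A \<in> nc_sets n" by (intro Inter_nc_sets) auto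
    then show ?thesis by (intro bexI[of _ "\<Inter>?A"]) auto
  qed
  show "{gpair s} \<in> nc_sets n" if "s \<in> Sigma_gens Dual n" for s
    using that by (auto simp: Dual_gens intro!: nc_setsI)
  show "inj_on gpair (Sigma_gens Dual n)" by (auto simp: inj_on_def Dual_gens)
  show "\<exists>s\<in>Sigma_gens Dual n. gpair s \<in> z" if z: "z \<in> nc_sets n" "z \<noteq> {}" for z
  proof -
    obtain a b where ab: "(a, b) \<in> z" using z(2) by auto
    then have "D a b \<in> Sigma_gens Dual n" using nc_setsD(1-3)[OF z(1) ab] by (simp add: Dual_gens)
    then show ?thesis using ab by (intro bexI[of _ "D a b"]) auto
  qed
  show "z = pairs n" if z: "z \<in> nc_sets n" "gpair ` Sigma_gens Dual n \<subseteq> z" for z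
  proof -
    have "pairs n \<subseteq> gpair ` Sigma_gens Dual n"
    proof clarify
      fix a b assume "(a, b) \<in> pairs n"
      then show "(a, b) \<in> gpair ` Sigma_gens Dual n"
        by (intro image_eqI[of _ _ "D a b"]) (auto simp: pairs_def Dual_gens)
    qed
    then show ?thesis using z nc_sets_subset by blast
  qed
  show "nc_quo s z \<in> nc_sets n" if "s \<in> Sigma_gens Dual n" "z \<in> nc_sets n" "gpair s \<in> z" for s z
    using that nc_quo_nc_sets by (auto simp: Dual_gens simp del: nc_quo.simps)
  show "card (nc_quo s z) < card z" if s: "s \<in> Sigma_gens Dual n" "z \<in> nc_sets n" "gpair s \<in> z" for s z
  proof (rule psubset_card_mono)
    show "finite z" using s(2) finite_pairs finite_subset nc_sets_subset by blast
    have "nc_quo s z \<subseteq> z" "gpair s \<notin> nc_quo s z" using s(1) by (auto simp: Dual_gens)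
    then show "nc_quo s z \<subset> z" using s(3) by blast
  qed
  show "nc_quo s y \<subseteq> nc_quo s z \<longleftrightarrow> y \<subseteq> z"
    if yz: "s \<in> Sigma_gens Dual n" "y \<in> nc_sets n" "z \<in> nc_sets n" "gpair s \<in> y" "gpair s \<in> z" for s y z
  proof -
    obtain i j where ij: "s = D i j" using yz(1) by (auto simp: Dual_gens)
    have "nc_quo s y \<subseteq> nc_quo s z" if "y \<subseteq> z" using that ij by auto
    moreover have "y \<subseteq> z" if "nc_quo s y \<subseteq> nc_quo s z"
      using nc_quo_reflects_subset[of y n i j z] yz that unfolding ij by (simp del: nc_quo.simps)
    ultimately show ?thesis by blast
  qed
  show "nc_quo s {gpair s} = {}" if "s \<in> Sigma_gens Dual n" for s
    using that by (auto simp: Dual_gens)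
  show "gpair s \<notin> nc_quo s z" if "s \<in> Sigma_gens Dual n" "z \<in> nc_sets n" "gpair s \<in> z" for s z
    using that by (auto simp: Dual_gens)
  show "\<exists>x\<in>nc_sets n. gpair s \<in> x \<and> nc_quo s x = y"
    if s: "s \<in> Sigma_gens Dual n" "z \<in> nc_sets n" "gpair s \<in> z" "y \<in> nc_sets n" "y \<subseteq> nc_quo s z" for s z y
  proof -
    obtain i j where ij: "s = D i j" "1 \<le> i" "i < j" "j \<le> n" using s by (auto simp: Dual_gens)
    show ?thesis using nc_quo_lift[OF s(4) ij(2-4)] s(5) unfolding ij(1) by force
  qed
  show "\<exists>j\<in>nc_sets n. lang (Sigma_gens Dual n) gpair nc_quo j l \<and> lang (Sigma_gens Dual n) gpair nc_quo j r \<and>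
             (\<forall>z\<in>nc_sets n. j \<subseteq> z \<longrightarrow> quo nc_quo z l = quo nc_quo z r)"
    if lr: "(l, r) \<in> rels Dual n" "l \<in> lists (Sigma_gens Dual n)" for l r
  proof -
    consider i j k where "l = [D i j, D j k]" "r = [D j k, D i k]" "1 \<le> i" "i < j" "j < k" "k \<le> n"
      | i j k where "l = [D j k, D i k]" "r = [D i k, D i j]" "1 \<le> i" "i < j" "j < k" "k \<le> n"
      | i j k m where "l = [D i j, D k m]" "r = [D k m, D i j]" "1 \<le> i" "i < j" "j \<le> n" "1 \<le> k" "k < m" "m \<le> n"
          "j < k \<or> (i < k \<and> m < j)"
      using lr by (auto simp: rels_def Dual_gens)
    then show ?thesis
    proof cases
      case 1
      then show ?thesis using triangle_words[of i j k n] triangle_nc_sets[of i j k n] triangle_quo[of i j k] by metis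
    next
      case 2
      then show ?thesis using triangle_words[of i j k n] triangle_nc_sets[of i j k n] triangle_quo[of i j k] by metis
    next
      case 3
      have "quo nc_quo z l = quo nc_quo z r" for z using 3 by auto
      then show ?thesis using 3 two_arcs_words[of i j n k m] two_arcs_nc_sets[of i j n k m] by metis
    qed
  qed
  show "(s, t) \<in> {(s, t). gpair s \<in> z \<and> gpair t \<in> z \<and>
             (\<exists>u v. ((s # u, t # v) \<in> rels Dual n \<or> (t # v, s # u) \<in> rels Dual n) \<and>
               (\<exists>j\<in>nc_sets n. j \<subseteq> z \<and> lang (Sigma_gens Dual n) gpair nc_quo j (s # u)))}\<^sup>*"
    (is "_ \<in> ?R\<^sup>*")
    if z: "z \<in> nc_sets n" and st: "s \<in> Sigma_gens Dual n" "t \<in> Sigma_gens Dual n" "gpair s \<in> z" "gpair t \<in> z" for z s t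
  proof -
    note zD = nc_setsD[OF z]
    define Q where "Q = ?R"
    have link: "(s, t) \<in> Q" if "(s # u, t # v) \<in> rels Dual n \<or> (t # v, s # u) \<in> rels Dual n"
      "y \<in> nc_sets n" "y \<subseteq> z" "gpair s \<in> y" "gpair t \<in> y"
      "lang (Sigma_gens Dual n) gpair nc_quo y (s # u)" for s t u v y
      using that unfolding Q_def by blast
    have tri: "{(D i j, D j k), (D j k, D i j), (D j k, D i k), (D i k, D j k), (D i j, D i k), (D i k, D i j)} \<subseteq> Q\<^sup>*"
      if t: "i < j" "j < k" "(i, j) \<in> z" "(j, k) \<in> z" "(i, k) \<in> z" for i j k
    proof -
      have b: "1 \<le> i" "k \<le> n" using zD(1,3) t by auto
      let ?y = "{(i, j), (j, k), (i, k)}"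
      note w = triangle_words[OF b(1) t(1,2) b(2)]
      have y: "?y \<in> nc_sets n" "?y \<subseteq> z" using triangle_nc_sets b t by auto
      have r: "([D i j, D j k], [D j k, D i k]) \<in> rels Dual n" "([D j k, D i k], [D i k, D i j]) \<in> rels Dual n"
        using b t by (auto simp: rels_def)
      have "(D i j, D j k) \<in> Q" by (rule link[OF disjI1[OF r(1)] y]) (use w in auto)
      moreover have "(D j k, D i j) \<in> Q" by (rule link[OF disjI2[OF r(1)] y]) (use w in auto)
      moreover have "(D j k, D i k) \<in> Q" by (rule link[OF disjI1[OF r(2)] y]) (use w in auto)
      moreover have "(D i k, D j k) \<in> Q" by (rule link[OF disjI2[OF r(2)] y]) (use w in auto)
      ultimately show ?thesis by (auto intro: rtrancl_into_rtrancl r_into_rtrancl)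
    qed
    have com: "{(D i j, D k m), (D k m, D i j)} \<subseteq> Q\<^sup>*"
      if t: "(i, j) \<in> z" "(k, m) \<in> z" "j < k \<or> (i < k \<and> m < j)" for i j k m
    proof -
      have b: "1 \<le> i" "i < j" "j \<le> n" "1 \<le> k" "k < m" "m \<le> n" using zD(1-3) t by auto
      let ?y = "{(i, j), (k, m)}"
      note w = two_arcs_words[OF b t(3)]
      have y: "?y \<in> nc_sets n" "?y \<subseteq> z" using two_arcs_nc_sets b t by auto
      have r: "([D i j, D k m], [D k m, D i j]) \<in> rels Dual n" using b t(3) by (auto simp: rels_def)
      have "(D i j, D k m) \<in> Q" by (rule link[OF disjI1[OF r] y]) (use w in auto)
      moreover have "(D k m, D i j) \<in> Q" by (rule link[OF disjI2[OF r] y]) (use w in auto)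
      ultimately show ?thesis by auto
    qed
    have main: "{(D a b, D c d), (D c d, D a b)} \<subseteq> Q\<^sup>*" if ab: "(a, b) \<in> z" and cd: "(c, d) \<in> z" and ac: "a \<le> c" for a b c d
    proof -
      have o: "a < b" "c < d" using zD(2) ab cd by auto
      consider "a = c" "b = d" | "a = c" "b < d" | "a = c" "d < b" | "a < c" "b = d" | "b = c" | "b < c"
        | "a < c" "d < b" | "a < c" "c < b" "b < d" using ac by linarith
      then show ?thesis
      proof cases
        case 2
        then show ?thesis using tri[of a b d] zD(5)[of a b d] ab cd o by auto
      next
        case 3
        then show ?thesis using tri[of a d b] zD(5)[of a d b] ab cd o by auto
      next
        case 4
        then show ?thesis using tri[of a c b] zD(6)[of a b c] ab cd o by auto
      next
        case 5
        then show ?thesis using tri[of a b d] zD(4)[of a b d] ab cd o by auto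
      next
        case 6
        then show ?thesis using com[of a b c d] ab cd by auto
      next
        case 7
        then show ?thesis using com[of a b c d] ab cd by auto
      next
        case 8
        \<comment> \<open>Crossing arcs: the noncrossing property puts all four points into one
          block, and \<open>D a c\<close> lies in a triangle with each of the two
          generators.\<close>
        then have e: "(a, c) \<in> z" using zD(7)[of a c b d] ab cd by simp
        then have e2: "(c, b) \<in> z" "(a, d) \<in> z" using zD(5)[of a c b] zD(4)[of a c d] ab cd 8 by auto
        have "(D a b, D a c) \<in> Q\<^sup>*" "(D a c, D a b) \<in> Q\<^sup>*"
          using tri[of a c b] e e2 ab 8 by auto
        moreover have "(D a c, D c d) \<in> Q\<^sup>*" "(D c d, D a c) \<in> Q\<^sup>*"
          using tri[of a c d] e e2 cd 8 o by auto
        ultimately show ?thesis by (auto intro: rtrancl_trans)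
      qed simp
    qed
    obtain a b c d where "s = D a b" "t = D c d" using st by (auto simp: Dual_gens)
    then show ?thesis unfolding Q_def[symmetric]
      using main[of a b c d] main[of c d a b] st nat_le_linear[of a c] by auto
  qed
qed


section \<open>Paths of arrows in the dual monoid\<close>

locale dual_braid =
  fixes n :: nat assumes n2: "2 \<le> n"

sublocale dual_braid \<subseteq> garside_germ Dual n "nc_sets n" "pairs n" gpair nc_quo
  by (rule dual_germ)

text \<open>
  The nested arcs \<open>(u, n + 1 - u)\<close> form a simple element whose complement consists of the nested
  arcs \<open>(u, n - u)\<close>.
\<close>
definition nest :: "nat \<Rightarrow> nat set \<Rightarrow> (nat \<times> nat) set" where
  "nest c I = (\<lambda>u. (u, c - u)) ` I"

lemma nest_nc_sets:
  assumes "\<And>u. u \<in> I \<Longrightarrow> 1 \<le> u \<and> u < c - u \<and> c - u \<le> n"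
  shows "nest c I \<in> nc_sets n"
proof (rule nc_setsI)
  have m: "(a, b) \<in> nest c I \<longleftrightarrow> a \<in> I \<and> b = c - a" for a b by (auto simp: nest_def)
  fix a b d f
  show "(a, b) \<in> nest c I \<Longrightarrow> 1 \<le> a \<and> a < b \<and> b \<le> n" using assms[of a] by (simp add: m)
  show "\<lbrakk>(a, b) \<in> nest c I; (b, d) \<in> nest c I\<rbrakk> \<Longrightarrow> (a, d) \<in> nest c I"
    using assms[of a] assms[of b] by (simp add: m) arith
  show "\<lbrakk>(a, b) \<in> nest c I; (a, d) \<in> nest c I; b < d\<rbrakk> \<Longrightarrow> (b, d) \<in> nest c I" by (simp add: m)
  show "\<lbrakk>(a, d) \<in> nest c I; (b, d) \<in> nest c I; a < b\<rbrakk> \<Longrightarrow> (a, b) \<in> nest c I"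
    using assms[of a] assms[of b] by (auto simp: m)
  show "\<lbrakk>a < b; b < d; d < f; (a, d) \<in> nest c I; (b, f) \<in> nest c I\<rbrakk> \<Longrightarrow> (a, b) \<in> nest c I"
    using assms[of a] assms[of b] by (auto simp: m)
qed

lemma nc_quo_nest:
  assumes "\<And>u. u \<in> I \<Longrightarrow> u < c - u" "k \<in> I"
  shows "nc_quo (D k (c - k)) (nest c I) = nest c (I - {k})"
proof -
  have "(k \<le> u \<and> u < c - k) = (k \<le> c - u \<and> c - u < c - k) \<longleftrightarrow> u \<noteq> k" if "u \<in> I" for u
    using assms(1)[OF that] assms(1)[OF assms(2)] by auto
  then show ?thesis by (auto simp: nest_def)
qed

text \<open>A cut removes pairs without relabelling points, so the cuts of a word act as independent
  conditions.\<close>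

lemma quo_nc_quo:
  "set w \<subseteq> range (case_prod D) \<Longrightarrow>
    quo nc_quo z w = {(a, b) \<in> z. \<forall>i j. D i j \<in> set w \<longrightarrow> (i \<le> a \<and> a < j) = (i \<le> b \<and> b < j)}"
  by (induction w arbitrary: z) auto

context dual_braid
begin

lemma D_gen [simp]: "D i j \<in> G \<longleftrightarrow> 1 \<le> i \<and> i < j \<and> j \<le> n"
  by (simp add: Dual_gens)

lemma nest_word:
  assumes I: "\<And>u. u \<in> I \<Longrightarrow> 1 \<le> u \<and> u < c - u \<and> c - u \<le> n" and xs: "distinct xs" "set xs \<subseteq> I"
  shows "word_of (nest c (set xs)) (map (\<lambda>u. D u (c - u)) xs)"
proof -
  let ?f = "\<lambda>u. D u (c - u)"
  have im: "gpair ` ?f ` J = nest c J" for J by (auto simp: nest_def image_image)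
  have "word_of (gpair ` set (map ?f xs)) (map ?f xs)"
  proof (rule word_of_atoms[where Y = "?f ` I"])
    fix X assume "X \<subseteq> ?f ` I"
    then obtain J where J: "X = ?f ` J" "J \<subseteq> I" by (auto simp: subset_image_iff)
    show "gpair ` X \<in> nc_sets n"
      unfolding J(1) im using I J by (intro nest_nc_sets) blast
    fix s assume "s \<in> X"
    then obtain k where k: "s = ?f k" "k \<in> J" using J by auto
    have "nc_quo s (nest c J) = nest c (J - {k})"
      unfolding k using I J k by (intro nc_quo_nest) blast+
    moreover have "?f ` J - {?f k} = ?f ` (J - {k})" by auto
    ultimately show "nc_quo s (gpair ` X) = gpair ` (X - {s})" unfolding J(1) k(1) im by (simp only: im)
  qed (use I xs in \<open>auto simp: distinct_map inj_on_def\<close>)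
  then show ?thesis by (simp only: set_map im)
qed

lemma len_DX_nest:
  assumes I: "\<And>u. u \<in> I \<Longrightarrow> 1 \<le> u \<and> u < c - u \<and> c - u \<le> n" and X: "X \<subseteq> (\<lambda>u. D u (c - u)) ` I"
  shows "len (DX X) = card X"
proof -
  let ?f = "\<lambda>u. D u (c - u)"
  obtain J where J: "X = ?f ` J" "J \<subseteq> I" using X by (auto simp: subset_image_iff)
  have fin: "finite J" using J I by (intro finite_subset[of J "{..n}"]) force+
  obtain xs where xs: "distinct xs" "set xs = J" using finite_distinct_list[OF fin] by blast
  have im: "gpair ` X = nest c J" using J(1) by (simp add: nest_def image_image)
  have w: "word_of (nest c J) (map ?f xs)" using nest_word[of I c xs] I J xs by auto
  have "len (DX X) = length (map ?f xs)"
  proof (rule len_DX_word[OF _ _ _ _ w])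
    show "nest c J \<in> nc_sets n" using I J by (intro nest_nc_sets) blast
    show "X \<subseteq> G" using J I by auto
  qed (use im in auto)
  also have "\<dots> = card X" using xs J(1) distinct_card[OF xs(1)] by (simp add: card_image inj_on_def)
  finally show ?thesis .
qed

lemma Rset_D:
  assumes "1 \<le> i" "i < j" "j \<le> n" "1 \<le> a" "a < b" "b \<le> n"
  shows "D a b \<in> Rset Dual n (ge (D i j)) \<longleftrightarrow> (i \<le> a \<and> a < j) \<noteq> (i \<le> b \<and> b < j)"
  using Rset_el[OF atom_Z word_of_atom, of "D i j" "D a b"] assms
  by (auto simp: pairs_def el_atom[of "D i j", symmetric])

lemma D_step:
  assumes "1 \<le> i" "i < j" "j \<le> n" "1 \<le> a" "a < b" "b \<le> n" "(i \<le> a \<and> a < j) \<noteq> (i \<le> b \<and> b < j)"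
  shows "(ge (D i j), ge (D a b)) \<in> arrows\<^sup>*"
  using Rset_D[OF assms(1-6)] Lset_gelt[of "D a b"] assms
  by (intro arrowsI) (auto simp: arrow_def gelt_Simples)

text \<open>By \<open>D_step\<close> there is an arrow from \<open>D i j\<close> to every arc with
  exactly one end in \<open>[i, j)\<close>. The target is chosen because
  \<open>[1, n div 2 + 1)\<close> separates the ends of all nested arcs
  \<open>(u, n + 1 - u)\<close>.\<close>

lemma D_reach:
  assumes "3 \<le> n" "1 \<le> i" "i < j" "j \<le> n"
  shows "(ge (D i j), ge (D 1 (n div 2 + 1))) \<in> arrows\<^sup>*"
proof -
  have 1: "(ge (D 1 c), ge (D 1 n)) \<in> arrows\<^sup>*" if "2 \<le> c" "c \<le> n" for c
    using that by (intro D_step) auto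
  have "(ge (D i j), ge (D 1 n)) \<in> arrows\<^sup>*"
  proof (cases "j = 2")
    case True
    then have "i = 1" using assms by simp
    show ?thesis unfolding \<open>i = 1\<close> True using 1[of 2] assms(1) by simp
  next
    case False
    have "(ge (D i j), ge (D (j - 1) j)) \<in> arrows\<^sup>*" using assms by (intro D_step) auto
    also have "(ge (D (j - 1) j), ge (D 1 (j - 1))) \<in> arrows\<^sup>*" using assms False by (intro D_step) auto
    also have "(ge (D 1 (j - 1)), ge (D 1 n)) \<in> arrows\<^sup>*" using assms False by (intro 1) auto
    finally show ?thesis .
  qed
  \<comment> \<open>The detour through \<open>D 2 n\<close> is made because \<open>[2, n)\<close>
    contains \<open>n div 2 + 1\<close> but not 1, whereas \<open>[1, n)\<close> contains
    both.\<close>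
  also have "(ge (D 1 n), ge (D 2 n)) \<in> arrows\<^sup>*" using assms by (intro D_step) auto
  also have "(ge (D 2 n), ge (D 1 (n div 2 + 1))) \<in> arrows\<^sup>*" using assms by (intro D_step) auto
  finally show ?thesis .
qed

text \<open>Any two sides of the triangle have the whole triangle as join, of length 2, so the
  polynomial is \<open>1 - 3t + (3 - 1)t^2\<close>, with value -1/8 at 3/4.\<close>

lemma moebius_neg: "3 \<le> n \<Longrightarrow> moebius {D 1 2, D 2 3, D 1 3} (3/4) < 0"
proof -
  assume n: "3 \<le> n"
  let ?j = "{(1, 2), (2, 3), (1, 3::nat)} :: (nat \<times> nat) set"
  have l: "len (DX X) = 2"
    if X: "X \<subseteq> {D 1 2, D 2 3, D 1 3}" and j: "\<And>z. z \<in> nc_sets n \<Longrightarrow> gpair ` X \<subseteq> z \<Longrightarrow> ?j \<subseteq> z" for X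
  proof -
    have "len (DX X) = length [D 1 2, D 2 3]"
    proof (rule len_DX_word)
      show "?j \<in> nc_sets n" "word_of ?j [D 1 2, D 2 3]"
        using triangle_nc_sets[of 1 2 3 n] triangle_words(1)[of 1 2 3 n] n by auto
      show "X \<subseteq> G" using X n by auto
      show "gpair ` X \<subseteq> ?j" using X by auto
    qed (use j in blast)
    then show ?thesis by simp
  qed
  have "len (DX {D 1 2, D 2 3}) = 2" using nc_setsD(4)[of _ n 1 2 3] by (intro l) auto
  moreover have "len (DX {D 1 2, D 1 3}) = 2" using nc_setsD(5)[of _ n 1 2 3] by (intro l) auto
  moreover have "len (DX {D 2 3, D 1 3}) = 2" using nc_setsD(6)[of _ n 1 3 2] by (intro l) auto
  moreover have "len (DX {D 1 2, D 2 3, D 1 3}) = 2" by (intro l) auto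
  moreover have "Pow {D 1 2, D 2 3, D 1 3} = {{}, {D 1 2}, {D 2 3}, {D 1 3}, {D 1 2, D 2 3},
      {D 1 2, D 1 3}, {D 2 3, D 1 3}, {D 1 2, D 2 3, D 1 3}}"
    by (auto simp: Pow_insert)
  moreover have "len (DX {}) = 0" "len (DX {D 1 2}) = 1" "len (DX {D 2 3}) = 1" "len (DX {D 1 3}) = 1"
    using len_DX_empty len_DX_single n by auto
  ultimately show ?thesis
    by (simp add: moebius_def doubleton_eq_iff insert_eq_iff power2_eq_square)
qed

lemma ergodic: ergodic
  unfolding ergodic_def
proof
  fix s assume "s \<in> G"
  then obtain i j where ij: "s = D i j" "1 \<le> i" "i < j" "j \<le> n" by (auto simp: Dual_gens)
  let ?f = "\<lambda>u. D u (Suc n - u)" and ?xs = "[1..<Suc (n div 2)]"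
  let ?z = "nest (Suc n) {1..n div 2}"
  have st: "set ?xs = {1..n div 2}" by auto
  have I: "1 \<le> u \<and> u < Suc n - u \<and> Suc n - u \<le> n" if "u \<in> {1..n div 2}" for u
    using that by auto
  have z: "?z \<in> nc_sets n" using nest_nc_sets[OF I] .
  have w: "word_of ?z (map ?f ?xs)"
    using nest_word[OF I distinct_upt eq_refl[OF st]] unfolding st .
  let ?y = "el ?z"
  let ?Y = "G - Rset Dual n ?y" and ?I = "{u. 1 \<le> u \<and> u < n - u}"
  have Y: "?Y \<subseteq> (\<lambda>u. D u (n - u)) ` ?I"
  proof
    fix t assume t: "t \<in> ?Y"
    then obtain u v where uv: "t = D u v" "1 \<le> u" "u < v" "v \<le> n" by (auto simp: Dual_gens)
    have "gpair t \<in> quo nc_quo (pairs n) (map ?f ?xs)" using t Rset_el[OF z w, of t] by blast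
    then have K: "(a \<le> u \<and> u < Suc n - a) = (a \<le> v \<and> v < Suc n - a)" if "a \<in> {1..n div 2}" for a
      using that uv(1) st by (subst (asm) quo_nc_quo) (auto simp del: upt_Suc)
    \<comment> \<open>An arc with \<open>u + v < n\<close> is cut by the nested arc that starts at
      \<open>u + 1\<close>, one with \<open>u + v > n\<close> by the nested arc that ends at
      \<open>v\<close>. Only arcs with \<open>u + v = n\<close> can remain.\<close>
    have "\<not> u + v < n"
    proof
      assume lt: "u + v < n"
      then have "u + 1 \<in> {1..n div 2}" using uv by auto
      from K[OF this] show False using lt uv by simp
    qed
    moreover have "\<not> n < u + v"
    proof
      assume lt: "n < u + v"
      then have "n - v + 1 \<in> {1..n div 2}" using uv by auto
      from K[OF this] show False using lt uv by simp
    qed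
    ultimately have "v = n - u" by linarith
    then show "t \<in> (\<lambda>u. D u (n - u)) ` ?I" using uv by auto
  qed
  have "len (DX X) = card X" if "X \<subseteq> ?Y" for X
    by (rule len_DX_nest[of ?I n]) (use that Y in auto)
  moreover have "?Y = {} \<or> (\<exists>Y \<subseteq> G. moebius Y (3/4) < 0)"
  proof (cases "n = 2")
    case True
    then have "?I = {}" by auto
    then show ?thesis using Y by blast
  next
    case False
    then show ?thesis using moebius_neg n2 by (intro disjI2 exI[of _ "{D 1 2, D 2 3, D 1 3}"]) auto
  qed
  moreover have "(ge s, ?y) \<in> arrows\<^sup>*"
  proof -
    have "(ge s, ge (D 1 (n div 2 + 1))) \<in> arrows\<^sup>*"
    proof (cases "n = 2")
      case True
      then have "i = 1" "j = 2" using ij by auto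
      then have "s = D 1 (n div 2 + 1)" using True ij(1) by simp
      then show ?thesis by (simp only: rtrancl.rtrancl_refl)
    next
      case False
      then show ?thesis using D_reach[of i j] ij n2 by simp
    qed
    also have "arrow Dual n (ge (D 1 (n div 2 + 1))) ?y"
    proof (rule arrow_elI[OF z])
      fix t assume "t \<in> G" "gpair t \<in> ?z"
      then obtain u where u: "t = ?f u" "u \<in> {1..n div 2}" by (auto simp: Dual_gens nest_def)
      show "t \<in> Rset Dual n (ge (D 1 (n div 2 + 1)))"
        unfolding u(1) using I[OF u(2)] u(2) n2 by (subst Rset_D) auto
    qed
    then have "(ge (D 1 (n div 2 + 1)), ?y) \<in> arrows\<^sup>*"
      using n2 el_Simples[OF z] by (intro arrowsI gelt_Simples) auto
    finally show ?thesis .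
  qed
  ultimately show "\<exists>y\<in>Sm. (ge s, y) \<in> arrows\<^sup>* \<and> (\<forall>X\<subseteq>G - Rset Dual n y. len (DX X) = card X) \<and>
       (G - Rset Dual n y = {} \<or> (\<exists>Y\<subseteq>G. moebius Y (3 / 4) < 0))"
    using el_Simples[OF z] by blast
qed

end

theorem theorem4p11:
  fixes K :: mkind and n :: nat and p :: real and \<nu> :: "(nat \<Rightarrow> elt) measure"
  assumes "n \<ge> 2" and "0 < p" and "ereal p \<le> qn K n"
    and "unif_measure K n p \<nu>"
  defines "V \<equiv> (if ereal p < qn K n then Simples K n else Simples K n - {unit_e K n})"
  shows
    \<comment> \<open>(1) the chain takes values in V\<close>
    "measure \<nu> {xi \<in> space \<nu>. \<forall>k. xi k \<in> V} = 1
   \<and> \<comment> \<open>(1)+(3) Markov chain with initial law h and transition matrix P: finite-dimensional laws\<close>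
     (\<forall>k \<ge> 1. \<forall>x. (\<forall>i<k. x i \<in> V) \<longrightarrow>
        measure \<nu> {xi \<in> space \<nu>. \<forall>i<k. xi i = x i}
          = hfun K n p (x 0) * (\<Prod>i<k - 1. trans_mat K n p (x i) (x (Suc i))))
   \<and> (\<forall>x \<in> V. (\<Sum>x' \<in> V. trans_mat K n p x x') = 1)
   \<and> \<comment> \<open>(2) initial distribution h\<close>
     (\<forall>x \<in> Simples K n. measure \<nu> {xi \<in> space \<nu>. xi 0 = x} = hfun K n p x)
   \<and> (\<forall>x \<in> Simples K n. hfun K n p x \<ge> 0)
   \<and> (\<Sum>x \<in> Simples K n. hfun K n p x) = 1
   \<and> (\<forall>x \<in> Simples K n - {unit_e K n}. hfun K n p x > 0)
   \<and> (hfun K n p (unit_e K n) > 0 \<longleftrightarrow> ereal p < qn K n)"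
proof (cases K)
  case Classical
  interpret C: classical_braid n by unfold_locales (rule assms(1))
  interpret uniform_garside Classical n "inv_sets n" "pairs n" gpair inv_quo p \<nu>
    by unfold_locales (use assms(4) Classical in simp)
  have "ereal p \<le> qn Classical n" using assms(3) Classical by simp
  from uniform_markov_chain[OF assms(2) this C.ergodic] show ?thesis
    unfolding V_def Classical .
next
  case Dual
  interpret C: dual_braid n by unfold_locales (rule assms(1))
  interpret uniform_garside Dual n "nc_sets n" "pairs n" gpair nc_quo p \<nu>
    by unfold_locales (use assms(4) Dual in simp)
  have "ereal p \<le> qn Dual n" using assms(3) Dual by simp
  from uniform_markov_chain[OF assms(2) this C.ergodic] show ?thesis
    unfolding V_def Dual .
qed

end
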